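(* Let $V$ be a complex vector space with $n=\dim V$, let $q$ be a positive integer, and let $G$ be a finite group of graded automorphisms of $S_q[V^*]$. Then $(G,q)$ is a projective reflection group if and only if the invariant algebra $S_q[V^*]^G$ is generated by $n$ algebraically independent homogeneous elements.
   Context: $S_q[V^*]$ denotes the subalgebra of the algebra $S[V^*]$ of polynomial functions on $V$ generated by the homogeneous polynomial functions of degree $q$. A (complex) reflection is an element of $GL(V)$ of finite order whose fixed space has codimension 1; a finite reflection group is a finite subgroup of $GL(V)$ generated by reflections. Let $C_q$ be the group of scalar matrices generated by $e^{2\pi i/q}I$. $GL(V)$ acts naturally on $S_q[V^*]$ (equivalently, via the natural map $GL(V)\to GL(S^q(V))$ and its dual action), with kernel $C_q$. The pair $(G,q)$ is a projective reflection group if there exists a finite reflection group $W\subseteq GL(V)$ with $C_q\subseteq W$ such that $G$ is the image of $W$ (i.e. $G=W/C_q$) under this natural action. *)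

theory Defs
  imports Complex_Main "HOL-Algebra.Bij" "HOL-Algebra.Generated_Groups" "HOL-Library.Poly_Mapping"
begin

text \<open>
  A complex vector space \<open>V\<close> is given by a type of class \<^class>\<open>ab_group_add\<close> together with its
  scalar multiplication \<open>s\<close>, as in the locale \<^locale>\<open>vector_space\<close>.  Functions on \<open>V\<close> form an
  algebra under the pointwise operations; all algebras below are unital.
\<close>

inductive_set generated_algebra :: "('v \<Rightarrow> complex) set \<Rightarrow> ('v \<Rightarrow> complex) set"
  for A :: "('v \<Rightarrow> complex) set" where
  gen: "f \<in> A \<Longrightarrow> f \<in> generated_algebra A"
| const: "(\<lambda>v. c) \<in> generated_algebra A"
| add: "f \<in> generated_algebra A \<Longrightarrow> g \<in> generated_algebra A
    \<Longrightarrow> (\<lambda>v. f v + g v) \<in> generated_algebra A"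
| mult: "f \<in> generated_algebra A \<Longrightarrow> g \<in> generated_algebra A
    \<Longrightarrow> (\<lambda>v. f v * g v) \<in> generated_algebra A"

definition polynomial_functions ::
  "(complex \<Rightarrow> 'v::ab_group_add \<Rightarrow> 'v) \<Rightarrow> ('v \<Rightarrow> complex) set" where
  "polynomial_functions s = generated_algebra {l. Vector_Spaces.linear s (*) l}"

definition homogeneous_polynomials ::
  "(complex \<Rightarrow> 'v::ab_group_add \<Rightarrow> 'v) \<Rightarrow> nat \<Rightarrow> ('v \<Rightarrow> complex) set" where
  "homogeneous_polynomials s d =
     {f \<in> polynomial_functions s. \<forall>c v. f (s c v) = c ^ d * f v}"

definition Sq :: "(complex \<Rightarrow> 'v::ab_group_add \<Rightarrow> 'v) \<Rightarrow> nat \<Rightarrow> ('v \<Rightarrow> complex) set" where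
  "Sq s q = generated_algebra (homogeneous_polynomials s q)"

text \<open>
  The grading of \<open>S\<^sub>q[V\<^sup>*]\<close> is the one inherited from the algebra of polynomial functions.
  Membership in \<^const>\<open>Bij\<close> makes an automorphism extensional, i.e. \<^const>\<open>undefined\<close>
  outside \<open>S\<^sub>q[V\<^sup>*]\<close>, so that automorphisms are determined by their values on this algebra.
\<close>

definition graded_automorphisms ::
  "(complex \<Rightarrow> 'v::ab_group_add \<Rightarrow> 'v) \<Rightarrow> nat \<Rightarrow> (('v \<Rightarrow> complex) \<Rightarrow> ('v \<Rightarrow> complex)) set" where
  "graded_automorphisms s q = {\<phi> \<in> Bij (Sq s q).
     \<phi> (\<lambda>v. 1) = (\<lambda>v. 1) \<and>
     (\<forall>c. \<forall>f\<in>Sq s q. \<phi> (\<lambda>v. c * f v) = (\<lambda>v. c * \<phi> f v)) \<and>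
     (\<forall>f\<in>Sq s q. \<forall>g\<in>Sq s q. \<phi> (\<lambda>v. f v + g v) = (\<lambda>v. \<phi> f v + \<phi> g v)) \<and>
     (\<forall>f\<in>Sq s q. \<forall>g\<in>Sq s q. \<phi> (\<lambda>v. f v * g v) = (\<lambda>v. \<phi> f v * \<phi> g v)) \<and>
     (\<forall>d. \<phi> ` (Sq s q \<inter> homogeneous_polynomials s d) = Sq s q \<inter> homogeneous_polynomials s d)}"

definition graded_automorphism_group ::
  "(complex \<Rightarrow> 'v::ab_group_add \<Rightarrow> 'v) \<Rightarrow> nat \<Rightarrow> (('v \<Rightarrow> complex) \<Rightarrow> ('v \<Rightarrow> complex)) monoid" where
  "graded_automorphism_group s q = BijGroup (Sq s q) \<lparr>carrier := graded_automorphisms s q\<rparr>"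

definition GL_group :: "(complex \<Rightarrow> 'v::ab_group_add \<Rightarrow> 'v) \<Rightarrow> ('v \<Rightarrow> 'v) monoid" where
  "GL_group s = BijGroup UNIV \<lparr>carrier := {g. Vector_Spaces.linear s s g \<and> bij g}\<rparr>"

text \<open>
  The codimension is stated additively, to avoid the truncated subtraction on \<^typ>\<open>nat\<close>.
\<close>

definition is_reflection :: "(complex \<Rightarrow> 'v::ab_group_add \<Rightarrow> 'v) \<Rightarrow> ('v \<Rightarrow> 'v) \<Rightarrow> bool" where
  "is_reflection s g \<longleftrightarrow> g \<in> carrier (GL_group s) \<and> (\<exists>k>0. g ^^ k = id) \<and>
     vector_space.dim s {v. g v = v} + 1 = vector_space.dim s UNIV"

definition finite_reflection_group ::
  "(complex \<Rightarrow> 'v::ab_group_add \<Rightarrow> 'v) \<Rightarrow> ('v \<Rightarrow> 'v) set \<Rightarrow> bool" where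
  "finite_reflection_group s W \<longleftrightarrow> subgroup W (GL_group s) \<and> finite W \<and>
     (\<exists>R. (\<forall>g\<in>R. is_reflection s g) \<and> W = generate (GL_group s) R)"

definition Cq :: "(complex \<Rightarrow> 'v::ab_group_add \<Rightarrow> 'v) \<Rightarrow> nat \<Rightarrow> ('v \<Rightarrow> 'v) set" where
  "Cq s q = generate (GL_group s) {s (exp (2 * of_real pi * \<i> / of_nat q))}"

definition natural_action ::
  "(complex \<Rightarrow> 'v::ab_group_add \<Rightarrow> 'v) \<Rightarrow> nat \<Rightarrow> ('v \<Rightarrow> 'v) \<Rightarrow> (('v \<Rightarrow> complex) \<Rightarrow> ('v \<Rightarrow> complex))"
  where "natural_action s q g = (\<lambda>f\<in>Sq s q. \<lambda>v. f ((inv\<^bsub>GL_group s\<^esub> g) v))"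

definition projective_reflection_group ::
  "(complex \<Rightarrow> 'v::ab_group_add \<Rightarrow> 'v) \<Rightarrow> (('v \<Rightarrow> complex) \<Rightarrow> ('v \<Rightarrow> complex)) set \<Rightarrow> nat \<Rightarrow> bool"
  where "projective_reflection_group s G q \<longleftrightarrow>
    (\<exists>W. finite_reflection_group s W \<and> Cq s q \<subseteq> W \<and> G = natural_action s q ` W)"

definition invariant_algebra ::
  "(complex \<Rightarrow> 'v::ab_group_add \<Rightarrow> 'v) \<Rightarrow> nat \<Rightarrow> (('v \<Rightarrow> complex) \<Rightarrow> ('v \<Rightarrow> complex)) set
     \<Rightarrow> ('v \<Rightarrow> complex) set" where
  "invariant_algebra s q G = {f \<in> Sq s q. \<forall>\<phi>\<in>G. \<phi> f = f}"

text \<open>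
  A polynomial in the variables \<open>x\<^sub>0, x\<^sub>1, \<dots>\<close> is a finitely supported family of coefficients,
  indexed by monomials; a monomial is a finitely supported family of exponents.
\<close>

definition eval_mpoly :: "(nat \<Rightarrow> complex) \<Rightarrow> ((nat \<Rightarrow>\<^sub>0 nat) \<Rightarrow>\<^sub>0 complex) \<Rightarrow> complex" where
  "eval_mpoly x P =
     (\<Sum>m\<in>Poly_Mapping.keys P. Poly_Mapping.lookup P m *
        (\<Prod>i\<in>Poly_Mapping.keys m. x i ^ Poly_Mapping.lookup m i))"

definition algebraically_independent :: "nat \<Rightarrow> (nat \<Rightarrow> 'v \<Rightarrow> complex) \<Rightarrow> bool" where
  "algebraically_independent n F \<longleftrightarrow>
     (\<forall>P. (\<forall>m\<in>Poly_Mapping.keys P. Poly_Mapping.keys m \<subseteq> {..<n}) \<longrightarrow>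
          (\<forall>v. eval_mpoly (\<lambda>i. F i v) P = 0) \<longrightarrow> P = 0)"

end

theory Submission
  imports Defs "HOL-Library.Function_Algebras" "HOL-Computational_Algebra.Fundamental_Theorem_Algebra"
    "Jordan_Normal_Form.Determinant"
begin

text \<open>
  A graded automorphism \<open>\<phi>\<close> of the Veronese algebra is induced by a linear map: on a generic line the
  roots of \<open>\<phi>(x\<^sub>i\<^sup>q)\<close> have multiplicity divisible by \<open>q\<close>, so \<open>\<phi>(x\<^sub>i\<^sup>q)\<close> is a \<open>q\<close>-th power of a linear form.
  Hence \<open>G\<close> is the image of a finite linear group \<open>W\<close> containing \<open>C\<^sub>q\<close>, with the same invariants, and the
  statement becomes the Chevalley--Shephard--Todd theorem for \<open>W\<close>.

  For a reflection group, homogeneous invariants that are linearly independent modulo products of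
  invariants without constant term are algebraically independent (Chevalley's argument), so there
  are at most \<open>n\<close> of them, and by the graded Nakayama lemma a maximal family generates.

  Conversely, let \<open>H\<close> be the subgroup generated by the reflections of \<open>W\<close>, and express the generators
  \<open>f\<close> of the \<open>W\<close>-invariants in the generators \<open>h\<close> of the \<open>H\<close>-invariants. The Jacobian determinant of \<open>f\<close>
  with respect to \<open>h\<close> does not vanish at points whose stabilizer lies in \<open>H\<close>. The other points lie
  on subspaces of codimension at least two, so the determinant has no zero on a generic line and
  is constant. Invertibility at the origin gives \<open>H\<close>-invariants = \<open>W\<close>-invariants, whence \<open>H = W\<close>.
\<close>

section \<open>Algebras of functions and their gradings\<close>

text \<open>All rings here consist of functions. Homogeneous components are coefficients of
  restrictions to rays, derivatives are complex derivatives, and general position is exploited by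
  restricting to a line, where one-variable polynomials and the fundamental theorem of algebra
  apply. Multiplicities are divisible by \<open>q\<close> because \<phi>(x_i^(q-1) x_j)^q =
  \<phi>(x_i^q)^(q-1) \<phi>(x_j^q), and the functions \<phi>(x_j^q) vanish together only at the
  origin. The linear group is finite because a lift is determined by q-th roots of finitely many
  functions. Chevalley's argument bounds the number of generators by \<open>n\<close> only from
  above. The bound from below comes from a point with trivial stabilizer, where the differentials of
  the invariants span the dual space. The same construction, carried out relative to a subgroup
  \<open>H\<close>, makes the Jacobian nonzero in the converse. The last step, from equal invariants
  to equal groups, separates a regular orbit by an \<open>H\<close>-invariant.\<close>

lemma sum_fun_apply: "(\<Sum>i\<in>I. f i) v = (\<Sum>i\<in>I. f i v)"
  for f :: "'i \<Rightarrow> 'a \<Rightarrow> 'b::comm_monoid_add"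
  by (induction I rule: infinite_finite_induct) auto

lemma prod_fun_apply: "(\<Prod>i\<in>I. f i) v = (\<Prod>i\<in>I. f i v)"
  for f :: "'i \<Rightarrow> 'a \<Rightarrow> 'b::comm_monoid_mult"
  by (induction I rule: infinite_finite_induct) auto

lemma prod_list_fun_apply: "prod_list fs v = (\<Prod>f\<leftarrow>fs. f v)"
  for fs :: "('a \<Rightarrow> 'b::comm_monoid_mult) list"
  by (induction fs) auto

lemma power_fun_apply: "(f ^ k) v = f v ^ k"
  for f :: "'a \<Rightarrow> 'b::comm_semiring_1"
  by (induction k) auto

definition fscale :: "complex \<Rightarrow> ('a \<Rightarrow> complex) \<Rightarrow> 'a \<Rightarrow> complex" where
  "fscale c f = (\<lambda>v. c * f v)"

lemma fscale_apply: "fscale c f v = c * f v"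
  by (simp add: fscale_def)

text \<open>As simplification rules the pointwise laws would rewrite eta-expanded occurrences of \<open>f + g\<close>
  and thereby destroy the algebraic form of function-valued goals.\<close>

declare plus_fun_apply [simp del] times_fun_apply [simp del] zero_fun_apply [simp del]
  one_fun_apply [simp del] minus_apply [simp del] uminus_apply [simp del]

lemmas fapply = plus_fun_apply times_fun_apply zero_fun_apply one_fun_apply minus_apply uminus_apply
  sum_fun_apply prod_fun_apply prod_list_fun_apply power_fun_apply fscale_apply

global_interpretation fv: vector_space fscale
  by unfold_locales (auto simp: fun_eq_iff fapply algebra_simps)

lemma fv_sum_apply: "(\<Sum>i\<in>I. fscale (c i) (f i)) v = (\<Sum>i\<in>I. c i * f i v)"
  by (simp add: fapply)

lemma ga_add: "f \<in> generated_algebra A \<Longrightarrow> g \<in> generated_algebra A \<Longrightarrow> f + g \<in> generated_algebra A"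
  using generated_algebra.add by (simp add: plus_fun_def)

lemma ga_mult: "f \<in> generated_algebra A \<Longrightarrow> g \<in> generated_algebra A \<Longrightarrow> f * g \<in> generated_algebra A"
  using generated_algebra.mult by (simp add: times_fun_def)

lemma ga_zero: "0 \<in> generated_algebra A"
  using generated_algebra.const[of 0] by (simp add: zero_fun_def)

lemma ga_one: "1 \<in> generated_algebra A"
  using generated_algebra.const[of 1] by (simp add: one_fun_def)

lemma ga_scale: "f \<in> generated_algebra A \<Longrightarrow> fscale c f \<in> generated_algebra A"
  using generated_algebra.mult[OF generated_algebra.const[of c]] by (simp add: fscale_def)

lemma ga_uminus: "f \<in> generated_algebra A \<Longrightarrow> - f \<in> generated_algebra A"
  using ga_scale[of f A "-1"] by (simp add: fun_eq_iff fapply fscale_def fun_Compl_def)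

lemma ga_diff: "f \<in> generated_algebra A \<Longrightarrow> g \<in> generated_algebra A \<Longrightarrow> f - g \<in> generated_algebra A"
  using ga_add[OF _ ga_uminus, of f A g] by simp

lemma ga_sum: "(\<And>i. i \<in> I \<Longrightarrow> f i \<in> generated_algebra A) \<Longrightarrow> (\<Sum>i\<in>I. f i) \<in> generated_algebra A"
  by (induction I rule: infinite_finite_induct) (auto intro: ga_add ga_zero)

lemma ga_prod: "(\<And>i. i \<in> I \<Longrightarrow> f i \<in> generated_algebra A) \<Longrightarrow> (\<Prod>i\<in>I. f i) \<in> generated_algebra A"
  by (induction I rule: infinite_finite_induct) (auto intro: ga_mult ga_one)

lemma ga_prod_list: "set fs \<subseteq> generated_algebra A \<Longrightarrow> prod_list fs \<in> generated_algebra A"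
  by (induction fs) (auto intro: ga_mult ga_one)

lemma ga_power: "f \<in> generated_algebra A \<Longrightarrow> f ^ k \<in> generated_algebra A"
  by (induction k) (auto intro: ga_mult ga_one)

lemma ga_span:
  assumes "f \<in> fv.span X" "X \<subseteq> generated_algebra A"
  shows "f \<in> generated_algebra A"
  using assms(1) by (induction rule: fv.span_induct_alt) (use assms(2) in \<open>auto intro: ga_zero ga_add ga_scale\<close>)

lemma ga_subset:
  assumes "A \<subseteq> generated_algebra B"
  shows "generated_algebra A \<subseteq> generated_algebra B"
proof
  fix f assume "f \<in> generated_algebra A"
  then show "f \<in> generated_algebra B"
    by induction (use assms in \<open>auto intro: generated_algebra.intros\<close>)
qed

lemma ga_subsetI:
  assumes "A \<subseteq> K" and "\<And>c. (\<lambda>v. c) \<in> K"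
    and "\<And>f g. f \<in> K \<Longrightarrow> g \<in> K \<Longrightarrow> f + g \<in> K" and "\<And>f g. f \<in> K \<Longrightarrow> g \<in> K \<Longrightarrow> f * g \<in> K"
  shows "generated_algebra A \<subseteq> K"
proof
  fix f assume "f \<in> generated_algebra A"
  then show "f \<in> K"
    by induction (use assms in \<open>auto simp: plus_fun_def times_fun_def\<close>)
qed

lemma span_scale_add: "f \<in> fv.span S \<Longrightarrow> g \<in> fv.span S \<Longrightarrow> fscale c f + g \<in> fv.span S"
  by (intro fv.span_add fv.span_scale)

text \<open>Products of lists concatenate, so their span is closed under multiplication. Statements
  about the algebra can then be proved by linear induction over monomials.\<close>

lemma ga_span_prod_list: "generated_algebra A \<subseteq> fv.span {prod_list fs |fs. set fs \<subseteq> A}"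
    (is "_ \<subseteq> fv.span ?M")
proof (rule ga_subsetI)
  show "A \<subseteq> fv.span ?M"
  proof
    fix f assume "f \<in> A"
    then have "prod_list [f] \<in> ?M" by (intro CollectI exI[of _ "[f]"]) auto
    then have "prod_list [f] \<in> fv.span ?M" by (rule fv.span_base)
    then show "f \<in> fv.span ?M" by simp
  qed
next
  fix c :: complex
  have "prod_list [] \<in> ?M" by (intro CollectI exI[of _ "[]"]) auto
  then have "fscale c 1 \<in> fv.span ?M" by (simp add: fv.span_base fv.span_scale)
  then show "(\<lambda>v. c) \<in> fv.span ?M" by (simp add: fscale_def one_fun_def)
next
  fix f g assume f: "f \<in> fv.span ?M" and g: "g \<in> fv.span ?M"
  show "f + g \<in> fv.span ?M" using f g by (rule fv.span_add)
  have base: "p * h \<in> fv.span ?M" if p: "p \<in> ?M" and h: "h \<in> fv.span ?M" for p h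
    using h
  proof (induction rule: fv.span_induct_alt)
    case base
    then show ?case by (simp add: fv.span_zero)
  next
    case (step c x y)
    obtain fs gs where *: "p = prod_list fs" "x = prod_list gs" "set fs \<subseteq> A" "set gs \<subseteq> A"
      using p step by auto
    have "p * x \<in> ?M" unfolding *
      by (intro CollectI exI[of _ "fs @ gs"]) (use * in auto)
    then have "p * x \<in> fv.span ?M" by (rule fv.span_base)
    moreover have "p * (fscale c x + y) = fscale c (p * x) + p * y"
      by (auto simp: fun_eq_iff fapply algebra_simps)
    ultimately show ?case using step(2) by (simp only: span_scale_add)
  qed
  show "f * g \<in> fv.span ?M"
    using f
  proof (induction rule: fv.span_induct_alt)
    case base
    then show ?case by (simp add: fv.span_zero)
  next
    case (step c x y)
    have "x * g \<in> fv.span ?M" using base[OF step(1) g] .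
    moreover have "(fscale c x + y) * g = fscale c (x * g) + y * g"
      by (auto simp: fun_eq_iff fapply algebra_simps)
    ultimately show ?case using step(2) by (simp only: span_scale_add)
  qed
qed

text \<open>The action is kept abstract because two gradings are needed: the usual one on functions
  on \<open>V\<close>, and a weighted one on tuples in which coordinate \<open>i\<close> has degree
  \<open>d i\<close>. The scalar 0 is included, so that the constant term is the value at
  \<open>\<sigma> 0 v\<close>.\<close>

locale scaling =
  fixes \<sigma> :: "complex \<Rightarrow> 'a \<Rightarrow> 'a"
  assumes act_mult: "\<sigma> c (\<sigma> d v) = \<sigma> (c * d) v" and act_one: "\<sigma> 1 v = v"
begin

definition homog :: "nat \<Rightarrow> ('a \<Rightarrow> complex) \<Rightarrow> bool" where
  "homog d f \<longleftrightarrow> (\<forall>c v. f (\<sigma> c v) = c ^ d * f v)"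

definition polylike :: "('a \<Rightarrow> complex) \<Rightarrow> bool" where
  "polylike f \<longleftrightarrow> (\<forall>v. \<exists>p. \<forall>c. f (\<sigma> c v) = poly p c)"

definition ray_poly :: "('a \<Rightarrow> complex) \<Rightarrow> 'a \<Rightarrow> complex poly" where
  "ray_poly f v = (THE p. \<forall>c. f (\<sigma> c v) = poly p c)"

text \<open>The component of degree \<open>d\<close> at \<open>v\<close> is the coefficient of c^d
  in f(\<sigma> c v). No expansion into monomials is chosen, so it is well defined without any
  linear independence of monomials.\<close>

definition hc :: "nat \<Rightarrow> ('a \<Rightarrow> complex) \<Rightarrow> 'a \<Rightarrow> complex" where
  "hc d f v = coeff (ray_poly f v) d"

lemma ray_poly_eqI:
  assumes "\<And>c. f (\<sigma> c v) = poly p c"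
  shows "ray_poly f v = p"
  unfolding ray_poly_def
  by (rule the_equality) (use assms in \<open>auto intro!: poly_ext\<close>)

lemma poly_ray_poly: "polylike f \<Longrightarrow> poly (ray_poly f v) c = f (\<sigma> c v)"
  unfolding polylike_def using ray_poly_eqI by metis

lemma polylike_ray: "polylike f \<Longrightarrow> polylike g \<Longrightarrow> polylike (f + g)"
    "polylike f \<Longrightarrow> polylike g \<Longrightarrow> polylike (f * g)" "polylike (\<lambda>v. a)"
    "polylike f \<Longrightarrow> polylike (fscale a f)"
    and ray_poly_add: "polylike f \<Longrightarrow> polylike g \<Longrightarrow> ray_poly (f + g) v = ray_poly f v + ray_poly g v"
    and ray_poly_mult: "polylike f \<Longrightarrow> polylike g \<Longrightarrow> ray_poly (f * g) v = ray_poly f v * ray_poly g v"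
    and ray_poly_const: "ray_poly (\<lambda>v. a) v = [:a:]"
    and ray_poly_scale: "polylike f \<Longrightarrow> ray_poly (fscale a f) v = Polynomial.smult a (ray_poly f v)"
proof -
  have "(f + g) (\<sigma> c v) = poly (ray_poly f v + ray_poly g v) c"
      "(f * g) (\<sigma> c v) = poly (ray_poly f v * ray_poly g v) c"
    if "polylike f" "polylike g" for f g c v
    using that by (auto simp: poly_ray_poly fapply)
  moreover have "(fscale a f) (\<sigma> c v) = poly (Polynomial.smult a (ray_poly f v)) c" if "polylike f" for f a c v
    using that by (auto simp: poly_ray_poly fapply)
  moreover have "(\<lambda>v. a) (\<sigma> c v) = poly [:a:] c" for a c v by simp
  ultimately show "polylike f \<Longrightarrow> polylike g \<Longrightarrow> polylike (f + g)"
    "polylike f \<Longrightarrow> polylike g \<Longrightarrow> polylike (f * g)" "polylike (\<lambda>v. a)"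
    "polylike f \<Longrightarrow> polylike (fscale a f)"
    "polylike f \<Longrightarrow> polylike g \<Longrightarrow> ray_poly (f + g) v = ray_poly f v + ray_poly g v"
    "polylike f \<Longrightarrow> polylike g \<Longrightarrow> ray_poly (f * g) v = ray_poly f v * ray_poly g v"
    "ray_poly (\<lambda>v. a) v = [:a:]"
    "polylike f \<Longrightarrow> ray_poly (fscale a f) v = Polynomial.smult a (ray_poly f v)"
    unfolding polylike_def by (blast intro: ray_poly_eqI)+
qed

lemma hc_add: "polylike f \<Longrightarrow> polylike g \<Longrightarrow> hc d (f + g) = hc d f + hc d g"
  by (simp add: fun_eq_iff fapply hc_def ray_poly_add)

lemma hc_scale: "polylike f \<Longrightarrow> hc d (fscale a f) = fscale a (hc d f)"
  by (simp add: fun_eq_iff fapply hc_def ray_poly_scale)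

lemma hc_mult: "polylike f \<Longrightarrow> polylike g \<Longrightarrow> hc d (f * g) = (\<Sum>e\<le>d. hc e f * hc (d - e) g)"
  by (simp add: fun_eq_iff fapply hc_def ray_poly_mult coeff_mult sum_fun_apply)

lemma polylike_zero: "polylike 0"
  using polylike_ray(3)[of 0] by (simp add: zero_fun_def)

lemma hc_zero: "hc d 0 = 0"
  using ray_poly_const[of 0] by (simp add: fun_eq_iff fapply hc_def zero_fun_def)

lemma hc_diff:
  assumes "polylike f" "polylike g"
  shows "hc d (f - g) = hc d f - hc d g"
proof -
  have eq: "f - g = f + fscale (-1) g" by (auto simp: fun_eq_iff fapply)
  show ?thesis
    unfolding eq hc_add[OF assms(1) polylike_ray(4)[OF assms(2)]] hc_scale[OF assms(2)]
    by (auto simp: fun_eq_iff fapply)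
qed

lemma polylike_sum: "(\<And>i. i \<in> I \<Longrightarrow> polylike (f i)) \<Longrightarrow> polylike (\<Sum>i\<in>I. f i)"
  by (induction I rule: infinite_finite_induct) (auto intro: polylike_ray polylike_zero)

lemma hc_sum: "(\<And>i. i \<in> I \<Longrightarrow> polylike (f i)) \<Longrightarrow> hc d (\<Sum>i\<in>I. f i) = (\<Sum>i\<in>I. hc d (f i))"
  by (induction I rule: infinite_finite_induct) (auto simp: hc_zero hc_add polylike_sum)

lemma homogD: "homog d f \<Longrightarrow> f (\<sigma> c v) = c ^ d * f v"
  by (simp add: homog_def)

lemma homog_polylike: "homog d f \<Longrightarrow> polylike f"
  unfolding polylike_def
proof
  fix v assume "homog d f"
  then show "\<exists>p. \<forall>c. f (\<sigma> c v) = poly p c"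
    by (intro exI[of _ "monom (f v) d"]) (simp add: homogD poly_monom)
qed

lemma ray_poly_homog: "homog d f \<Longrightarrow> ray_poly f v = monom (f v) d"
  by (rule ray_poly_eqI) (simp add: homogD poly_monom)

lemma hc_homog: "homog d f \<Longrightarrow> hc e f = (if e = d then f else 0)"
  by (auto simp: fun_eq_iff fapply hc_def ray_poly_homog)

lemma homog_hc:
  assumes "polylike f"
  shows "homog d (hc d f)"
  unfolding homog_def
proof (intro allI)
  fix c v
  have "ray_poly f (\<sigma> c v) = pcompose (ray_poly f v) [:0, c:]"
    by (rule ray_poly_eqI) (simp add: poly_pcompose poly_ray_poly assms act_mult)
  then show "hc d f (\<sigma> c v) = c ^ d * hc d f v"
    by (simp add: hc_def coeff_pcompose_linear)
qed

lemma homog_add: "homog d f \<Longrightarrow> homog d g \<Longrightarrow> homog d (f + g)"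
  and homog_scale: "homog d f \<Longrightarrow> homog d (fscale a f)"
  and homog_mult: "homog d f \<Longrightarrow> homog e g \<Longrightarrow> homog (d + e) (f * g)"
  and homog_const: "homog 0 (\<lambda>v. a)"
  and homog_zero: "homog d 0"
  by (auto simp: homog_def fapply algebra_simps power_add)

lemma homog_one: "homog 0 1"
  by (auto simp: homog_def fapply)

lemma homog_sum: "(\<And>i. i \<in> I \<Longrightarrow> homog d (f i)) \<Longrightarrow> homog d (\<Sum>i\<in>I. f i)"
  by (induction I rule: infinite_finite_induct) (auto intro: homog_add homog_zero)

lemma homog_prod_list: "(\<And>f. f \<in> set fs \<Longrightarrow> homog 1 f) \<Longrightarrow> homog (length fs) (prod_list fs)"
proof (induction fs)
  case (Cons f fs)
  then show ?case using homog_mult[of 1 f "length fs" "prod_list fs"] by simp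
qed (simp add: homog_one)

lemma homog_power: "homog d f \<Longrightarrow> homog (k * d) (f ^ k)"
  by (induction k) (auto intro: homog_mult homog_one)

lemma hc_mult_homog:
  assumes "homog a f" "polylike g"
  shows "hc d (f * g) = (if a \<le> d then f * hc (d - a) g else 0)"
proof -
  have "hc d (f * g) = (\<Sum>e\<le>d. if e = a then f * hc (d - a) g else 0)"
    unfolding hc_mult[OF homog_polylike[OF assms(1)] assms(2)]
    by (rule sum.cong) (auto simp: hc_homog[OF assms(1)])
  then show ?thesis by simp
qed

lemma hc_compose:
  assumes "polylike f" and "\<And>c v. k (\<sigma> c v) = \<sigma> c (k v)"
  shows "hc d (f \<circ> k) = hc d f \<circ> k" and "polylike (f \<circ> k)"
proof -
  have *: "(f \<circ> k) (\<sigma> c v) = poly (ray_poly f (k v)) c" for c v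
    by (simp add: assms poly_ray_poly)
  have "ray_poly (f \<circ> k) v = ray_poly f (k v)" for v
    by (rule ray_poly_eqI) (fact *)
  then show "hc d (f \<circ> k) = hc d f \<circ> k" by (auto simp: hc_def fun_eq_iff)
  from * show "polylike (f \<circ> k)" unfolding polylike_def by blast
qed

lemma hc_0: "polylike f \<Longrightarrow> hc 0 f v = f (\<sigma> 0 v)"
  by (simp add: hc_def poly_0_coeff_0[symmetric] poly_ray_poly)

text \<open>Homogeneous generators make the algebra stable under taking components. The last
  conjunct bounds the degree uniformly in \<open>v\<close>; \<open>polylike\<close> is a pointwise
  condition and does not give this, but \<open>hc_decomp\<close> requires it.\<close>

lemma ga_graded:
  assumes A: "\<And>f. f \<in> A \<Longrightarrow> \<exists>d. homog d f" and f: "f \<in> generated_algebra A"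
  shows "polylike f \<and> (\<forall>d. hc d f \<in> generated_algebra A) \<and> (\<exists>N. \<forall>d>N. hc d f = 0)"
  using f
proof induction
  case (gen f)
  obtain d where d: "homog d f" using A gen by blast
  show ?case using gen
    by (auto simp: hc_homog[OF d] intro: homog_polylike[OF d] ga_zero generated_algebra.gen)
next
  case (const c)
  show ?case
    by (auto simp: hc_homog[OF homog_const] intro: homog_polylike[OF homog_const] ga_zero generated_algebra.const)
next
  case (add f g)
  obtain N M where "\<forall>d>N. hc d f = 0" "\<forall>d>M. hc d g = 0" using add by auto
  then have "\<forall>d>max N M. hc d (f + g) = 0" using add by (auto simp: hc_add)
  moreover have "polylike (f + g)" "\<forall>d. hc d (f + g) \<in> generated_algebra A"
    using add by (auto simp: hc_add intro: polylike_ray ga_add)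
  ultimately show ?case unfolding plus_fun_def by blast
next
  case (mult f g)
  obtain N M where NM: "\<forall>d>N. hc d f = 0" "\<forall>d>M. hc d g = 0" using mult by auto
  have "hc d (f * g) = 0" if d: "d > N + M" for d
  proof -
    have "hc e f * hc (d - e) g = 0" for e
      using NM d by (cases "e > N") auto
    then show ?thesis using mult by (simp add: hc_mult)
  qed
  then have "\<forall>d>N + M. hc d (f * g) = 0" by auto
  moreover have "polylike (f * g)" "\<forall>d. hc d (f * g) \<in> generated_algebra A"
    using mult by (auto simp: hc_mult intro!: polylike_ray ga_mult ga_sum)
  ultimately show ?case unfolding times_fun_def by blast
qed

lemma hc_decomp:
  assumes "polylike f" and "\<And>d. d > N \<Longrightarrow> hc d f = 0"
  shows "f = (\<Sum>d\<le>N. hc d f)"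
proof
  fix v
  have deg: "degree (ray_poly f v) \<le> N"
    by (rule degree_le) (use assms(2) in \<open>auto simp: hc_def fun_eq_iff fapply\<close>)
  have "f v = poly (ray_poly f v) 1" by (simp add: poly_ray_poly assms act_one)
  also have "\<dots> = (\<Sum>d\<le>N. coeff (ray_poly f v) d)"
    unfolding poly_altdef by (rule sum.mono_neutral_cong_left) (use deg in \<open>auto simp: coeff_eq_0\<close>)
  finally show "f v = (\<Sum>d\<le>N. hc d f) v" by (simp add: fapply hc_def)
qed

text \<open>Induction on the degree: for two factors without constant term, the component of degree
  \<open>d\<close> of the product involves only components of degree strictly between 0 and
  \<open>d\<close>, and these lie in the algebra of \<open>Y\<close> by induction
  hypothesis.\<close>

lemma graded_nakayama:
  assumes X: "\<And>f. f \<in> X \<Longrightarrow> \<exists>d. homog d f" "A \<subseteq> generated_algebra X"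
    and Y: "\<And>f. f \<in> Y \<Longrightarrow> \<exists>d. homog d f"
    and dec: "\<And>f. f \<in> A \<Longrightarrow> \<exists>g\<in>generated_algebra Y.
      f - g \<in> fv.span {a * b |a b. a \<in> A \<and> b \<in> A \<and> hc 0 a = 0 \<and> hc 0 b = 0}"
  shows "A \<subseteq> generated_algebra Y"
proof -
  let ?D = "{a * b |a b. a \<in> A \<and> b \<in> A \<and> hc 0 a = 0 \<and> hc 0 b = 0}"
  have pA: "polylike f" if "f \<in> A" for f using ga_graded[OF X(1)] X(2) that by blast
  have hcB: "hc d f \<in> generated_algebra Y" if "f \<in> A" for f d
    using that
  proof (induction d arbitrary: f rule: less_induct)
    case (less d f)
    obtain g where g: "g \<in> generated_algebra Y" "f - g \<in> fv.span ?D" using dec less by blast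
    have pg: "polylike g" "hc d g \<in> generated_algebra Y" using ga_graded[OF Y g(1)] by auto
    have ab: "hc d (a * b) \<in> generated_algebra Y"
      if "a \<in> A" "b \<in> A" "hc 0 a = 0" "hc 0 b = 0" for a b
    proof -
      have "hc e a * hc (d - e) b \<in> generated_algebra Y" if e: "e \<le> d" for e
      proof (cases "e = 0 \<or> e = d")
        case True
        then show ?thesis using \<open>hc 0 a = 0\<close> \<open>hc 0 b = 0\<close> by (auto simp: ga_zero)
      next
        case False
        then have "e < d" "d - e < d" using e by auto
        then show ?thesis using less.IH \<open>a \<in> A\<close> \<open>b \<in> A\<close> by (auto intro: ga_mult)
      qed
      then show ?thesis using that by (auto simp: hc_mult pA intro: ga_sum)
    qed
    have "polylike h \<and> hc d h \<in> generated_algebra Y" if "h \<in> fv.span ?D" for h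
      using that
    proof (induction rule: fv.span_induct_alt)
      case base
      then show ?case by (auto simp: polylike_zero hc_zero ga_zero)
    next
      case (step c x y)
      then obtain a b where x: "x = a * b" "a \<in> A" "b \<in> A" "hc 0 a = 0" "hc 0 b = 0" by auto
      have px: "polylike x" unfolding x using x pA by (auto intro: polylike_ray)
      show ?case using ab[OF x(2-)] step px
        by (auto simp: hc_add hc_scale polylike_ray x(1) intro!: ga_add ga_scale polylike_ray)
    qed
    from this[OF g(2)] have "hc d (f - g) \<in> generated_algebra Y" by simp
    then have "hc d (f - g) + hc d g \<in> generated_algebra Y" using pg by (auto intro: ga_add)
    then show ?case using pA less pg by (simp add: hc_diff)
  qed
  show ?thesis
  proof
    fix f assume f: "f \<in> A"
    obtain N where "\<forall>d>N. hc d f = 0" using ga_graded[OF X(1)] X(2) f by blast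
    then have "f = (\<Sum>d\<le>N. hc d f)" using hc_decomp[of f N] pA f by auto
    moreover have "(\<Sum>d\<le>N. hc d f) \<in> generated_algebra Y" using hcB f by (auto intro: ga_sum)
    ultimately show "f \<in> generated_algebra Y" by simp
  qed
qed

end

section \<open>Polynomials on the space of complex tuples\<close>

definition coord :: "nat \<Rightarrow> (nat \<Rightarrow> complex) \<Rightarrow> complex" where
  "coord i y = y i"

text \<open>Polynomials in \<open>r\<close> variables are functions on infinite tuples, so that one
  type serves every \<open>r\<close>; \<open>Pn_cong\<close> records that only the first
  \<open>r\<close> entries matter.\<close>

definition Pn :: "nat \<Rightarrow> ((nat \<Rightarrow> complex) \<Rightarrow> complex) set" where
  "Pn r = generated_algebra (coord ` {..<r})"

lemma coord_Pn: "i < r \<Longrightarrow> coord i \<in> Pn r"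
  unfolding Pn_def by (rule generated_algebra.gen) simp

lemma Pn_const: "(\<lambda>y. c) \<in> Pn r"
  unfolding Pn_def by (rule generated_algebra.const)

lemmas Pn_closed = Pn_const coord_Pn
  ga_add[of _ "coord ` {..<_}", folded Pn_def] ga_mult[of _ "coord ` {..<_}", folded Pn_def]
  ga_scale[of _ "coord ` {..<_}", folded Pn_def] ga_diff[of _ "coord ` {..<_}", folded Pn_def]
  ga_sum[of _ _ "coord ` {..<_}", folded Pn_def] ga_prod[of _ _ "coord ` {..<_}", folded Pn_def]
  ga_power[of _ "coord ` {..<_}", folded Pn_def]

lemma Pn_induct [consumes 1, case_names const coord add mult]:
  assumes "P \<in> Pn r" and "\<And>c. K (\<lambda>y. c)" and "\<And>i. i < r \<Longrightarrow> K (coord i)"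
    and "\<And>P Q. P \<in> Pn r \<Longrightarrow> Q \<in> Pn r \<Longrightarrow> K P \<Longrightarrow> K Q \<Longrightarrow> K (P + Q)"
    and "\<And>P Q. P \<in> Pn r \<Longrightarrow> Q \<in> Pn r \<Longrightarrow> K P \<Longrightarrow> K Q \<Longrightarrow> K (P * Q)"
  shows "K P"
  using assms(1) unfolding Pn_def
proof induction
  case (gen f)
  then show ?case using assms(3) by auto
next
  case (const c)
  then show ?case using assms(2) by auto
next
  case (add f g)
  then show ?case using assms(4)[of f g] by (simp add: Pn_def plus_fun_def)
next
  case (mult f g)
  then show ?case using assms(5)[of f g] by (simp add: Pn_def times_fun_def)
qed

lemma generated_algebra_image_iff:
  "f \<in> generated_algebra (F ` {..<r}) \<longleftrightarrow> (\<exists>P\<in>Pn r. f = (\<lambda>v. P (\<lambda>i. F i v)))"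
proof
  assume "f \<in> generated_algebra (F ` {..<r})"
  then show "\<exists>P\<in>Pn r. f = (\<lambda>v. P (\<lambda>i. F i v))"
  proof induction
    case (gen f)
    then obtain i where "i < r" "f = F i" by auto
    then show ?case by (intro bexI[of _ "coord i"]) (auto simp: coord_def intro: coord_Pn)
  next
    case (const c)
    show ?case by (intro bexI[of _ "\<lambda>y. c"]) (auto intro: Pn_const)
  next
    case (add f g)
    then obtain P Q where "P \<in> Pn r" "Q \<in> Pn r" "f = (\<lambda>v. P (\<lambda>i. F i v))" "g = (\<lambda>v. Q (\<lambda>i. F i v))"
      by auto
    then show ?case by (intro bexI[of _ "P + Q"]) (auto simp: fapply intro: Pn_closed)
  next
    case (mult f g)
    then obtain P Q where "P \<in> Pn r" "Q \<in> Pn r" "f = (\<lambda>v. P (\<lambda>i. F i v))" "g = (\<lambda>v. Q (\<lambda>i. F i v))"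
      by auto
    then show ?case by (intro bexI[of _ "P * Q"]) (auto simp: fapply intro: Pn_closed)
  qed
next
  have "(\<lambda>v. P (\<lambda>i. F i v)) \<in> generated_algebra (F ` {..<r})" if "P \<in> Pn r" for P
    using that
  proof (induction rule: Pn_induct)
    case (const c)
    show ?case by (rule generated_algebra.const)
  next
    case (coord i)
    then show ?case unfolding coord_def by (auto intro: generated_algebra.gen)
  next
    case (add P Q)
    then show ?case unfolding fapply by (intro generated_algebra.add)
  next
    case (mult P Q)
    then show ?case unfolding fapply by (intro generated_algebra.mult)
  qed
  then show "\<exists>P\<in>Pn r. f = (\<lambda>v. P (\<lambda>i. F i v)) \<Longrightarrow> f \<in> generated_algebra (F ` {..<r})" by auto
qed

lemma Pn_comp: "P \<in> Pn r \<Longrightarrow> (\<lambda>v. P (\<lambda>i. F i v)) \<in> generated_algebra (F ` {..<r})"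
  by (auto simp: generated_algebra_image_iff)

lemma Pn_comp_in:
  assumes "P \<in> Pn r" "\<And>i. i < r \<Longrightarrow> F i \<in> generated_algebra A"
  shows "(\<lambda>v. P (\<lambda>i. F i v)) \<in> generated_algebra A"
  using ga_subset[of "F ` {..<r}" A] Pn_comp[OF assms(1), of F] assms(2) by blast

lemma Pn_cong:
  assumes "P \<in> Pn r" and "\<And>i. i < r \<Longrightarrow> y i = z i"
  shows "P y = P z"
  using assms(1) by (induction rule: Pn_induct) (use assms(2) in \<open>auto simp: coord_def fapply\<close>)

subsection \<open>Partial derivatives\<close>

text \<open>The chain rule along arbitrary curves is built in, so that sums and products reduce to
  the one-variable rules. Moving a single coordinate afterwards identifies \<open>D i\<close> with
  \<open>pd i P\<close>.\<close>

definition is_grad :: "nat \<Rightarrow> ((nat \<Rightarrow> complex) \<Rightarrow> complex) \<Rightarrow> (nat \<Rightarrow> (nat \<Rightarrow> complex) \<Rightarrow> complex) \<Rightarrow> bool" where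
  "is_grad r P D \<longleftrightarrow> (\<forall>i<r. D i \<in> Pn r) \<and>
    (\<forall>w w' t. (\<forall>i<r. ((\<lambda>t. w t i) has_field_derivative w' i) (at t)) \<longrightarrow>
       ((\<lambda>t. P (w t)) has_field_derivative (\<Sum>i<r. D i (w t) * w' i)) (at t))"

lemma is_gradI:
  assumes "\<And>i. i < r \<Longrightarrow> D i \<in> Pn r"
    and "\<And>w w' t. (\<And>i. i < r \<Longrightarrow> ((\<lambda>t. w t i) has_field_derivative w' i) (at t)) \<Longrightarrow>
       ((\<lambda>t. P (w t)) has_field_derivative (\<Sum>i<r. D i (w t) * w' i)) (at t)"
  shows "is_grad r P D"
  unfolding is_grad_def using assms by simp

lemma is_gradD:
  assumes "is_grad r P D"
  shows "i < r \<Longrightarrow> D i \<in> Pn r"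
    and "(\<And>i. i < r \<Longrightarrow> ((\<lambda>t. w t i) has_field_derivative w' i) (at t)) \<Longrightarrow>
       ((\<lambda>t. P (w t)) has_field_derivative (\<Sum>i<r. D i (w t) * w' i)) (at t)"
  using assms unfolding is_grad_def by simp_all

lemma is_grad_ex:
  assumes "P \<in> Pn r"
  shows "\<exists>D. is_grad r P D"
  using assms
proof (induction rule: Pn_induct)
  case (const c)
  have "is_grad r (\<lambda>y. c) (\<lambda>i y. 0)" by (rule is_gradI) (auto intro: Pn_const)
  then show ?case by blast
next
  case (coord i)
  have "is_grad r (coord i) (\<lambda>j y. if j = i then 1 else 0)"
    by (rule is_gradI)
      (use coord in \<open>auto intro: Pn_const simp: coord_def if_distrib[of "\<lambda>a. a * _"] cong: if_cong\<close>)
  then show ?case by blast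
next
  case (add P Q)
  then obtain D E where D: "is_grad r P D" and E: "is_grad r Q E" by blast
  have "is_grad r (P + Q) (\<lambda>i. D i + E i)"
  proof (rule is_gradI)
    show "D i + E i \<in> Pn r" if "i < r" for i
      using is_gradD(1)[OF D that] is_gradD(1)[OF E that] by (rule Pn_closed)
    fix w :: "complex \<Rightarrow> nat \<Rightarrow> complex" and w' t
    assume w: "\<And>i. i < r \<Longrightarrow> ((\<lambda>t. w t i) has_field_derivative w' i) (at t)"
    show "((\<lambda>t. (P + Q) (w t)) has_field_derivative (\<Sum>i<r. (D i + E i) (w t) * w' i)) (at t)"
      using DERIV_add[OF is_gradD(2)[OF D w] is_gradD(2)[OF E w]]
      by (simp add: fapply ring_distribs sum.distrib)
  qed
  then show ?case by blast
next
  case (mult P Q)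
  then obtain D E where D: "is_grad r P D" and E: "is_grad r Q E" by blast
  have "is_grad r (P * Q) (\<lambda>i. D i * Q + P * E i)"
  proof (rule is_gradI)
    show "D i * Q + P * E i \<in> Pn r" if "i < r" for i
      using is_gradD(1)[OF D that] is_gradD(1)[OF E that] mult(1,2) by (simp add: Pn_closed)
    fix w :: "complex \<Rightarrow> nat \<Rightarrow> complex" and w' t
    assume w: "\<And>i. i < r \<Longrightarrow> ((\<lambda>t. w t i) has_field_derivative w' i) (at t)"
    show "((\<lambda>t. (P * Q) (w t)) has_field_derivative
        (\<Sum>i<r. (D i * Q + P * E i) (w t) * w' i)) (at t)"
      using DERIV_mult[OF is_gradD(2)[OF D w] is_gradD(2)[OF E w]]
      by (simp add: fapply ring_distribs sum.distrib sum_distrib_left sum_distrib_right mult_ac)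
  qed
  then show ?case by blast
qed

definition pd :: "nat \<Rightarrow> ((nat \<Rightarrow> complex) \<Rightarrow> complex) \<Rightarrow> (nat \<Rightarrow> complex) \<Rightarrow> complex" where
  "pd i P y = (THE D. ((\<lambda>t. P (y(i := t))) has_field_derivative D) (at (y i)))"

lemma pd_eqI: "((\<lambda>t. P (y(i := t))) has_field_derivative D) (at (y i)) \<Longrightarrow> pd i P y = D"
  unfolding pd_def by (rule the_equality) (auto intro: DERIV_unique)

lemma
  assumes P: "P \<in> Pn r"
  shows pd_Pn: "\<And>i. i < r \<Longrightarrow> pd i P \<in> Pn r"
    and pd_chain: "\<And>w w' t. (\<And>i. i < r \<Longrightarrow> ((\<lambda>t. w t i) has_field_derivative w' i) (at t)) \<Longrightarrow>
       ((\<lambda>t. P (w t)) has_field_derivative (\<Sum>i<r. pd i P (w t) * w' i)) (at t)"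
proof -
  obtain D where D: "is_grad r P D" using is_grad_ex[OF P] by blast
  have eq: "pd i P = D i" if i: "i < r" for i
  proof
    fix y :: "nat \<Rightarrow> complex"
    have "((\<lambda>t. (y(i := t)) j) has_field_derivative (if j = i then 1 else 0)) (at (y i))" for j :: nat
      by (cases "j = i") auto
    from is_gradD(2)[OF D, where w = "\<lambda>t. y(i := t)", OF this] i show "pd i P y = D i y"
      by (intro pd_eqI) (simp add: if_distrib[of "\<lambda>a. _ * a"] cong: if_cong)
  qed
  show "\<And>i. i < r \<Longrightarrow> pd i P \<in> Pn r" using is_gradD(1)[OF D] eq by simp
  show "((\<lambda>t. P (w t)) has_field_derivative (\<Sum>i<r. pd i P (w t) * w' i)) (at t)"
    if "\<And>i. i < r \<Longrightarrow> ((\<lambda>t. w t i) has_field_derivative w' i) (at t)" for w w' t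
    using is_gradD(2)[OF D that] by (simp add: eq)
qed

lemma pd_DERIV:
  assumes "P \<in> Pn r" "i < r"
  shows "((\<lambda>t. P (y(i := t))) has_field_derivative pd i P y) (at (y i))"
proof -
  have "((\<lambda>t. (y(i := t)) j) has_field_derivative (if j = i then 1 else 0)) (at (y i))" for j :: nat
    by (cases "j = i") auto
  from pd_chain[OF assms(1), of "\<lambda>t. y(i := t)", OF this] assms(2) show ?thesis
    by (simp add: if_distrib[of "\<lambda>a. _ * a"] cong: if_cong)
qed

lemma pd_const: "pd i (\<lambda>y. c) y = 0"
  by (rule pd_eqI) simp

lemma pd_coord: "pd i (coord j) y = (if i = j then 1 else 0)"
  by (rule pd_eqI) (auto simp: coord_def)

lemma pd_add: "P \<in> Pn r \<Longrightarrow> Q \<in> Pn r \<Longrightarrow> i < r \<Longrightarrow> pd i (P + Q) y = pd i P y + pd i Q y"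
  using DERIV_add[OF pd_DERIV[of P r i y] pd_DERIV[of Q r i y]] by (intro pd_eqI) (simp add: fapply)

lemma pd_diff: "P \<in> Pn r \<Longrightarrow> Q \<in> Pn r \<Longrightarrow> i < r \<Longrightarrow> pd i (P - Q) y = pd i P y - pd i Q y"
  using DERIV_diff[OF pd_DERIV[of P r i y] pd_DERIV[of Q r i y]] by (intro pd_eqI) (simp add: fapply)

lemma pd_mult:
  "P \<in> Pn r \<Longrightarrow> Q \<in> Pn r \<Longrightarrow> i < r \<Longrightarrow> pd i (P * Q) y = pd i P y * Q y + P y * pd i Q y"
  using DERIV_mult[OF pd_DERIV[of P r i y] pd_DERIV[of Q r i y]]
  by (intro pd_eqI) (simp add: fapply mult_ac)

lemma pd_scale: "P \<in> Pn r \<Longrightarrow> i < r \<Longrightarrow> pd i (fscale c P) y = c * pd i P y"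
  using DERIV_cmult[OF pd_DERIV[of P r i y], of c] by (intro pd_eqI) (simp add: fapply)

lemma pd_sum:
  "finite I \<Longrightarrow> (\<And>k. k \<in> I \<Longrightarrow> P k \<in> Pn r) \<Longrightarrow> i < r \<Longrightarrow> pd i (\<Sum>k\<in>I. P k) y = (\<Sum>k\<in>I. pd i (P k) y)"
proof (induction I rule: finite_induct)
  case empty
  show ?case using pd_const[of i 0 y] by (simp add: zero_fun_def)
next
  case (insert k I)
  then show ?case by (simp add: pd_add[of _ r] Pn_closed)
qed

text \<open>With p and q the values at 0, PQ = (P - p)(Q - q) + qP + pQ - pq. The first summand is a
  product of two functions vanishing at 0, and the rest is handled by the induction
  hypotheses.\<close>

lemma Taylor_0:
  assumes "P \<in> Pn r"
  shows "P - (\<lambda>y. P (\<lambda>i. 0)) - (\<Sum>i<r. fscale (pd i P (\<lambda>i. 0)) (coord i))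
    \<in> fv.span {A * B |A B. A \<in> Pn r \<and> B \<in> Pn r \<and> A (\<lambda>i. 0) = 0 \<and> B (\<lambda>i. 0) = 0}"
    (is "_ - _ - ?L P \<in> fv.span ?D")
proof -
  let ?R = "\<lambda>P. P - (\<lambda>y. P (\<lambda>i. 0)) - ?L P"
  show ?thesis
    using assms
  proof (induction rule: Pn_induct)
    case (const c)
    have "?R (\<lambda>y. c) = 0" by (simp add: fun_eq_iff fapply pd_const)
    then show ?case by (simp only: fv.span_zero)
  next
    case (coord i)
    then have "?R (coord i) = 0"
      by (simp add: fun_eq_iff fapply pd_coord)
        (simp add: coord_def if_distrib[of "\<lambda>a. a * _"] cong: if_cong)
    then show ?case by (simp only: fv.span_zero)
  next
    case (add P Q)
    have "?L (P + Q) = ?L P + ?L Q"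
      using add(1,2) by (simp add: pd_add[of _ r] fv.scale_left_distrib sum.distrib)
    then have "?R (P + Q) = ?R P + ?R Q"
      by (simp only:) (simp add: fun_eq_iff fapply)
    then show ?case using add by (simp only: fv.span_add)
  next
    case (mult P Q)
    let ?p = "P (\<lambda>i. 0)" and ?q = "Q (\<lambda>i. 0)"
    have "?L (P * Q) = fscale ?q (?L P) + fscale ?p (?L Q)"
      using mult(1,2)
      by (simp add: pd_mult[of _ r] fv.scale_left_distrib sum.distrib fv.scale_sum_right mult.commute)
    then have "?R (P * Q) = (P - (\<lambda>y. ?p)) * (Q - (\<lambda>y. ?q)) + (fscale ?q (?R P) + fscale ?p (?R Q))"
      by (simp only:) (simp add: fun_eq_iff fapply algebra_simps)
    moreover have "(P - (\<lambda>y. ?p)) * (Q - (\<lambda>y. ?q)) \<in> ?D"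
      using mult by (intro CollectI exI[of _ "P - (\<lambda>y. ?p)"] exI[of _ "Q - (\<lambda>y. ?q)"])
        (auto simp: fapply intro!: Pn_closed)
    ultimately show ?case using mult(3,4)
      by (simp only: fv.span_add fv.span_scale fv.span_base)
  qed
qed

subsection \<open>Linear independence of monomials\<close>

lemma digit_sum_less:
  fixes b :: "nat \<Rightarrow> nat"
  assumes "\<And>i. i < r \<Longrightarrow> b i < M"
  shows "(\<Sum>i<r. b i * M ^ i) < M ^ r"
  using assms
proof (induction r)
  case (Suc r)
  then have "(\<Sum>i<r. b i * M ^ i) < M ^ r" "Suc (b r) \<le> M" by (auto simp: Suc_le_eq)
  then have "(\<Sum>i<Suc r. b i * M ^ i) < M ^ r + b r * M ^ r" by simp
  also have "\<dots> = Suc (b r) * M ^ r" by simp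
  also have "\<dots> \<le> M * M ^ r" by (rule mult_right_mono) (use \<open>Suc (b r) \<le> M\<close> in auto)
  finally show ?case by simp
qed auto

text \<open>Uniqueness of digits in base \<open>M\<close>: the top digit is the quotient by M^r,
  since \<open>digit_sum_less\<close> bounds the remaining sum.\<close>

lemma digit_sum_inj:
  fixes b b' :: "nat \<Rightarrow> nat"
  assumes "\<And>i. i < r \<Longrightarrow> b i < M" "\<And>i. i < r \<Longrightarrow> b' i < M"
    and "(\<Sum>i<r. b i * M ^ i) = (\<Sum>i<r. b' i * M ^ i)" and "i < r"
  shows "b i = b' i"
  using assms
proof (induction r arbitrary: i)
  case (Suc r)
  let ?s = "\<Sum>i<r. b i * M ^ i" and ?s' = "\<Sum>i<r. b' i * M ^ i"
  have less: "?s < M ^ r" "?s' < M ^ r" using Suc by (auto intro!: digit_sum_less)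
  have eq: "?s + b r * M ^ r = ?s' + b' r * M ^ r" using Suc by simp
  have nz: "M ^ r \<noteq> 0" using less(1) by linarith
  have "b r = (?s + b r * M ^ r) div M ^ r" using less(1) div_mult_self1[OF nz] by simp
  also have "\<dots> = b' r" unfolding eq using less(2) div_mult_self1[OF nz] by simp
  finally have "b r = b' r" .
  moreover from this eq have "?s = ?s'" by simp
  ultimately show ?case
    using Suc.IH[of i] Suc.prems(1,2,4) by (cases "i = r") (auto simp: less_Suc_eq)
qed auto

definition mono_fun :: "nat \<Rightarrow> (nat \<Rightarrow> nat) \<Rightarrow> (nat \<Rightarrow> complex) \<Rightarrow> complex" where
  "mono_fun r b y = (\<Prod>i<r. y i ^ b i)"

lemma mono_fun_Pn: "mono_fun r b \<in> Pn r"
proof -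
  have "mono_fun r b = (\<Prod>i<r. coord i ^ b i)" by (simp add: fun_eq_iff mono_fun_def fapply coord_def)
  then show ?thesis by (auto intro!: Pn_closed)
qed

text \<open>Substituting \<open>y\<^sub>i = t ^ M\<^sup>i\<close> with \<open>M\<close> larger than all exponents sends distinct monomials to
  distinct powers of \<open>t\<close>.\<close>

lemma mono_fun_independent:
  assumes "finite B" and inj: "\<And>b b'. b \<in> B \<Longrightarrow> b' \<in> B \<Longrightarrow> (\<And>i. i < r \<Longrightarrow> b i = b' i) \<Longrightarrow> b = b'"
    and zero: "\<And>y. (\<Sum>b\<in>B. c b * mono_fun r b y) = 0" and "b \<in> B"
  shows "c b = 0"
proof -
  have "finite ((\<lambda>(b, i). b i) ` (B \<times> {..<r}))" using assms(1) by auto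
  then obtain M where "\<forall>k\<in>(\<lambda>(b, i). b i) ` (B \<times> {..<r}). k < M"
    unfolding finite_nat_set_iff_bounded by blast
  then have M: "b i < M" if "b \<in> B" "i < r" for b i using that by auto
  define e where "e b = (\<Sum>i<r. b i * M ^ i)" for b
  have inj_e: "b = b'" if "b \<in> B" "b' \<in> B" "e b = e b'" for b b'
    using that inj[of b b'] digit_sum_inj[of r b M b'] M unfolding e_def by blast
  define p where "p = (\<Sum>b\<in>B. monom (c b) (e b))"
  have "poly p t = 0" for t
  proof -
    have "mono_fun r b (\<lambda>i. t ^ M ^ i) = t ^ e b" for b
      by (simp add: mono_fun_def e_def power_sum power_mult[symmetric] mult.commute)
    then show ?thesis using zero[of "\<lambda>i. t ^ M ^ i"] by (simp add: p_def poly_sum poly_monom)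
  qed
  then have "p = 0" using poly_all_0_iff_0 by blast
  then have "0 = coeff p (e b)" by simp
  also have "\<dots> = (\<Sum>b'\<in>B. if b' = b then c b' else 0)"
    unfolding p_def coeff_sum by (rule sum.cong) (use inj_e \<open>b \<in> B\<close> in auto)
  also have "\<dots> = c b" using assms by simp
  finally show ?thesis by simp
qed

section \<open>Algebraic independence: polynomial functions versus formal polynomials\<close>

definition alg_indep :: "nat \<Rightarrow> (nat \<Rightarrow> 'a \<Rightarrow> complex) \<Rightarrow> bool" where
  "alg_indep r F \<longleftrightarrow> (\<forall>P\<in>Pn r. (\<forall>v. P (\<lambda>i. F i v) = 0) \<longrightarrow> P = 0)"

lemma alg_indepD:
  assumes "alg_indep r F" "P \<in> Pn r" "Q \<in> Pn r" "\<And>v. P (\<lambda>i. F i v) = Q (\<lambda>i. F i v)"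
  shows "P = Q"
proof -
  have "P - Q \<in> Pn r" by (intro Pn_closed assms)
  then have "P - Q = 0" using assms unfolding alg_indep_def by (auto simp: fapply)
  then show ?thesis by simp
qed

lemma eval_mpoly_mono_fun:
  assumes "\<And>m. m \<in> Poly_Mapping.keys P \<Longrightarrow> Poly_Mapping.keys m \<subseteq> {..<n}"
  shows "eval_mpoly y P = (\<Sum>m\<in>Poly_Mapping.keys P. Poly_Mapping.lookup P m * mono_fun n (Poly_Mapping.lookup m) y)"
  unfolding eval_mpoly_def
proof (rule sum.cong)
  fix m assume "m \<in> Poly_Mapping.keys P"
  have "(\<Prod>i\<in>Poly_Mapping.keys m. y i ^ Poly_Mapping.lookup m i) = (\<Prod>i<n. y i ^ Poly_Mapping.lookup m i)"
    by (rule prod.mono_neutral_left) (use assms[OF \<open>m \<in> Poly_Mapping.keys P\<close>] in \<open>auto simp: in_keys_iff\<close>)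
  then show "Poly_Mapping.lookup P m * (\<Prod>i\<in>Poly_Mapping.keys m. y i ^ Poly_Mapping.lookup m i) = Poly_Mapping.lookup P m * mono_fun n (Poly_Mapping.lookup m) y"
    by (simp add: mono_fun_def)
qed simp

lemma eval_mpoly_add: "eval_mpoly y (P + Q) = eval_mpoly y P + eval_mpoly y Q"
proof -
  have *: "eval_mpoly y R = (\<Sum>m\<in>Poly_Mapping.keys P \<union> Poly_Mapping.keys Q. Poly_Mapping.lookup R m * (\<Prod>i\<in>Poly_Mapping.keys m. y i ^ Poly_Mapping.lookup m i))"
    if "Poly_Mapping.keys R \<subseteq> Poly_Mapping.keys P \<union> Poly_Mapping.keys Q" for R
    unfolding eval_mpoly_def by (rule sum.mono_neutral_left) (use that in \<open>auto simp: in_keys_iff\<close>)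
  show ?thesis
    using *[of "P + Q"] *[of P] *[of Q] Poly_Mapping.keys_add[of P Q]
    by (simp add: Poly_Mapping.lookup_add ring_distribs sum.distrib)
qed

lemma Pn_eval_mpoly:
  assumes "P \<in> Pn n"
  shows "\<exists>Q. (\<forall>m\<in>Poly_Mapping.keys Q. Poly_Mapping.keys m \<subseteq> {..<n}) \<and> P = (\<lambda>y. eval_mpoly y Q)"
proof -
  have monomial: "\<exists>m. Poly_Mapping.keys m \<subseteq> {..<n} \<and> prod_list fs = (\<lambda>y. \<Prod>i\<in>Poly_Mapping.keys m. y i ^ Poly_Mapping.lookup m i)"
    if "set fs \<subseteq> coord ` {..<n}" for fs
    using that
  proof (induction fs)
    case Nil
    then show ?case by (intro exI[of _ 0]) (simp add: fun_eq_iff fapply)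
  next
    case (Cons f fs)
    then obtain m i where m: "Poly_Mapping.keys m \<subseteq> {..<n}" "prod_list fs = (\<lambda>y. \<Prod>i\<in>Poly_Mapping.keys m. y i ^ Poly_Mapping.lookup m i)"
      and i: "i < n" "f = coord i" by auto
    have expand: "(\<Prod>i\<in>Poly_Mapping.keys k. y i ^ Poly_Mapping.lookup k i) = (\<Prod>i<n. y i ^ Poly_Mapping.lookup k i)" if "Poly_Mapping.keys k \<subseteq> {..<n}"
      for y :: "nat \<Rightarrow> complex" and k
      by (rule prod.mono_neutral_left) (use that in \<open>auto simp: in_keys_iff\<close>)
    let ?m = "m + Poly_Mapping.single i 1"
    have sub: "Poly_Mapping.keys ?m \<subseteq> {..<n}" using Poly_Mapping.keys_add[of m "Poly_Mapping.single i 1"] m i by auto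
    have "(\<Prod>j<n. y j ^ Poly_Mapping.lookup ?m j) = (\<Prod>j<n. y j ^ Poly_Mapping.lookup m j) * y i"
      for y :: "nat \<Rightarrow> complex"
    proof -
      have "(\<Prod>j<n. y j ^ Poly_Mapping.lookup ?m j) =
          (\<Prod>j<n. y j ^ Poly_Mapping.lookup m j) * (\<Prod>j<n. if j = i then y i else 1)"
        unfolding prod.distrib[symmetric]
        by (rule prod.cong) (auto simp: Poly_Mapping.lookup_add Poly_Mapping.lookup_single)
      then show ?thesis using i by simp
    qed
    then show ?case
      using m i sub by (intro exI[of _ ?m]) (simp add: fun_eq_iff fapply expand coord_def mult.commute)
  qed
  have "P \<in> fv.span {prod_list fs |fs. set fs \<subseteq> coord ` {..<n}}"
    using ga_span_prod_list[of "coord ` {..<n}"] assms unfolding Pn_def by (rule subsetD)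
  then show ?thesis
  proof (induction rule: fv.span_induct_alt)
    case base
    show ?case by (intro exI[of _ 0]) (simp add: eval_mpoly_def fun_eq_iff fapply)
  next
    case (step c x P)
    then obtain fs Q where Q: "\<forall>m\<in>Poly_Mapping.keys Q. Poly_Mapping.keys m \<subseteq> {..<n}" "P = (\<lambda>y. eval_mpoly y Q)"
      "x = prod_list fs" "set fs \<subseteq> coord ` {..<n}" by auto
    obtain m where m: "Poly_Mapping.keys m \<subseteq> {..<n}" "x = (\<lambda>y. \<Prod>i\<in>Poly_Mapping.keys m. y i ^ Poly_Mapping.lookup m i)"
      using monomial[OF Q(4)] Q(3) by auto
    have "fscale c x + P = (\<lambda>y. eval_mpoly y (Poly_Mapping.single m c + Q))"
      by (simp add: eval_mpoly_add fun_eq_iff fapply m Q) (simp add: eval_mpoly_def)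
    moreover have "\<forall>k\<in>Poly_Mapping.keys (Poly_Mapping.single m c + Q). Poly_Mapping.keys k \<subseteq> {..<n}"
      using Poly_Mapping.keys_add[of "Poly_Mapping.single m c" Q] Q(1) m(1) by (fastforce split: if_splits)
    ultimately show ?case by blast
  qed
qed

lemma eval_mpoly_Pn:
  assumes "\<And>m. m \<in> Poly_Mapping.keys P \<Longrightarrow> Poly_Mapping.keys m \<subseteq> {..<n}"
  shows "(\<lambda>y. eval_mpoly y P) \<in> Pn n"
proof -
  have "(\<lambda>y. eval_mpoly y P) = (\<Sum>m\<in>Poly_Mapping.keys P. fscale (Poly_Mapping.lookup P m) (mono_fun n (Poly_Mapping.lookup m)))"
    by (simp add: fun_eq_iff fapply eval_mpoly_mono_fun[OF assms])
  then show ?thesis by (auto intro!: Pn_closed mono_fun_Pn)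
qed

text \<open>Monomials supported below \<open>n\<close> are determined by their first
  \<open>n\<close> exponents, so distinct formal monomials stay distinct in
  \<open>mono_fun_independent\<close>.\<close>

lemma eval_mpoly_eq_0:
  assumes "\<And>m. m \<in> Poly_Mapping.keys P \<Longrightarrow> Poly_Mapping.keys m \<subseteq> {..<n}" "\<And>y. eval_mpoly y P = 0"
  shows "P = 0"
proof (rule ccontr)
  assume "P \<noteq> 0"
  then obtain m where m: "m \<in> Poly_Mapping.keys P" by fastforce
  define c where "c b = Poly_Mapping.lookup P (Abs_poly_mapping b)" for b
  have c: "c (Poly_Mapping.lookup m) = Poly_Mapping.lookup P m" for m by (simp add: c_def lookup_inverse)
  have inj: "inj_on Poly_Mapping.lookup (Poly_Mapping.keys P)" by (auto simp: inj_on_def lookup_inject)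
  have out: "Poly_Mapping.lookup k i = 0" if "k \<in> Poly_Mapping.keys P" "\<not> i < n" for k i
    using assms(1)[OF that(1)] that(2) by (metis in_keys_iff lessThan_iff subsetD)
  have "c (Poly_Mapping.lookup m) = 0"
  proof (rule mono_fun_independent[of "Poly_Mapping.lookup ` Poly_Mapping.keys P" n c])
    show "b = b'" if "b \<in> Poly_Mapping.lookup ` Poly_Mapping.keys P" "b' \<in> Poly_Mapping.lookup ` Poly_Mapping.keys P" "\<And>i. i < n \<Longrightarrow> b i = b' i" for b b'
    proof -
      obtain m m' where mm: "m \<in> Poly_Mapping.keys P" "m' \<in> Poly_Mapping.keys P"
        "b = Poly_Mapping.lookup m" "b' = Poly_Mapping.lookup m'" using \<open>b \<in> _\<close> \<open>b' \<in> _\<close> by auto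
      show ?thesis
      proof
        fix i show "b i = b' i" using that(3)[of i] out mm by (cases "i < n") auto
      qed
    qed
    show "(\<Sum>b\<in>Poly_Mapping.lookup ` Poly_Mapping.keys P. c b * mono_fun n b y) = 0" for y
      using assms(2)[of y] by (simp add: sum.reindex[OF inj] c eval_mpoly_mono_fun[OF assms(1)])
  qed (use m in auto)
  then show False using m by (simp add: c in_keys_iff)
qed

text \<open>Formal polynomials are exchanged for functions in \<open>Pn n\<close>: every such
  function comes from a formal polynomial, and a formal polynomial inducing the zero function is
  zero.\<close>

lemma algebraically_independent_iff: "algebraically_independent n F \<longleftrightarrow> alg_indep n F"
proof
  assume *: "algebraically_independent n F"
  show "alg_indep n F" unfolding alg_indep_def
  proof (intro ballI impI)
    fix P assume P: "P \<in> Pn n" "\<forall>v. P (\<lambda>i. F i v) = 0"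
    obtain Q where "\<forall>m\<in>Poly_Mapping.keys Q. Poly_Mapping.keys m \<subseteq> {..<n}" "P = (\<lambda>y. eval_mpoly y Q)"
      using Pn_eval_mpoly P by blast
    moreover from this have "Q = 0" using * P unfolding algebraically_independent_def by auto
    ultimately show "P = 0" by (simp add: eval_mpoly_def zero_fun_def)
  qed
next
  assume *: "alg_indep n F"
  show "algebraically_independent n F" unfolding algebraically_independent_def
  proof (intro allI impI)
    fix P assume P: "\<forall>m\<in>Poly_Mapping.keys P. Poly_Mapping.keys m \<subseteq> {..<n}" "\<forall>v. eval_mpoly (\<lambda>i. F i v) P = 0"
    have "(\<lambda>y. eval_mpoly y P) = 0"
      using *[unfolded alg_indep_def, rule_format, of "\<lambda>y. eval_mpoly y P"] P eval_mpoly_Pn[of P n] by simp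
    then have "eval_mpoly y P = 0" for y by (simp add: fun_eq_iff fapply)
    then show "P = 0" using eval_mpoly_eq_0[of P n] P(1) by blast
  qed
qed

text \<open>Polynomials in \<open>n\<close> variables of degree at most \<open>k C\<close> in each variable form a space of
  dimension \<open>O(k\<^sup>n)\<close>, which leaves no room for the \<open>(k + 1)\<^sup>r\<close> monomials in \<open>r > n\<close>
  independent polynomials.\<close>

definition box :: "nat \<Rightarrow> nat \<Rightarrow> ((nat \<Rightarrow> complex) \<Rightarrow> complex) set" where
  "box n N = mono_fun n ` ({..<n} \<rightarrow>\<^sub>E {..N})"

lemma finite_box: "finite (box n N)" and card_box: "card (box n N) \<le> (N + 1) ^ n"
proof -
  have fin: "finite ({..<n} \<rightarrow>\<^sub>E {..N})" by (intro finite_PiE) auto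
  then show "finite (box n N)" by (simp add: box_def)
  show "card (box n N) \<le> (N + 1) ^ n"
    using card_image_le[OF fin, of "mono_fun n"] by (simp add: box_def card_PiE)
qed

lemma mono_fun_box: "(\<And>i. i < n \<Longrightarrow> a i \<le> N) \<Longrightarrow> mono_fun n a \<in> box n N"
  unfolding box_def
  by (rule image_eqI[of _ _ "restrict a {..<n}"]) (auto simp: mono_fun_def fun_eq_iff)

lemma box_mono: "N \<le> M \<Longrightarrow> box n N \<subseteq> box n M"
  unfolding box_def by (intro image_mono PiE_mono) auto

lemma span_box_mult:
  assumes f: "f \<in> fv.span (box n N)" and g: "g \<in> fv.span (box n M)"
  shows "f * g \<in> fv.span (box n (N + M))"
proof -
  have 1: "p * h \<in> fv.span (box n (N + M))" if p: "p \<in> box n N" and h: "h \<in> fv.span (box n M)" for p h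
    using h
  proof (induction rule: fv.span_induct_alt)
    case base
    then show ?case by (simp add: fv.span_zero)
  next
    case (step c x y)
    obtain a b where *: "p = mono_fun n a" "x = mono_fun n b" "a \<in> {..<n} \<rightarrow>\<^sub>E {..N}" "b \<in> {..<n} \<rightarrow>\<^sub>E {..M}"
      using p step unfolding box_def by auto
    have ab: "a i \<le> N" "b i \<le> M" if "i < n" for i using *(3,4) that by (auto simp: PiE_def Pi_def)
    have "p * x = mono_fun n (\<lambda>i. a i + b i)"
      unfolding * by (simp add: fun_eq_iff fapply mono_fun_def power_add prod.distrib)
    then have "p * x \<in> box n (N + M)" using ab by (auto intro!: mono_fun_box add_mono)
    then have "p * x \<in> fv.span (box n (N + M))" by (rule fv.span_base)
    moreover have "p * (fscale c x + y) = fscale c (p * x) + p * y"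
      by (auto simp: fun_eq_iff fapply algebra_simps)
    ultimately show ?case using step(2) by (simp only: span_scale_add)
  qed
  show ?thesis
    using f
  proof (induction rule: fv.span_induct_alt)
    case base
    then show ?case by (simp add: fv.span_zero)
  next
    case (step c x y)
    have "(fscale c x + y) * g = fscale c (x * g) + y * g"
      by (auto simp: fun_eq_iff fapply algebra_simps)
    then show ?case using step(2) 1[OF step(1) g] by (simp only: span_scale_add)
  qed
qed

lemma Pn_span_box: "P \<in> Pn n \<Longrightarrow> \<exists>N. P \<in> fv.span (box n N)"
proof (induction rule: Pn_induct)
  case (const c)
  have "mono_fun n (\<lambda>i. 0) \<in> box n 0" by (rule mono_fun_box) simp
  then have "fscale c (mono_fun n (\<lambda>i. 0)) \<in> fv.span (box n 0)"
    by (intro fv.span_scale fv.span_base)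
  moreover have "fscale c (mono_fun n (\<lambda>i. 0)) = (\<lambda>y. c)" by (simp add: fun_eq_iff fapply mono_fun_def)
  ultimately show ?case by metis
next
  case (coord i)
  have "coord i = mono_fun n (\<lambda>j. if j = i then 1 else 0)"
    using coord by (simp add: fun_eq_iff coord_def mono_fun_def if_distrib[of "\<lambda>k. _ ^ k"] cong: if_cong)
  then show ?case by (auto intro!: exI[of _ 1] fv.span_base mono_fun_box)
next
  case (add P Q)
  then obtain N M where "P \<in> fv.span (box n N)" "Q \<in> fv.span (box n M)" by auto
  then show ?case
    using fv.span_mono[OF box_mono[of N "max N M" n]] fv.span_mono[OF box_mono[of M "max N M" n]]
    by (intro exI[of _ "max N M"] fv.span_add) auto
next
  case (mult P Q)
  then show ?case using span_box_mult by blast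
qed

lemma alg_indep_le:
  assumes H: "\<And>i. i < r \<Longrightarrow> H i \<in> Pn n" and ind: "alg_indep r H"
  shows "r \<le> n"
proof (rule ccontr)
  assume "\<not> r \<le> n"
  obtain N where N: "\<And>i. i < r \<Longrightarrow> H i \<in> fv.span (box n (N i))" using Pn_span_box[OF H] by metis
  define C where "C = (\<Sum>i<r. N i)"
  have C: "H i \<in> fv.span (box n C)" if "i < r" for i
    using N[OF that] fv.span_mono[OF box_mono[of "N i" C n]] that member_le_sum[of i "{..<r}" N]
    by (auto simp: C_def)
  have pow: "H i ^ k \<in> fv.span (box n (C * k))" if "i < r" for i k
  proof (induction k)
    case 0
    have "mono_fun n (\<lambda>i. 0) \<in> box n 0" by (rule mono_fun_box) simp
    moreover have "mono_fun n (\<lambda>i. 0) = 1" by (simp add: fun_eq_iff fapply mono_fun_def)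
    ultimately show ?case by (simp add: fv.span_base)
  next
    case (Suc k)
    then show ?case using span_box_mult[OF C[OF that] Suc] by simp
  qed
  have mono: "(\<Prod>i<j. H i ^ b i) \<in> fv.span (box n (C * k * j))" if "\<And>i. i < j \<Longrightarrow> b i \<le> k" "j \<le> r"
    for b j k
    using that
  proof (induction j)
    case 0
    have "mono_fun n (\<lambda>i. 0) \<in> box n 0" by (rule mono_fun_box) simp
    moreover have "mono_fun n (\<lambda>i. 0) = 1" by (simp add: fun_eq_iff fapply mono_fun_def)
    ultimately show ?case by (simp add: fv.span_base)
  next
    case (Suc j)
    have "H j ^ b j \<in> fv.span (box n (C * k))"
      using pow[of j "b j"] Suc fv.span_mono[OF box_mono[of "C * b j" "C * k" n]] by auto
    from span_box_mult[OF Suc.IH this] Suc.prems show ?case by (simp add: algebra_simps)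
  qed
  have bound: "(k + 1) ^ r \<le> (C * k * r + 1) ^ n" for k
  proof -
    let ?E = "{..<r} \<rightarrow>\<^sub>E {..k}"
    let ?m = "\<lambda>b. \<Prod>i<r. H i ^ b i"
    have fin: "finite ?E" by (intro finite_PiE) auto
    have indep: "c b = 0" if c: "(\<Sum>b\<in>?E. fscale (c b) (?m b)) = 0" and b: "b \<in> ?E" for c b
    proof (rule mono_fun_independent[OF fin _ _ b])
      show "b = b'" if "b \<in> ?E" "b' \<in> ?E" "\<And>i. i < r \<Longrightarrow> b i = b' i" for b b'
        using that by (metis PiE_ext lessThan_iff)
      let ?P = "\<Sum>b\<in>?E. fscale (c b) (mono_fun r b)"
      have "?P \<in> Pn r" by (intro Pn_closed mono_fun_Pn)
      moreover have "?P (\<lambda>i. H i y) = (\<Sum>b\<in>?E. fscale (c b) (?m b)) y" for y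
        by (simp add: fapply mono_fun_def)
      ultimately have "?P = 0" using ind c unfolding alg_indep_def by (simp add: fapply)
      then show "(\<Sum>b\<in>?E. c b * mono_fun r b y) = 0" for y
        using fv_sum_apply[of c "mono_fun r" ?E y] by (simp add: zero_fun_apply)
    qed
    have inj: "inj_on ?m ?E"
    proof (rule inj_onI, rule ccontr)
      fix b b' assume b: "b \<in> ?E" "b' \<in> ?E" "?m b = ?m b'" "b \<noteq> b'"
      let ?c = "\<lambda>a. if a = b then 1 else if a = b' then -1 else 0 :: complex"
      have "(\<Sum>a\<in>?E. fscale (?c a) (?m a)) = (\<Sum>a\<in>{b, b'}. fscale (?c a) (?m a))"
        by (rule sum.mono_neutral_right[OF fin]) (use b in auto)
      also have "\<dots> = 0" using b by auto
      finally show False using indep[of ?c b] b by simp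
    qed
    have scalars: "c x = 0" if c: "(\<Sum>x\<in>?m ` ?E. fscale (c x) x) = 0" and x: "x \<in> ?m ` ?E" for c x
    proof -
      obtain b where b: "b \<in> ?E" "x = ?m b" using x by blast
      have "(\<Sum>b\<in>?E. fscale (c (?m b)) (?m b)) = 0"
        using c unfolding sum.reindex[OF inj] by (simp only: o_def)
      from indep[OF this b(1)] b(2) show ?thesis by simp
    qed
    have "fv.independent (?m ` ?E)"
      using fv.independent_if_scalars_zero[OF finite_imageI[OF fin]] scalars by blast
    moreover have "?m ` ?E \<subseteq> fv.span (box n (C * k * r))"
    proof (rule image_subsetI)
      fix b assume "b \<in> ?E"
      then have "b i \<le> k" if "i < r" for i using that by (auto simp: PiE_def Pi_def)
      then show "?m b \<in> fv.span (box n (C * k * r))" using mono[of r b k] by simp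
    qed
    ultimately have "card (?m ` ?E) \<le> card (box n (C * k * r))"
      using fv.independent_span_bound[OF finite_box] by blast
    also have "\<dots> \<le> (C * k * r + 1) ^ n" by (rule card_box)
    finally show ?thesis unfolding card_image[OF inj] by (simp add: card_PiE)
  qed
  \<comment> \<open>For \<open>r > n\<close> the left side of \<open>bound\<close> is at least
    (k+1)^n (k+1), and the right side is at most (k+1)^n (C r + 1)^n. Choosing \<open>k\<close> as
    the last factor makes the two incompatible.\<close>
  define k where "k = (C * r + 1) ^ n"
  have "(k + 1) ^ n * (k + 1) \<le> (k + 1) ^ r"
    using power_increasing[of "Suc n" r "k + 1"] \<open>\<not> r \<le> n\<close> by (simp add: algebra_simps)
  also have "\<dots> \<le> (C * k * r + 1) ^ n" by (rule bound)
  also have "\<dots> \<le> ((C * r + 1) * (k + 1)) ^ n" by (rule power_mono) (auto simp: algebra_simps)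
  also have "\<dots> = (k + 1) ^ n * k" by (simp only: power_mult_distrib k_def[symmetric] mult.commute)
  finally show False by simp
qed

section \<open>Polynomial functions in coordinates\<close>

lemma vector_space_complex: "vector_space ((*) :: complex \<Rightarrow> complex \<Rightarrow> complex)"
  by unfold_locales (auto simp: algebra_simps)

lemma comp_fun_simps:
  "(f + g) \<circ> k = (f \<circ> k) + (g \<circ> k)" "(f * g) \<circ> k = (f \<circ> k) * (g \<circ> k)"
  "(f - g) \<circ> k = (f \<circ> k) - (g \<circ> k)" "(\<lambda>v. c) \<circ> k = (\<lambda>v. c)" "fscale c f \<circ> k = fscale c (f \<circ> k)"
  "(\<Sum>i\<in>I. F i) \<circ> k = (\<Sum>i\<in>I. F i \<circ> k)" "0 \<circ> k = 0"
  by (auto simp: fun_eq_iff fapply)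

text \<open>A basis \<open>e\<close> with its dual coordinates \<open>x\<close>, both indexed by
  numbers, so that polynomial functions on \<open>V\<close> are elements of \<open>Pn n\<close>
  evaluated at the \<open>x i\<close>.\<close>

locale coord_space = vector_space s
  for s :: "complex \<Rightarrow> 'v::ab_group_add \<Rightarrow> 'v" +
  fixes n :: nat and x :: "nat \<Rightarrow> 'v \<Rightarrow> complex" and e :: "nat \<Rightarrow> 'v"
  assumes x_linear: "i < n \<Longrightarrow> Vector_Spaces.linear s (*) (x i)"
    and x_e: "i < n \<Longrightarrow> j < n \<Longrightarrow> x i (e j) = (if i = j then 1 else 0)"
    and expand: "(\<Sum>i<n. s (x i v) (e i)) = v"
begin

sublocale scaling s
  by unfold_locales (simp_all add: scale_scale)

definition linfun :: "('v \<Rightarrow> complex) \<Rightarrow> bool" where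
  "linfun l \<longleftrightarrow> (\<forall>u v. l (u + v) = l u + l v) \<and> (\<forall>c v. l (s c v) = c * l v)"

definition linmap :: "('v \<Rightarrow> 'v) \<Rightarrow> bool" where
  "linmap g \<longleftrightarrow> (\<forall>u v. g (u + v) = g u + g v) \<and> (\<forall>c v. g (s c v) = s c (g v))"

lemma linfun_iff: "Vector_Spaces.linear s (*) l \<longleftrightarrow> linfun l"
  unfolding Vector_Spaces.linear_def module_hom_def module_hom_axioms_def linfun_def
  using vector_space_axioms vector_space_complex
  by (auto simp: module_iff_vector_space)

lemma linmap_iff: "Vector_Spaces.linear s s g \<longleftrightarrow> linmap g"
  unfolding Vector_Spaces.linear_def module_hom_def module_hom_axioms_def linmap_def
  using vector_space_axioms
  by (auto simp: module_iff_vector_space)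

lemma linfun_x: "i < n \<Longrightarrow> linfun (x i)"
  using x_linear linfun_iff by blast

lemma linfunD: "linfun l \<Longrightarrow> l (u + v) = l u + l v" "linfun l \<Longrightarrow> l (s c v) = c * l v"
  by (auto simp: linfun_def)

lemma linfun_0: "linfun l \<Longrightarrow> l 0 = 0"
  using linfunD(2)[of l 0 0] by simp

lemma linfun_diff: "linfun l \<Longrightarrow> l (u - v) = l u - l v"
  using linfunD(1)[of l "u - v" v] by simp

lemma linfun_sum: "linfun l \<Longrightarrow> l (\<Sum>i\<in>I. f i) = (\<Sum>i\<in>I. l (f i))"
  by (induction I rule: infinite_finite_induct) (auto simp: linfun_0 linfunD)

lemma linfun_expand: "linfun l \<Longrightarrow> l v = (\<Sum>i<n. l (e i) * x i v)"
  using linfun_sum[of l "\<lambda>i. s (x i v) (e i)" "{..<n}"]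
  by (simp add: expand linfunD mult.commute)

lemma linmapD: "linmap g \<Longrightarrow> g (u + v) = g u + g v" "linmap g \<Longrightarrow> g (s c v) = s c (g v)"
  by (auto simp: linmap_def)

lemma linmap_0: "linmap g \<Longrightarrow> g 0 = 0"
  using linmapD(2)[of g 0 0] by simp

lemma linfun_comp: "linfun l \<Longrightarrow> linmap g \<Longrightarrow> linfun (l \<circ> g)"
  by (auto simp: linfun_def linmap_def)

lemma linmap_comp: "linmap g \<Longrightarrow> linmap h \<Longrightarrow> linmap (g \<circ> h)"
  by (auto simp: linmap_def)

lemma x_sep:
  assumes "\<And>i. i < n \<Longrightarrow> x i u = x i v"
  shows "u = v"
proof -
  have "(\<Sum>i<n. s (x i u) (e i)) = (\<Sum>i<n. s (x i v) (e i))"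
    by (rule sum.cong) (use assms in auto)
  then show ?thesis unfolding expand .
qed

lemma x_nonzero: "v \<noteq> 0 \<Longrightarrow> \<exists>i<n. x i v \<noteq> 0"
  using x_sep[of v 0] linfun_0[OF linfun_x] by auto

definition vec :: "(nat \<Rightarrow> complex) \<Rightarrow> 'v" where
  "vec y = (\<Sum>i<n. s (y i) (e i))"

lemma x_vec: "i < n \<Longrightarrow> x i (vec y) = y i"
  by (simp add: vec_def linfun_sum[OF linfun_x] linfunD[OF linfun_x] x_e
      if_distrib[of "\<lambda>a. _ * a"] cong: if_cong)

definition Pol :: "('v \<Rightarrow> complex) set" where
  "Pol = generated_algebra (x ` {..<n})"

lemma linfun_Pol:
  assumes "linfun l"
  shows "l \<in> Pol"
proof -
  have "l = (\<Sum>i<n. fscale (l (e i)) (x i))"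
    by (simp add: fun_eq_iff fapply linfun_expand[OF assms, symmetric])
  moreover have "\<dots> \<in> Pol"
    unfolding Pol_def by (intro ga_sum ga_scale generated_algebra.gen) auto
  ultimately show ?thesis by simp
qed

lemma polynomial_functions_eq: "polynomial_functions s = Pol"
proof
  show "polynomial_functions s \<subseteq> Pol"
    using ga_subset[of "Collect linfun" "x ` {..<n}"] linfun_Pol
    by (auto simp: polynomial_functions_def Pol_def linfun_iff)
  show "Pol \<subseteq> polynomial_functions s"
    unfolding polynomial_functions_def Pol_def
    by (intro ga_subset) (auto intro!: generated_algebra.gen simp: x_linear)
qed

lemma Pol_const: "(\<lambda>v. c) \<in> Pol" and Pol_one: "1 \<in> Pol" and Pol_zero: "0 \<in> Pol"
  and Pol_x: "i < n \<Longrightarrow> x i \<in> Pol"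
  unfolding Pol_def by (auto intro: generated_algebra.intros ga_one ga_zero)

lemmas Pol_closed = Pol_const Pol_one Pol_zero Pol_x
  ga_add[of _ "x ` {..<n}", folded Pol_def] ga_mult[of _ "x ` {..<n}", folded Pol_def]
  ga_scale[of _ "x ` {..<n}", folded Pol_def] ga_diff[of _ "x ` {..<n}", folded Pol_def]
  ga_sum[of _ _ "x ` {..<n}", folded Pol_def] ga_prod[of _ _ "x ` {..<n}", folded Pol_def]
  ga_power[of _ "x ` {..<n}", folded Pol_def]

lemma Pol_subsetI:
  assumes "\<And>i. i < n \<Longrightarrow> x i \<in> K" and "\<And>c. (\<lambda>v. c) \<in> K"
    and "\<And>f g. f \<in> K \<Longrightarrow> g \<in> K \<Longrightarrow> f + g \<in> K" and "\<And>f g. f \<in> K \<Longrightarrow> g \<in> K \<Longrightarrow> f * g \<in> K"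
  shows "Pol \<subseteq> K"
  unfolding Pol_def by (rule ga_subsetI) (use assms in auto)

lemma Pol_iff: "f \<in> Pol \<longleftrightarrow> (\<exists>P\<in>Pn n. f = (\<lambda>v. P (\<lambda>i. x i v)))"
  unfolding Pol_def by (rule generated_algebra_image_iff)

lemma homog_linfun: "linfun l \<Longrightarrow> homog 1 l"
  by (simp add: homog_def linfunD)

lemma homog_x: "f \<in> x ` {..<n} \<Longrightarrow> \<exists>d. homog d f"
  using homog_linfun linfun_x by blast

lemma Pol_polylike: "f \<in> Pol \<Longrightarrow> polylike f"
  and Pol_hc: "f \<in> Pol \<Longrightarrow> hc d f \<in> Pol"
  and Pol_bound: "f \<in> Pol \<Longrightarrow> \<exists>N. \<forall>d>N. hc d f = 0"
  using ga_graded[of "x ` {..<n}" f, OF homog_x] unfolding Pol_def by auto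

lemma homogeneous_polynomials_eq: "homogeneous_polynomials s d = {f \<in> Pol. homog d f}"
  by (simp add: homogeneous_polynomials_def polynomial_functions_eq homog_def)

lemma hc_0_eq: "f \<in> Pol \<Longrightarrow> hc 0 f = 0 \<longleftrightarrow> f 0 = 0"
  by (auto simp: fun_eq_iff hc_0 Pol_polylike fapply)

lemma homog_at_0: "homog d f \<Longrightarrow> d > 0 \<Longrightarrow> f 0 = 0"
  using homogD[of d f 0 0] by (simp add: zero_power)

lemma homog_0_const:
  assumes "homog 0 f"
  shows "f = (\<lambda>v. f 0)"
proof
  show "f v = f 0" for v using homogD[OF assms, of 0 v] by simp
qed

lemma Pol_line: "f \<in> Pol \<Longrightarrow> \<exists>p. \<forall>t. f (a + s t b) = poly p t"
proof -
  have "Pol \<subseteq> {f. \<exists>p. \<forall>t. f (a + s t b) = poly p t}"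
  proof (rule Pol_subsetI)
    fix i assume i: "i < n"
    have "x i (a + s t b) = poly [:x i a, x i b:] t" for t
      using i by (simp add: linfunD[OF linfun_x])
    then show "x i \<in> {f. \<exists>p. \<forall>t. f (a + s t b) = poly p t}" by blast
  next
    fix c :: complex
    have "c = poly [:c:] t" for t by simp
    then show "(\<lambda>v. c) \<in> {f. \<exists>p. \<forall>t. f (a + s t b) = poly p t}" by blast
  next
    fix f g assume "f \<in> {f. \<exists>p. \<forall>t. f (a + s t b) = poly p t}"
      "g \<in> {f. \<exists>p. \<forall>t. f (a + s t b) = poly p t}"
    then obtain p q where pq: "f (a + s t b) = poly p t" "g (a + s t b) = poly q t" for t by auto
    have "(f + g) (a + s t b) = poly (p + q) t" "(f * g) (a + s t b) = poly (p * q) t" for t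
      by (auto simp: fapply pq)
    then show "f + g \<in> {f. \<exists>p. \<forall>t. f (a + s t b) = poly p t}"
      "f * g \<in> {f. \<exists>p. \<forall>t. f (a + s t b) = poly p t}" by blast+
  qed
  then show "f \<in> Pol \<Longrightarrow> \<exists>p. \<forall>t. f (a + s t b) = poly p t" by blast
qed

text \<open>Both factors are restricted to the line through a point where \<open>f\<close> is
  nonzero and a point where \<open>g\<close> is nonzero; one-variable polynomials form a
  domain.\<close>

lemma Pol_domain:
  assumes f: "f \<in> Pol" and g: "g \<in> Pol" and fg: "f * g = 0" and "f \<noteq> 0"
  shows "g = 0"
proof (rule ccontr)
  assume "g \<noteq> 0"
  obtain a b where a: "f a \<noteq> 0" and b: "g b \<noteq> 0"
    using \<open>f \<noteq> 0\<close> \<open>g \<noteq> 0\<close> by (auto simp: fun_eq_iff fapply)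
  obtain p where p: "\<And>t. f (a + s t (b - a)) = poly p t" using Pol_line[OF f] by metis
  obtain q where q: "\<And>t. g (a + s t (b - a)) = poly q t" using Pol_line[OF g] by metis
  have "poly (p * q) t = 0" for t
    using fg by (simp add: p[symmetric] q[symmetric] fun_eq_iff fapply)
  then have "p * q = 0" using poly_all_0_iff_0 by blast
  moreover have "p \<noteq> 0" using p[of 0] a by auto
  moreover have "q \<noteq> 0" using q[of 1] b by auto
  ultimately show False by simp
qed

lemma Pol_common_nonzero:
  assumes "finite I" "\<And>i. i \<in> I \<Longrightarrow> f i \<in> Pol" "\<And>i. i \<in> I \<Longrightarrow> f i \<noteq> 0"
  shows "(\<Prod>i\<in>I. f i) \<noteq> 0"
  using assms
proof (induction I rule: finite_induct)
  case empty
  show ?case by (simp add: fun_eq_iff fapply)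
next
  case (insert i I)
  have "(\<Prod>i\<in>I. f i) \<in> Pol" using insert.prems(1) by (intro Pol_closed) auto
  moreover have "(\<Prod>i\<in>I. f i) \<noteq> 0" using insert by simp
  ultimately have "f i * (\<Prod>i\<in>I. f i) \<noteq> 0"
    using Pol_domain[of "f i" "\<Prod>i\<in>I. f i"] insert.prems by auto
  then show ?case using insert.hyps by simp
qed

text \<open>Supplies points in general position, outside finitely many proper zero sets.\<close>

lemma exists_common_nonzero:
  assumes "finite I" "\<And>i. i \<in> I \<Longrightarrow> f i \<in> Pol" "\<And>i. i \<in> I \<Longrightarrow> f i \<noteq> 0"
  shows "\<exists>v. \<forall>i\<in>I. f i v \<noteq> 0"
proof -
  have "(\<Prod>i\<in>I. f i) \<noteq> 0" by (rule Pol_common_nonzero) (use assms in auto)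
  then obtain v where "(\<Prod>i\<in>I. f i) v \<noteq> 0"
    by (auto simp: fun_eq_iff zero_fun_apply)
  then show ?thesis using assms(1) by (auto simp: fapply)
qed

text \<open>Cancelling \<open>l\<close> from the degree-\<open>d\<close> component of
  \<open>l * p\<close> leaves the component of degree \<open>d - 1\<close> of \<open>p\<close>. For
  \<open>d = 0\<close> the comparison gives \<open>p = 0\<close>, which is homogeneous of every
  degree, so the truncated subtraction does no harm.\<close>

lemma homog_divide:
  assumes l: "linfun l" "l \<noteq> 0" and p: "p \<in> Pol" and lp: "homog d (l * p)"
  shows "d = 0 \<Longrightarrow> p = 0" and "homog (d - 1) p"
proof -
  have eq: "l * p = (if 1 \<le> d then l * hc (d - 1) p else 0)"
    using hc_homog[OF lp, of d] hc_mult_homog[OF homog_linfun[OF l(1)] Pol_polylike[OF p]] by simp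
  show 0: "p = 0" if "d = 0"
    using eq that Pol_domain[OF linfun_Pol[OF l(1)] p _ l(2)] by simp
  show "homog (d - 1) p"
  proof (cases "d = 0")
    case True
    then show ?thesis using 0 homog_zero by simp
  next
    case False
    then have "l * (p - hc (d - 1) p) = 0" using eq by (simp add: right_diff_distrib)
    then have "p - hc (d - 1) p = 0"
      using Pol_domain[OF linfun_Pol[OF l(1)] _ _ l(2)] Pol_closed(8)[OF p Pol_hc[OF p]] by blast
    then have "p = hc (d - 1) p" by simp
    then show ?thesis using homog_hc[OF Pol_polylike[OF p]] by metis
  qed
qed

lemma Pol_comp: "f \<in> Pol \<Longrightarrow> linmap g \<Longrightarrow> f \<circ> g \<in> Pol"
proof -
  assume g: "linmap g"
  have "Pol \<subseteq> {f. f \<circ> g \<in> Pol}"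
    by (rule Pol_subsetI)
      (use g in \<open>auto simp: comp_fun_simps intro: linfun_Pol linfun_comp linfun_x intro!: Pol_closed\<close>)
  then show "f \<in> Pol \<Longrightarrow> f \<circ> g \<in> Pol" by blast
qed

lemma hc_comp_linmap: "f \<in> Pol \<Longrightarrow> linmap g \<Longrightarrow> hc d (f \<circ> g) = hc d f \<circ> g"
  by (rule hc_compose) (auto simp: Pol_polylike linmapD)

lemma homog_comp: "homog d f \<Longrightarrow> linmap g \<Longrightarrow> homog d (f \<circ> g)"
  by (simp add: homog_def linmapD)

lemma alg_indep_x: "alg_indep n x"
  unfolding alg_indep_def
proof (intro ballI impI)
  fix P assume P: "P \<in> Pn n" "\<forall>v. P (\<lambda>i. x i v) = 0"
  have "P y = 0" for y
    using P(2)[rule_format, of "vec y"] Pn_cong[OF P(1), of y "\<lambda>i. x i (vec y)"] x_vec by simp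
  then show "P = 0" by (simp add: fun_eq_iff fapply)
qed

lemma alg_indep_Pol_le:
  assumes h: "\<And>i. i < r \<Longrightarrow> h i \<in> Pol" and ind: "alg_indep r h"
  shows "r \<le> n"
proof -
  obtain H where H: "\<And>i. i < r \<Longrightarrow> H i \<in> Pn n" "\<And>i. i < r \<Longrightarrow> h i = (\<lambda>v. H i (\<lambda>j. x j v))"
    using h unfolding Pol_iff by metis
  have "alg_indep r H"
    unfolding alg_indep_def
  proof (intro ballI impI)
    fix P assume P: "P \<in> Pn r" "\<forall>y. P (\<lambda>i. H i y) = 0"
    have "P (\<lambda>i. h i v) = 0" for v
      using P(2)[rule_format, of "\<lambda>j. x j v"] Pn_cong[OF P(1), of "\<lambda>i. h i v" "\<lambda>i. H i (\<lambda>j. x j v)"] H(2)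
      by simp
    then show "P = 0" using ind P(1) unfolding alg_indep_def by blast
  qed
  with H(1) show ?thesis by (rule alg_indep_le)
qed

subsection \<open>Derivatives along the basis vectors\<close>

definition dS :: "nat \<Rightarrow> ('v \<Rightarrow> complex) \<Rightarrow> 'v \<Rightarrow> complex" where
  "dS k f v = (THE D. ((\<lambda>t. f (v + s t (e k))) has_field_derivative D) (at 0))"

lemma dS_eqI: "((\<lambda>t. f (v + s t (e k))) has_field_derivative D) (at 0) \<Longrightarrow> dS k f v = D"
  unfolding dS_def by (rule the_equality) (auto intro: DERIV_unique)

lemma x_line_DERIV:
  assumes "i < n" "k < n"
  shows "((\<lambda>t. x i (v + s t (e k))) has_field_derivative (if i = k then 1 else 0)) (at t)"
  using assms by (auto simp: linfunD[OF linfun_x] x_e intro!: derivative_eq_intros)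

lemma
  assumes P: "P \<in> Pn n" and k: "k < n"
  shows dS_Pn_DERIV: "((\<lambda>t. P (\<lambda>i. x i (v + s t (e k)))) has_field_derivative pd k P (\<lambda>i. x i v)) (at 0)"
    and dS_Pn: "dS k (\<lambda>v. P (\<lambda>i. x i v)) v = pd k P (\<lambda>i. x i v)"
proof -
  from pd_chain[OF P, where t = 0 and w = "\<lambda>t i. x i (v + s t (e k))", OF x_line_DERIV[OF _ k]]
  show *: "((\<lambda>t. P (\<lambda>i. x i (v + s t (e k)))) has_field_derivative pd k P (\<lambda>i. x i v)) (at 0)"
    using k by (simp add: if_distrib[of "\<lambda>a. _ * a"] cong: if_cong)
  show "dS k (\<lambda>v. P (\<lambda>i. x i v)) v = pd k P (\<lambda>i. x i v)" by (rule dS_eqI) (rule *)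
qed

lemma dS_DERIV:
  assumes "f \<in> Pol" "k < n"
  shows "((\<lambda>t. f (v + s t (e k))) has_field_derivative dS k f v) (at 0)"
  using assms(1) dS_Pn_DERIV[OF _ assms(2)] dS_Pn[OF _ assms(2)] unfolding Pol_iff by auto

lemma dS_Pol:
  assumes "f \<in> Pol" "k < n"
  shows "dS k f \<in> Pol"
proof -
  obtain P where P: "P \<in> Pn n" "f = (\<lambda>v. P (\<lambda>i. x i v))" using assms unfolding Pol_iff by blast
  have "dS k f = (\<lambda>v. pd k P (\<lambda>i. x i v))" unfolding P(2) by (rule ext) (rule dS_Pn[OF P(1) assms(2)])
  then show ?thesis unfolding Pol_iff using pd_Pn[OF P(1) assms(2)] by blast
qed

lemma dS_chain:
  assumes Q: "Q \<in> Pn r" and h: "\<And>i. i < r \<Longrightarrow> h i \<in> Pol" and k: "k < n"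
  shows "dS k (\<lambda>v. Q (\<lambda>i. h i v)) v = (\<Sum>i<r. pd i Q (\<lambda>i. h i v) * dS k (h i) v)"
proof (rule dS_eqI)
  from pd_chain[OF Q, of "\<lambda>t i. h i (v + s t (e k))", OF dS_DERIV[OF h k]]
  show "((\<lambda>t. Q (\<lambda>i. h i (v + s t (e k)))) has_field_derivative
      (\<Sum>i<r. pd i Q (\<lambda>i. h i v) * dS k (h i) v)) (at 0)" by simp
qed

text \<open>The function f(t v) is differentiated at t = 1 in two ways, by the chain rule and as t^d
  f(v).\<close>

lemma Euler:
  assumes f: "f \<in> Pol" "homog d f"
  shows "(\<Sum>k<n. x k v * dS k f v) = of_nat d * f v"
proof -
  obtain P where P: "P \<in> Pn n" "f = (\<lambda>v. P (\<lambda>i. x i v))" using f(1) unfolding Pol_iff by blast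
  have "((\<lambda>t. x i (s t v)) has_field_derivative x i v) (at 1)" if "i < n" for i
    using that by (auto simp: linfunD[OF linfun_x] intro!: derivative_eq_intros)
  from pd_chain[OF P(1), of "\<lambda>t i. x i (s t v)", OF this]
  have "((\<lambda>t. f (s t v)) has_field_derivative (\<Sum>i<n. pd i P (\<lambda>i. x i v) * x i v)) (at 1)"
    by (simp add: P(2))
  moreover have "((\<lambda>t. f (s t v)) has_field_derivative of_nat d * f v) (at 1)"
    unfolding homogD[OF f(2)] by (auto intro!: derivative_eq_intros)
  ultimately have "(\<Sum>i<n. pd i P (\<lambda>i. x i v) * x i v) = of_nat d * f v"
    by (rule DERIV_unique)
  then show ?thesis by (simp add: P(2) dS_Pn[OF P(1)] mult.commute)
qed

text \<open>Differentiating f(c v + c t e_k) = c^d f(v + t e_k) at t = 0 gives c D(c v) = c^d D(v)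
  for the derivative D. The factor c is cancelled between polynomials in c, not between values,
  because homogeneity is demanded at c = 0 as well.\<close>

lemma homog_dS:
  assumes f: "f \<in> Pol" "homog d f" and d: "d > 0" and k: "k < n"
  shows "homog (d - 1) (dS k f)"
proof -
  obtain m where m: "d = Suc m" using d gr0_implies_Suc by blast
  have pl: "polylike (dS k f)" by (intro Pol_polylike dS_Pol f k)
  have "ray_poly (dS k f) v = monom (dS k f v) m" for v
  proof -
    have "poly (pCons 0 (ray_poly (dS k f) v)) c = poly (monom (dS k f v) d) c" for c
    proof -
      have "((\<lambda>t. f (s c v + s (c * t) (e k))) has_field_derivative c * dS k f (s c v)) (at 0)"
      proof -
        have 1: "((\<lambda>t. f (s c v + s t (e k))) has_field_derivative dS k f (s c v)) (at (c * 0))"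
          using dS_DERIV[OF f(1) k, of "s c v"] by simp
        have 2: "((\<lambda>t. c * t) has_field_derivative c) (at 0)" by (auto intro!: derivative_eq_intros)
        from DERIV_chain2[OF 1 2] show ?thesis by (simp only: mult.commute)
      qed
      moreover have "f (s c v + s (c * t) (e k)) = c ^ d * f (v + s t (e k))" for t
        using homogD[OF f(2), of c "v + s t (e k)"] by (simp add: scale_right_distrib)
      moreover have "((\<lambda>t. c ^ d * f (v + s t (e k))) has_field_derivative c ^ d * dS k f v) (at 0)"
        using dS_DERIV[OF f(1) k, of v] by (rule DERIV_cmult)
      ultimately have "c * dS k f (s c v) = c ^ d * dS k f v" by (simp add: DERIV_unique)
      then show ?thesis by (simp add: poly_monom poly_ray_poly[OF pl])
    qed
    then have "pCons 0 (ray_poly (dS k f) v) = pCons 0 (monom (dS k f v) m)"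
      unfolding m monom_Suc by (intro poly_ext) auto
    then show ?thesis by simp
  qed
  then have "hc m (dS k f) = dS k f" by (auto simp: fun_eq_iff hc_def)
  then show ?thesis using homog_hc[OF pl, of m] m by simp
qed

end

section \<open>Invariants of finite linear groups\<close>

locale fin_lin_group = coord_space +
  fixes W :: "('a \<Rightarrow> 'a) set"
  assumes fin: "finite W" and W_id: "id \<in> W" and W_comp: "g \<in> W \<Longrightarrow> h \<in> W \<Longrightarrow> g \<circ> h \<in> W"
    and W_lin: "g \<in> W \<Longrightarrow> linmap g" and W_inv: "g \<in> W \<Longrightarrow> \<exists>h\<in>W. g \<circ> h = id \<and> h \<circ> g = id"
begin

definition invs :: "('a \<Rightarrow> complex) set" where
  "invs = {f \<in> Pol. \<forall>g\<in>W. f \<circ> g = f}"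

text \<open>The Reynolds operator: a projection onto the invariants that is linear over
  them.\<close>

definition avg :: "('a \<Rightarrow> complex) \<Rightarrow> 'a \<Rightarrow> complex" where
  "avg f = fscale (1 / of_nat (card W)) (\<Sum>g\<in>W. f \<circ> g)"

lemma card_W: "(of_nat (card W) :: complex) \<noteq> 0"
  using fin W_id by auto

lemma invs_Pol: "f \<in> invs \<Longrightarrow> f \<in> Pol"
  by (simp add: invs_def)

lemma invsD: "f \<in> invs \<Longrightarrow> g \<in> W \<Longrightarrow> f \<circ> g = f"
  by (simp add: invs_def)

lemma invs_apply: "f \<in> invs \<Longrightarrow> g \<in> W \<Longrightarrow> f (g v) = f v"
  using invsD[of f g] by (metis comp_apply)

lemma invs_closed:
  "(\<lambda>v. c) \<in> invs" "1 \<in> invs" "0 \<in> invs"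
  "f \<in> invs \<Longrightarrow> g \<in> invs \<Longrightarrow> f + g \<in> invs"
  "f \<in> invs \<Longrightarrow> g \<in> invs \<Longrightarrow> f * g \<in> invs"
  "f \<in> invs \<Longrightarrow> g \<in> invs \<Longrightarrow> f - g \<in> invs"
  "f \<in> invs \<Longrightarrow> fscale c f \<in> invs"
  by (auto simp: invs_def comp_fun_simps intro: Pol_closed) (auto simp: one_fun_def)

lemma invs_sum: "(\<And>i. i \<in> I \<Longrightarrow> f i \<in> invs) \<Longrightarrow> (\<Sum>i\<in>I. f i) \<in> invs"
  by (induction I rule: infinite_finite_induct) (auto intro: invs_closed)

lemma invs_hc: "f \<in> invs \<Longrightarrow> hc d f \<in> invs"
  by (auto simp: invs_def hc_comp_linmap[symmetric] W_lin Pol_hc)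

lemma ga_invs: "(\<And>i. i < r \<Longrightarrow> h i \<in> invs) \<Longrightarrow> generated_algebra (h ` {..<r}) \<subseteq> invs"
  by (rule ga_subsetI) (auto intro: invs_closed)

lemma bij_comp_W: "h \<in> W \<Longrightarrow> bij_betw (\<lambda>g. g \<circ> h) W W"
proof -
  assume h: "h \<in> W"
  obtain k where k: "k \<in> W" "h \<circ> k = id" "k \<circ> h = id" using W_inv[OF h] by blast
  show ?thesis
    by (rule bij_betw_byWitness[of _ "\<lambda>g. g \<circ> k"]) (use k h W_comp in \<open>auto simp: comp_assoc\<close>)
qed

lemma avg_Pol: "f \<in> Pol \<Longrightarrow> avg f \<in> Pol"
  unfolding avg_def by (intro Pol_closed Pol_comp W_lin)

lemma avg_invs:
  assumes "f \<in> Pol"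
  shows "avg f \<in> invs"
  unfolding invs_def
proof (intro CollectI conjI ballI)
  show "avg f \<in> Pol" by (rule avg_Pol) fact
  fix h assume h: "h \<in> W"
  have "(\<Sum>g\<in>W. f \<circ> g) \<circ> h = (\<Sum>g\<in>W. f \<circ> (g \<circ> h))"
    by (simp only: comp_fun_simps comp_assoc)
  also have "\<dots> = (\<Sum>g\<in>W. f \<circ> g)"
    by (rule sum.reindex_bij_betw[OF bij_comp_W[OF h]])
  finally show "avg f \<circ> h = avg f" by (simp only: avg_def comp_fun_simps)
qed

lemma avg_mult: "a \<in> invs \<Longrightarrow> avg (a * f) = a * avg f"
proof -
  assume a: "a \<in> invs"
  have "(\<Sum>g\<in>W. (a * f) \<circ> g) = (\<Sum>g\<in>W. a * (f \<circ> g))"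
    by (rule sum.cong) (simp_all only: comp_fun_simps invsD[OF a])
  then have "(\<Sum>g\<in>W. (a * f) \<circ> g) = a * (\<Sum>g\<in>W. f \<circ> g)" by (simp only: sum_distrib_left)
  then show ?thesis unfolding avg_def by (simp only:) (simp add: fun_eq_iff fapply)
qed

lemma avg_const: "avg (\<lambda>v. c) = (\<lambda>v. c)"
  using card_W by (simp add: avg_def fun_eq_iff fapply)

lemma avg_invs_id: "a \<in> invs \<Longrightarrow> avg a = a"
  using avg_mult[of a 1] avg_const[of 1] by (simp add: one_fun_def[symmetric])

lemma avg_sum: "avg (\<Sum>i\<in>I. f i) = (\<Sum>i\<in>I. avg (f i))"
proof -
  have "(\<Sum>g\<in>W. (\<Sum>i\<in>I. f i) \<circ> g) = (\<Sum>i\<in>I. \<Sum>g\<in>W. f i \<circ> g)"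
    unfolding comp_fun_simps by (rule sum.swap)
  then show ?thesis unfolding avg_def by (simp only: fv.scale_sum_right)
qed

lemma avg_add: "avg (f + g) = avg f + avg g" and avg_scale: "avg (fscale c f) = fscale c (avg f)"
  and avg_zero: "avg 0 = 0"
  by (simp_all add: avg_def comp_fun_simps sum.distrib fv.scale_right_distrib fv.scale_sum_right mult.commute)

lemma avg_homog: "homog d f \<Longrightarrow> homog d (avg f)"
  unfolding avg_def by (intro homog_scale homog_sum homog_comp W_lin)

lemma avg_apply: "avg f v = (\<Sum>g\<in>W. f (g v)) / of_nat (card W)"
  by (simp add: avg_def fapply)

lemma avg_at_0: "f 0 = 0 \<Longrightarrow> avg f 0 = 0"
  by (simp add: avg_apply linmap_0 W_lin)

section \<open>Decomposable invariants and the Hilbert ideal\<close>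

definition invs_pos :: "('a \<Rightarrow> complex) set" where
  "invs_pos = {a \<in> invs. a 0 = 0}"

text \<open>The square of the augmentation ideal of \<open>invs\<close>. Generators of the algebra
  of invariants need only be found modulo this space.\<close>

definition decomp :: "('a \<Rightarrow> complex) set" where
  "decomp = fv.span {a * b |a b. a \<in> invs_pos \<and> b \<in> invs_pos}"

definition hilbert_ideal :: "('a \<Rightarrow> complex) set" where
  "hilbert_ideal = fv.span {p * a |p a. p \<in> Pol \<and> a \<in> invs_pos}"

lemma decomp_mult: "a \<in> invs_pos \<Longrightarrow> b \<in> invs_pos \<Longrightarrow> a * b \<in> decomp"
  unfolding decomp_def by (rule fv.span_base) auto

lemmas decomp_closed = decomp_mult
  fv.span_zero[of "{a * b |a b. a \<in> invs_pos \<and> b \<in> invs_pos}", folded decomp_def]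
  fv.span_add[of _ "{a * b |a b. a \<in> invs_pos \<and> b \<in> invs_pos}", folded decomp_def]
  fv.span_diff[of _ "{a * b |a b. a \<in> invs_pos \<and> b \<in> invs_pos}", folded decomp_def]
  fv.span_scale[of _ "{a * b |a b. a \<in> invs_pos \<and> b \<in> invs_pos}", folded decomp_def]
  fv.span_sum[of _ _ "{a * b |a b. a \<in> invs_pos \<and> b \<in> invs_pos}", folded decomp_def]

lemma hilbert_mult_base: "p \<in> Pol \<Longrightarrow> a \<in> invs_pos \<Longrightarrow> p * a \<in> hilbert_ideal"
  unfolding hilbert_ideal_def by (rule fv.span_base) auto

lemmas hilbert_closed = hilbert_mult_base
  fv.span_zero[of "{p * a |p a. p \<in> Pol \<and> a \<in> invs_pos}", folded hilbert_ideal_def]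
  fv.span_add[of _ "{p * a |p a. p \<in> Pol \<and> a \<in> invs_pos}", folded hilbert_ideal_def]
  fv.span_diff[of _ "{p * a |p a. p \<in> Pol \<and> a \<in> invs_pos}", folded hilbert_ideal_def]
  fv.span_scale[of _ "{p * a |p a. p \<in> Pol \<and> a \<in> invs_pos}", folded hilbert_ideal_def]
  fv.span_sum[of _ _ "{p * a |p a. p \<in> Pol \<and> a \<in> invs_pos}", folded hilbert_ideal_def]

lemma invs_pos_invs: "a \<in> invs_pos \<Longrightarrow> a \<in> invs"
  by (simp add: invs_pos_def)

lemma invs_posI: "a \<in> invs \<Longrightarrow> homog d a \<Longrightarrow> d > 0 \<Longrightarrow> a \<in> invs_pos"
  by (simp add: invs_pos_def homog_at_0)

lemma hilbert_induct [consumes 1, case_names zero step]: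
  assumes f: "f \<in> hilbert_ideal" and zero: "K 0"
    and step: "\<And>c p a f. p \<in> Pol \<Longrightarrow> a \<in> invs_pos \<Longrightarrow> f \<in> hilbert_ideal \<Longrightarrow> K f \<Longrightarrow>
      K (fscale c (p * a) + f)"
  shows "K f"
proof -
  have "f \<in> hilbert_ideal \<and> K f" using f[unfolded hilbert_ideal_def]
  proof (induction rule: fv.span_induct_alt)
    case base
    show ?case using zero hilbert_closed(2) by blast
  next
    case (step c q f)
    then obtain p a where q: "q = p * a" "p \<in> Pol" "a \<in> invs_pos" by auto
    show ?case using assms(3)[OF q(2,3), of f c] step(2) hilbert_closed(1)[OF q(2,3)] q(1)
      by (auto intro!: hilbert_closed(3,5))
  qed
  then show ?thesis ..
qed

lemma hilbert_mult:
  assumes q: "q \<in> Pol" and f: "f \<in> hilbert_ideal"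
  shows "q * f \<in> hilbert_ideal"
  using f
proof (induction rule: hilbert_induct)
  case zero
  show ?case using hilbert_closed(2) by simp
next
  case (step c p a f)
  have "q * (fscale c (p * a) + f) = fscale c ((q * p) * a) + q * f"
    by (simp add: fun_eq_iff fapply algebra_simps)
  moreover have "(q * p) * a \<in> hilbert_ideal" using q step by (intro hilbert_closed(1) Pol_closed)
  ultimately show ?case using step(4) by (simp only: hilbert_closed(3,5))
qed

lemma hilbert_comp:
  assumes g: "g \<in> W" and f: "f \<in> hilbert_ideal"
  shows "f \<circ> g \<in> hilbert_ideal"
  using f
proof (induction rule: hilbert_induct)
  case zero
  show ?case using hilbert_closed(2) by (simp add: comp_fun_simps)
next
  case (step c p a f)
  have "(fscale c (p * a) + f) \<circ> g = fscale c ((p \<circ> g) * a) + (f \<circ> g)"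
    by (simp only: comp_fun_simps invsD[OF invs_pos_invs[OF step(2)] g])
  moreover have "(p \<circ> g) * a \<in> hilbert_ideal" using g step by (intro hilbert_closed(1) Pol_comp W_lin)
  ultimately show ?case using step(4) by (simp only: hilbert_closed(3,5))
qed

text \<open>Averaging maps \<open>x\<^sub>k p a\<close> with \<open>a\<close> invariant to the product of \<open>a\<close> and the average of
  \<open>x\<^sub>k p\<close>, and the latter vanishes at the origin.\<close>

lemma avg_mult_hilbert:
  assumes q: "q \<in> Pol" "q 0 = 0" and f: "f \<in> hilbert_ideal"
  shows "avg (q * f) \<in> decomp"
  using f
proof (induction rule: hilbert_induct)
  case zero
  show ?case using decomp_closed(2) by (simp add: avg_zero)
next
  case (step c p a f)
  have eq: "q * (fscale c (p * a) + f) = fscale c (a * (q * p)) + q * f"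
    by (simp add: fun_eq_iff fapply algebra_simps)
  have "avg (q * p) \<in> invs_pos"
    using q step by (auto simp: invs_pos_def fapply intro!: avg_invs Pol_closed avg_at_0)
  then have "a * avg (q * p) \<in> decomp" using step by (intro decomp_closed)
  then show ?case using step(4) unfolding eq avg_add avg_scale avg_mult[OF invs_pos_invs[OF step(2)]]
    by (intro decomp_closed(3,5))
qed

text \<open>For polynomial functions, vanishing at 0 means having no component of degree 0. This
  identifies \<open>decomp\<close> with the span occurring in
  \<open>graded_nakayama\<close>.\<close>

lemma invs_nakayama:
  assumes h: "\<And>i. i < r \<Longrightarrow> \<exists>d. homog d (h i)"
    and dec: "\<And>f. f \<in> invs \<Longrightarrow> \<exists>g\<in>generated_algebra (h ` {..<r}). f - g \<in> decomp"
  shows "invs \<subseteq> generated_algebra (h ` {..<r})"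
proof (rule graded_nakayama[of "x ` {..<n}"])
  show "\<And>f. f \<in> x ` {..<n} \<Longrightarrow> \<exists>d. homog d f" by (rule homog_x)
  show "invs \<subseteq> generated_algebra (x ` {..<n})" using invs_Pol by (auto simp: Pol_def)
  show "\<And>f. f \<in> h ` {..<r} \<Longrightarrow> \<exists>d. homog d f" using h by auto
  fix f assume "f \<in> invs"
  then obtain g where g: "g \<in> generated_algebra (h ` {..<r})" "f - g \<in> decomp" using dec by blast
  have "{a * b |a b. a \<in> invs_pos \<and> b \<in> invs_pos} =
      {a * b |a b. a \<in> invs \<and> b \<in> invs \<and> hc 0 a = 0 \<and> hc 0 b = 0}"
    using hc_0_eq invs_Pol unfolding invs_pos_def by blast
  then show "\<exists>g\<in>generated_algebra (h ` {..<r}).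
      f - g \<in> fv.span {a * b |a b. a \<in> invs \<and> b \<in> invs \<and> hc 0 a = 0 \<and> hc 0 b = 0}"
    using g unfolding decomp_def by auto
qed

end

section \<open>Chevalley's theorem\<close>

text \<open>The formula that a reflection obeys, without dimension or order. The vector
  \<open>a\<close> may be 0, so on a nonzero space the identity qualifies; \<open>l\<close> is
  nonzero because it is divided out later.\<close>

definition (in coord_space) refl_map :: "('v \<Rightarrow> 'v) \<Rightarrow> bool" where
  "refl_map g \<longleftrightarrow> (\<exists>l a. linfun l \<and> l \<noteq> 0 \<and> (\<forall>v. g v = v + s (l v) a))"

text \<open>\<open>f \<circ> g\<close> and \<open>f\<close> agree on the kernel of \<open>l\<close>.
  Divisibility is checked on coordinates and carried to products by (f h) o g - f h = ((f o g) - f)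
  (h o g) + f ((h o g) - h).\<close>

lemma (in coord_space) refl_divides:
  assumes g: "\<And>v. g v = v + s (l v) a" and l: "linfun l" and f: "f \<in> Pol"
  shows "\<exists>q\<in>Pol. (f \<circ> g) - f = l * q"
proof -
  let ?K = "{f \<in> Pol. f \<circ> g \<in> Pol \<and> (\<exists>q\<in>Pol. (f \<circ> g) - f = l * q)}"
  have "Pol \<subseteq> ?K"
  proof (rule Pol_subsetI)
    fix i assume i: "i < n"
    have 1: "x i \<circ> g = x i + fscale (x i a) l"
      by (auto simp: fun_eq_iff fapply g linfunD[OF linfun_x[OF i]])
    have 2: "x i \<circ> g \<in> Pol" unfolding 1 by (intro Pol_closed linfun_Pol l i)
    have "(x i \<circ> g) - x i = l * (\<lambda>v. x i a)" unfolding 1 by (auto simp: fun_eq_iff fapply)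
    then show "x i \<in> ?K" using 2 Pol_x[OF i] Pol_const[of "x i a"] by blast
  next
    fix c :: complex
    have "((\<lambda>v. c) \<circ> g) - (\<lambda>v. c) = l * 0" by (auto simp: fun_eq_iff fapply)
    then show "(\<lambda>v. c) \<in> ?K" by (auto simp: comp_fun_simps intro!: Pol_closed bexI[of _ 0])
  next
    fix f h assume "f \<in> ?K" "h \<in> ?K"
    then obtain p q where *: "f \<in> Pol" "h \<in> Pol" "f \<circ> g \<in> Pol" "h \<circ> g \<in> Pol" "p \<in> Pol" "q \<in> Pol"
      "(f \<circ> g) - f = l * p" "(h \<circ> g) - h = l * q" by auto
    have "((f + h) \<circ> g) - (f + h) = ((f \<circ> g) - f) + ((h \<circ> g) - h)" by (simp add: comp_fun_simps)
    also have "\<dots> = l * (p + q)" unfolding * by (simp add: ring_distribs)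
    finally show "f + h \<in> ?K" using * by (auto simp: comp_fun_simps intro!: Pol_closed)
    have "((f * h) \<circ> g) - f * h = ((f \<circ> g) - f) * (h \<circ> g) + f * ((h \<circ> g) - h)"
      by (simp add: comp_fun_simps algebra_simps)
    also have "\<dots> = l * (p * (h \<circ> g) + f * q)" unfolding * by (simp add: algebra_simps)
    finally have "((f * h) \<circ> g) - f * h = l * (p * (h \<circ> g) + f * q)" .
    moreover have "p * (h \<circ> g) + f * q \<in> Pol" "f * h \<in> Pol" "(f * h) \<circ> g \<in> Pol"
      unfolding comp_fun_simps by (intro Pol_closed *)+
    ultimately show "f * h \<in> ?K" by blast
  qed
  then show ?thesis using f by blast
qed

text \<open>Generation by reflections, in the form of an induction over left factors. In a finite
  group inverses are powers, so products of generators suffice.\<close>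

locale refl_group = fin_lin_group +
  assumes refl_generated:
    "\<And>X. id \<in> X \<Longrightarrow> (\<And>g h. g \<in> W \<Longrightarrow> refl_map g \<Longrightarrow> h \<in> X \<Longrightarrow> g \<circ> h \<in> X) \<Longrightarrow> W \<subseteq> X"
begin

text \<open>The hypothesis on reflections spreads to all of \<open>W\<close> by (p o g o h) - p =
  (((p o g) - p) o h) + ((p o h) - p) and the stability of the ideal under \<open>W\<close>.
  Averaging over \<open>W\<close> then gives the claim.\<close>

lemma diff_avg_hilbert:
  assumes p: "p \<in> Pol" and r: "\<And>g. g \<in> W \<Longrightarrow> refl_map g \<Longrightarrow> (p \<circ> g) - p \<in> hilbert_ideal"
  shows "p - avg p \<in> hilbert_ideal"
proof -
  have "W \<subseteq> {h \<in> W. (p \<circ> h) - p \<in> hilbert_ideal}"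
  proof (rule refl_generated)
    show "id \<in> {h \<in> W. (p \<circ> h) - p \<in> hilbert_ideal}" using W_id hilbert_closed(2) by simp
    fix g h assume g: "g \<in> W" "refl_map g" and h: "h \<in> {h \<in> W. (p \<circ> h) - p \<in> hilbert_ideal}"
    have "(p \<circ> (g \<circ> h)) - p = (((p \<circ> g) - p) \<circ> h) + ((p \<circ> h) - p)"
      by (simp add: comp_fun_simps comp_assoc)
    moreover have "((p \<circ> g) - p) \<circ> h \<in> hilbert_ideal" using hilbert_comp r g h by blast
    ultimately have "(p \<circ> (g \<circ> h)) - p \<in> hilbert_ideal" using h by (simp only: hilbert_closed mem_Collect_eq)
    then show "g \<circ> h \<in> {h \<in> W. (p \<circ> h) - p \<in> hilbert_ideal}" using g h W_comp by blast
  qed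
  then have "(\<Sum>g\<in>W. (p \<circ> g) - p) \<in> hilbert_ideal" by (intro hilbert_closed(6)) auto
  then have *: "fscale (- (1 / of_nat (card W))) (\<Sum>g\<in>W. (p \<circ> g) - p) \<in> hilbert_ideal"
    by (rule hilbert_closed(5))
  have "fscale (- (1 / of_nat (card W))) (\<Sum>g\<in>W. (p \<circ> g) - p) = p - avg p"
    using card_W by (simp add: fun_eq_iff fapply avg_def sum_subtractf field_simps)
  with * show ?thesis by (simp only:)
qed

text \<open>Chevalley's lemma on relations, by induction on the degree of \<open>p k\<close>. In
  degree 0, averaging the relation expresses a_k through the other a_i unless p_k = 0. In higher
  degree, transforming the relation by a reflection, subtracting and dividing by its linear form
  gives a relation with the same \<open>a\<close> and a smaller degree at \<open>k\<close>. So every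
  reflection fixes p_k modulo the Hilbert ideal, and p_k is congruent to its average, an invariant
  of positive degree.\<close>

lemma relation_hilbert:
  assumes M: "finite M" "k \<in> M" and a: "\<And>i. i \<in> M \<Longrightarrow> a i \<in> invs" and p: "\<And>i. i \<in> M \<Longrightarrow> p i \<in> Pol"
    and rel: "(\<Sum>i\<in>M. a i * p i) = 0" and hom: "homog d (p k)"
    and not: "\<And>b. (\<And>i. i \<in> M - {k} \<Longrightarrow> b i \<in> invs) \<Longrightarrow> a k \<noteq> (\<Sum>i\<in>M - {k}. b i * a i)"
  shows "p k \<in> hilbert_ideal"
  using p rel hom
proof (induction d arbitrary: p)
  case 0
  define c where "c = p k 0"
  have pk: "p k = (\<lambda>v. c)" unfolding c_def by (rule homog_0_const) (rule 0(3))
  have "c = 0"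
  proof (rule ccontr)
    assume c: "c \<noteq> 0"
    have "(\<Sum>i\<in>M. a i * avg (p i)) = avg (\<Sum>i\<in>M. a i * p i)"
      unfolding avg_sum by (rule sum.cong) (simp_all add: avg_mult a)
    then have "a k * avg (p k) + (\<Sum>i\<in>M - {k}. a i * avg (p i)) = 0"
      using M unfolding 0(2) avg_zero by (simp add: sum.remove)
    then have eq: "fscale c (a k) + (\<Sum>i\<in>M - {k}. a i * avg (p i)) = 0"
      unfolding pk avg_const by (simp add: fun_eq_iff fapply mult.commute)
    have "a k = (\<Sum>i\<in>M - {k}. fscale (- (1 / c)) (avg (p i)) * a i)"
    proof
      fix v
      have "c * a k v + (\<Sum>i\<in>M - {k}. a i v * avg (p i) v) = 0"
        using fun_cong[OF eq, of v] by (simp add: fapply)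
      then have "a k v = - (1 / c) * (\<Sum>i\<in>M - {k}. a i v * avg (p i) v)"
        using c by (simp add: field_simps add_eq_0_iff)
      then show "a k v = (\<Sum>i\<in>M - {k}. fscale (- (1 / c)) (avg (p i)) * a i) v"
        by (simp add: fapply sum_distrib_left mult_ac)
    qed
    moreover have "fscale (- (1 / c)) (avg (p i)) \<in> invs" if "i \<in> M - {k}" for i
      using that 0(1) by (intro invs_closed avg_invs) auto
    ultimately show False using not[of "\<lambda>i. fscale (- (1 / c)) (avg (p i))"] by blast
  qed
  then have "p k = 0" using pk by (simp add: zero_fun_def)
  then show ?case using hilbert_closed(2) by simp
next
  case (Suc d)
  have "(p k \<circ> g) - p k \<in> hilbert_ideal" if g: "g \<in> W" "refl_map g" for g
  proof -
    obtain l b where l: "linfun l" "l \<noteq> 0" "\<And>v. g v = v + s (l v) b"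
      using g(2) unfolding refl_map_def by blast
    have "\<forall>i\<in>M. \<exists>q\<in>Pol. (p i \<circ> g) - p i = l * q"
      using refl_divides[OF l(3,1)] Suc.prems(1) by blast
    then obtain q where q: "\<And>i. i \<in> M \<Longrightarrow> q i \<in> Pol" "\<And>i. i \<in> M \<Longrightarrow> (p i \<circ> g) - p i = l * q i"
      by metis
    have "l * (\<Sum>i\<in>M. a i * q i) = (\<Sum>i\<in>M. a i * (l * q i))"
      by (simp only: sum_distrib_left mult_ac)
    also have "\<dots> = (\<Sum>i\<in>M. ((a i * p i) \<circ> g) - a i * p i)"
    proof (rule sum.cong)
      fix i assume i: "i \<in> M"
      show "a i * (l * q i) = ((a i * p i) \<circ> g) - a i * p i"
        unfolding q(2)[OF i, symmetric] comp_fun_simps invsD[OF a[OF i] g(1)] by (rule right_diff_distrib)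
    qed simp
    also have "\<dots> = ((\<Sum>i\<in>M. a i * p i) \<circ> g) - (\<Sum>i\<in>M. a i * p i)"
      by (simp only: comp_fun_simps sum_subtractf)
    also have "\<dots> = 0" unfolding Suc.prems(2) by (simp add: comp_fun_simps)
    finally have "l * (\<Sum>i\<in>M. a i * q i) = 0" .
    moreover have "(\<Sum>i\<in>M. a i * q i) \<in> Pol" using a q invs_Pol by (intro Pol_closed) auto
    ultimately have rel': "(\<Sum>i\<in>M. a i * q i) = 0"
      using Pol_domain[OF linfun_Pol[OF l(1)] _ _ l(2)] by blast
    have "homog (Suc d) (p k \<circ> g)" using Suc.prems(3) g W_lin by (intro homog_comp)
    then have "homog (Suc d) ((p k \<circ> g) - p k)"
      using Suc.prems(3) by (auto simp: homog_def fapply algebra_simps)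
    then have "homog (Suc d) (l * q k)" using q(2)[OF M(2)] by simp
    from homog_divide(2)[OF l(1,2) q(1)[OF M(2)] this] have "homog d (q k)" by simp
    then have "q k \<in> hilbert_ideal" using Suc.IH[of q] q(1) rel' by blast
    then show ?thesis unfolding q(2)[OF M(2)] using hilbert_mult linfun_Pol[OF l(1)] by blast
  qed
  then have 1: "p k - avg (p k) \<in> hilbert_ideal" using Suc.prems(1) M(2) by (intro diff_avg_hilbert)
  have "avg (p k) \<in> invs_pos"
    using avg_invs avg_homog[OF Suc.prems(3)] Suc.prems(1) M(2) by (intro invs_posI[of _ "Suc d"]) auto
  then have "1 * avg (p k) \<in> hilbert_ideal" by (intro hilbert_closed(1) Pol_one)
  with 1 have "(p k - avg (p k)) + 1 * avg (p k) \<in> hilbert_ideal" by (rule hilbert_closed(3))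
  then show ?case by simp
qed

end

text \<open>A maximal family of homogeneous invariants that is linearly independent modulo decomposable
  invariants is finite, because such families are algebraically independent.\<close>

definition (in fin_lin_group) primitive :: "nat \<Rightarrow> (nat \<Rightarrow> 'a \<Rightarrow> complex) \<Rightarrow> (nat \<Rightarrow> nat) \<Rightarrow> bool" where
  "primitive r h d \<longleftrightarrow> (\<forall>i<r. h i \<in> invs \<and> homog (d i) (h i) \<and> d i > 0) \<and>
     (\<forall>c. (\<Sum>i<r. fscale (c i) (h i)) \<in> decomp \<longrightarrow> (\<forall>i<r. c i = 0))"

text \<open>With weights \<open>d i\<close>, substituting invariants of degree \<open>d i\<close>
  for the variables preserves degrees.\<close>

lemma weighted_scaling: "scaling (\<lambda>c y i. c ^ d i * (y i :: complex))"
  by unfold_locales (auto simp: power_mult_distrib mult_ac)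

section \<open>Weighted-homogeneous relations among primitive invariants\<close>

context refl_group
begin

context
  fixes r h d
  assumes prim: "primitive r h d"
begin

interpretation w: scaling "\<lambda>c y i. c ^ d i * (y i :: complex)"
  by (rule weighted_scaling)

lemma h_invs: "i < r \<Longrightarrow> h i \<in> invs" and h_homog: "i < r \<Longrightarrow> homog (d i) (h i)"
  and d_pos: "i < r \<Longrightarrow> d i > 0"
  and h_indep: "(\<Sum>i<r. fscale (c i) (h i)) \<in> decomp \<Longrightarrow> i < r \<Longrightarrow> c i = 0"
  using prim unfolding primitive_def by blast+

lemma w_homog_coord: "f \<in> coord ` {..<r} \<Longrightarrow> \<exists>d. w.homog d f"
  by (auto simp: w.homog_def coord_def)

lemma w_homog_comp:
  assumes "P \<in> Pn r" "w.homog D P"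
  shows "homog D (\<lambda>v. P (\<lambda>i. h i v))"
  unfolding homog_def
proof (intro allI)
  fix c v
  have "P (\<lambda>i. h i (s c v)) = P (\<lambda>i. c ^ d i * h i v)"
    by (rule Pn_cong[OF assms(1)]) (simp add: homogD[OF h_homog])
  then show "P (\<lambda>i. h i (s c v)) = c ^ D * P (\<lambda>i. h i v)" using w.homogD[OF assms(2)] by simp
qed

text \<open>As in \<open>homog_dS\<close>, the factor c^(d i) is cancelled between polynomials in c.
  The disjunction avoids a truncated degree: if \<open>D < d i\<close>, comparing coefficients shows
  that the derivative is zero.\<close>

lemma w_homog_pd:
  assumes P: "P \<in> Pn r" "w.homog D P" and i: "i < r"
  shows "pd i P = 0 \<or> (d i \<le> D \<and> w.homog (D - d i) (pd i P))"
proof -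
  have pd: "pd i P \<in> Pn r" by (rule pd_Pn[OF P(1) i])
  have pl: "w.polylike (pd i P)" using w.ga_graded[OF w_homog_coord] pd unfolding Pn_def by blast
  have eq: "c ^ d i * pd i P (\<lambda>j. c ^ d j * y j) = c ^ D * pd i P y" for c y
  proof -
    have 1: "((\<lambda>t. P ((\<lambda>j. c ^ d j * y j)(i := t))) has_field_derivative
      pd i P (\<lambda>j. c ^ d j * y j)) (at (c ^ d i * y i))"
      using pd_DERIV[OF P(1) i, of "\<lambda>j. c ^ d j * y j"] by simp
    have 2: "((\<lambda>t. c ^ d i * t) has_field_derivative c ^ d i) (at (y i))"
      by (auto intro!: derivative_eq_intros)
    have "(\<lambda>j. c ^ d j * y j)(i := c ^ d i * t) = (\<lambda>j. c ^ d j * (y(i := t)) j)" for t by auto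
    then have "P ((\<lambda>j. c ^ d j * y j)(i := c ^ d i * t)) = c ^ D * P (y(i := t))" for t
      using w.homogD[OF P(2), of c "y(i := t)"] by simp
    then have "((\<lambda>t. c ^ D * P (y(i := t))) has_field_derivative
        pd i P (\<lambda>j. c ^ d j * y j) * c ^ d i) (at (y i))"
      using DERIV_chain2[OF 1 2] by simp
    moreover have "((\<lambda>t. c ^ D * P (y(i := t))) has_field_derivative c ^ D * pd i P y) (at (y i))"
      by (rule DERIV_cmult[OF pd_DERIV[OF P(1) i]])
    ultimately show ?thesis using DERIV_unique by (simp add: mult.commute)
  qed
  have poly: "monom 1 (d i) * w.ray_poly (pd i P) y = monom (pd i P y) D" for y
  proof (rule poly_ext)
    show "poly (monom 1 (d i) * w.ray_poly (pd i P) y) c = poly (monom (pd i P y) D) c" for c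
      using eq[of c y] by (simp add: poly_monom w.poly_ray_poly[OF pl])
  qed
  show ?thesis
  proof (cases "d i \<le> D")
    case True
    have "w.hc (D - d i) (pd i P) = pd i P"
    proof
      fix y
      have "coeff (monom 1 (d i) * w.ray_poly (pd i P) y) D = pd i P y" by (simp add: poly)
      then show "w.hc (D - d i) (pd i P) y = pd i P y"
        using True by (simp add: coeff_monom_mult w.hc_def)
    qed
    then show ?thesis using True w.homog_hc[OF pl, of "D - d i"] by simp
  next
    case False
    have "pd i P y = 0" for y
    proof -
      have "coeff (monom 1 (d i) * w.ray_poly (pd i P) y) D = pd i P y" by (simp add: poly)
      then show ?thesis using False by (simp add: coeff_monom_mult)
    qed
    then show ?thesis by (simp add: fun_eq_iff fapply)
  qed
qed

text \<open>Weighted Euler formula, from differentiating P(t^(d i) y_i) at t = 1.\<close>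

lemma w_Euler:
  assumes P: "P \<in> Pn r" "w.homog D P"
  shows "(\<Sum>i<r. of_nat (d i) * y i * pd i P y) = of_nat D * P y"
proof -
  have "((\<lambda>t. t ^ d i * y i) has_field_derivative of_nat (d i) * y i) (at 1)" if "i < r" for i
    by (auto intro!: derivative_eq_intros)
  from pd_chain[OF P(1), where w = "\<lambda>t i. t ^ d i * y i" and t = 1, OF this]
  have "((\<lambda>t. P (\<lambda>i. t ^ d i * y i)) has_field_derivative
      (\<Sum>i<r. pd i P y * (of_nat (d i) * y i))) (at 1)" by simp
  moreover have "((\<lambda>t. P (\<lambda>i. t ^ d i * y i)) has_field_derivative of_nat D * P y) (at 1)"
    unfolding w.homogD[OF P(2)] by (auto intro!: derivative_eq_intros)
  ultimately have "(\<Sum>i<r. pd i P y * (of_nat (d i) * y i)) = of_nat D * P y" by (rule DERIV_unique)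
  then show ?thesis by (simp add: mult_ac)
qed

text \<open>Chevalley's argument for a relation \<open>Q(h) = 0\<close> of minimal degree. Express the derivatives
  \<open>q\<^sub>j = (\<partial>\<^sub>jQ)(h)\<close> through a minimal subfamily indexed by \<open>M\<close> and differentiate \<open>Q(h) = 0\<close> along the
  basis vectors: the coefficients \<open>p\<close> of the resulting relation among the \<open>q\<^sub>i\<close> lie in the Hilbert
  ideal. By Euler's formula, \<open>h\<^sub>k\<close> is then dependent on the other \<open>h\<^sub>j\<close> modulo decomposables.\<close>

lemma no_homogeneous_relation:
  assumes Q: "Q \<in> Pn r" "w.homog D Q" "\<And>v. Q (\<lambda>i. h i v) = 0"
  shows "Q = 0"
  using Q
proof (induction D arbitrary: Q rule: less_induct)
  case (less D Q)
  show ?case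
  proof (rule ccontr)
    assume Q0: "Q \<noteq> 0"
    define q where "q i = (\<lambda>v. pd i Q (\<lambda>j. h j v))" for i
    have pdQ: "pd i Q \<in> Pn r" if "i < r" for i by (rule pd_Pn[OF less(2) that])
    have q_invs: "q i \<in> invs" if "i < r" for i
      using Pn_comp[OF pdQ[OF that], of h] ga_invs[of r h] h_invs unfolding q_def by blast
    have q_hom: "pd i Q = 0 \<or> (d i \<le> D \<and> w.homog (D - d i) (pd i Q))" if "i < r" for i
      by (rule w_homog_pd[OF less(2,3) that])
    \<comment> \<open>A vanishing \<open>q i\<close> would be a relation of degree
      \<open>D - d i\<close>, smaller than \<open>D\<close>, and the induction hypothesis would make
      \<open>pd i Q\<close> zero.\<close>
    have q_nz: "q i \<noteq> 0" if i: "i < r" "pd i Q \<noteq> 0" for i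
    proof
      assume "q i = 0"
      then have "pd i Q (\<lambda>j. h j v) = 0" for v by (simp add: q_def fun_eq_iff fapply)
      moreover have "w.homog (D - d i) (pd i Q)" "D - d i < D" using q_hom[OF i(1)] i d_pos[OF i(1)] by auto
      ultimately show False using less.IH[of "D - d i" "pd i Q"] pdQ[OF i(1)] i by blast
    qed
    define M0 where "M0 = {i. i < r \<and> pd i Q \<noteq> 0}"
    have M0_fin: "finite M0" by (auto simp: M0_def)
    have M0_ne: "M0 \<noteq> {}"
    proof
      assume "M0 = {}"
      then have pd0: "\<And>i. i < r \<Longrightarrow> pd i Q = 0" by (auto simp: M0_def)
      have "of_nat D * Q y = 0" for y
        using w_Euler[OF less(2,3), of y] pd0 by (simp add: fapply)
      \<comment> \<open>In degree 0, scaling by 0 shows that \<open>Q\<close> is constant, since all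
        weights are positive. The constant is a value of \<open>Q\<close> on the \<open>h i\<close>,
        hence 0.\<close>
      moreover have "D \<noteq> 0"
      proof
        assume "D = 0"
        have "Q y = Q (\<lambda>i. 0)" for y
        proof -
          have "Q (\<lambda>i. 0 ^ d i * y i) = Q y" using w.homogD[OF less(3), of 0 y] \<open>D = 0\<close> by simp
          moreover have "Q (\<lambda>i. 0 ^ d i * y i) = Q (\<lambda>i. 0)"
            by (rule Pn_cong[OF less(2)]) (use d_pos in \<open>auto simp: zero_power\<close>)
          ultimately show ?thesis by simp
        qed
        then have "Q y = 0" for y using less(4)[of 0] by metis
        then show False using Q0 by (simp add: fun_eq_iff fapply)
      qed
      ultimately show False using Q0 by (auto simp: fun_eq_iff fapply)
    qed
    have hom_q: "homog (D - d i) (q i)" "d i \<le> D" if "i \<in> M0" for i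
      using q_hom[of i] w_homog_comp[OF pdQ, of i "D - d i"] that by (auto simp: M0_def q_def)
    \<comment> \<open>The \<open>q i\<close> with \<open>i\<close> in \<open>M\<close> generate the
      same ideal of \<open>invs\<close> as those with \<open>i\<close> in \<open>M0\<close>. A set
      \<open>M\<close> of least cardinality is taken below, so that no \<open>q k\<close> is a
      combination of the others, as \<open>relation_hilbert\<close> requires.\<close>
    define spans where "spans M \<longleftrightarrow> M \<subseteq> M0 \<and>
      (\<forall>j\<in>M0. \<exists>b. (\<forall>i\<in>M. b i \<in> invs) \<and> q j = (\<Sum>i\<in>M. b i * q i))" for M
    have "spans M0" unfolding spans_def
    proof (intro conjI ballI)
      fix j assume j: "j \<in> M0"
      have "q j = (\<Sum>i\<in>M0. (if i = j then 1 else 0) * q i)"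
        using M0_fin j by (simp add: if_distrib[of "\<lambda>a. a * _"] cong: if_cong)
      then show "\<exists>b. (\<forall>i\<in>M0. b i \<in> invs) \<and> q j = (\<Sum>i\<in>M0. b i * q i)"
        by (intro exI[of _ "\<lambda>i. if i = j then 1 else 0"]) (auto intro: invs_closed)
    qed simp
    then obtain M where M: "spans M" and min: "\<And>M'. spans M' \<Longrightarrow> card M \<le> card M'"
      using ex_has_least_nat[of spans M0 card] by blast
    have M_sub: "M \<subseteq> M0" using M by (simp add: spans_def)
    have M_fin: "finite M" using M_sub M0_fin finite_subset by blast
    have M_min: "q k \<noteq> (\<Sum>i\<in>M - {k}. b i * q i)" if k: "k \<in> M" and b: "\<And>i. i \<in> M - {k} \<Longrightarrow> b i \<in> invs"
      for k b
    proof
      assume qk: "q k = (\<Sum>i\<in>M - {k}. b i * q i)"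
      have "spans (M - {k})" unfolding spans_def
      proof (intro conjI ballI)
        fix j assume "j \<in> M0"
        then obtain c where c: "\<And>i. i \<in> M \<Longrightarrow> c i \<in> invs" "q j = (\<Sum>i\<in>M. c i * q i)"
          using M unfolding spans_def by blast
        have "q j = c k * q k + (\<Sum>i\<in>M - {k}. c i * q i)"
          unfolding c(2) by (rule sum.remove[OF M_fin k])
        also have "\<dots> = (\<Sum>i\<in>M - {k}. (c k * b i + c i) * q i)"
          by (subst qk) (simp add: sum_distrib_left sum.distrib ring_distribs mult.assoc)
        finally have "q j = (\<Sum>i\<in>M - {k}. (c k * b i + c i) * q i)" .
        moreover have "c k * b i + c i \<in> invs" if "i \<in> M - {k}" for i
          using that b c(1) k by (intro invs_closed) auto
        ultimately show "\<exists>b. (\<forall>i\<in>M - {k}. b i \<in> invs) \<and> q j = (\<Sum>i\<in>M - {k}. b i * q i)"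
          by (intro exI[of _ "\<lambda>i. c k * b i + c i"]) blast
      qed (use M_sub in auto)
      from min[OF this] show False using k M_fin card_Diff1_less[OF M_fin k] by simp
    qed
    have "M \<noteq> {}"
    proof
      assume "M = {}"
      obtain j where j: "j \<in> M0" using M0_ne by blast
      have "q j = 0" using M j \<open>M = {}\<close> unfolding spans_def by auto
      then show False using q_nz j by (auto simp: M0_def)
    qed
    then obtain k where k: "k \<in> M" by blast
    have k0: "k < r" "k \<in> M0" using k M_sub by (auto simp: M0_def)
    \<comment> \<open>The coefficients can be taken homogeneous: comparing components of degree
      \<open>D - d j\<close> leaves degree \<open>d i - d j\<close> for the coefficient of
      \<open>q i\<close>, and the coefficient 0 if that difference is negative.\<close>
    define R where "R j g \<longleftrightarrow> (\<forall>i\<in>M. g i \<in> invs \<and> (g i \<noteq> 0 \<longrightarrow> d j \<le> d i \<and> homog (d i - d j) (g i))) \<and>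
      q j = (\<Sum>i\<in>M. g i * q i)" for j g
    have "\<exists>g. R j g" if j: "j \<in> M0" for j
    proof -
      obtain b where b: "\<And>i. i \<in> M \<Longrightarrow> b i \<in> invs" "q j = (\<Sum>i\<in>M. b i * q i)"
        using M j unfolding spans_def by blast
      define g where "g i = (if D - d i \<le> D - d j then hc ((D - d j) - (D - d i)) (b i) else 0)" for i
      have "q j = hc (D - d j) (q j)" using hc_homog[OF hom_q(1)[OF j]] by simp
      also have "\<dots> = (\<Sum>i\<in>M. hc (D - d j) (q i * b i))"
        unfolding b(2) mult.commute[of "b _"]
        by (rule hc_sum) (use b(1) q_invs M_sub in \<open>auto intro!: Pol_polylike invs_Pol invs_closed simp: M0_def\<close>)
      also have "\<dots> = (\<Sum>i\<in>M. g i * q i)"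
      proof (rule sum.cong)
        fix i assume i: "i \<in> M"
        have qi: "homog (D - d i) (q i)" using hom_q i M_sub by blast
        show "hc (D - d j) (q i * b i) = g i * q i"
          unfolding hc_mult_homog[OF qi Pol_polylike[OF invs_Pol[OF b(1)[OF i]]]] g_def
          by (simp add: mult.commute)
      qed simp
      finally have "q j = (\<Sum>i\<in>M. g i * q i)" .
      moreover have "g i \<in> invs \<and> (g i \<noteq> 0 \<longrightarrow> d j \<le> d i \<and> homog (d i - d j) (g i))" if i: "i \<in> M" for i
      proof -
        have "d i \<le> D" "d j \<le> D" using hom_q(2) i j M_sub by auto
        then show ?thesis using b(1)[OF i]
          by (auto simp: g_def intro!: invs_hc invs_closed homog_hc Pol_polylike invs_Pol)
      qed
      ultimately show ?thesis unfolding R_def by blast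
    qed
    then obtain g where gR: "\<And>j. j \<in> M0 \<Longrightarrow> R j (g j)" by metis
    have g: "\<And>i j. j \<in> M0 \<Longrightarrow> i \<in> M \<Longrightarrow> g j i \<in> invs"
      "\<And>i j. j \<in> M0 \<Longrightarrow> i \<in> M \<Longrightarrow> g j i \<noteq> 0 \<Longrightarrow> d j \<le> d i \<and> homog (d i - d j) (g j i)"
      "\<And>j. j \<in> M0 \<Longrightarrow> q j = (\<Sum>i\<in>M. g j i * q i)"
      using gR unfolding R_def by simp_all
    \<comment> \<open>This is the coefficient of \<open>q i\<close> after the \<open>q j\<close>
      with \<open>j\<close> outside \<open>M\<close> have been replaced by their expressions through
      \<open>M\<close> in the differentiated relation, the sum of all
      \<open>q j * dS l (h j)\<close>.\<close>
    define p where "p l i = dS l (h i) + (\<Sum>j\<in>M0 - M. g j i * dS l (h j))" for l i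
    have dS_h: "dS l (h j) \<in> Pol" if "l < n" "j < r" for l j using that h_invs invs_Pol dS_Pol by blast
    have p_Pol: "p l i \<in> Pol" if "l < n" "i \<in> M" for l i
      unfolding p_def
    proof (intro Pol_closed)
      show "dS l (h i) \<in> Pol" using that M_sub dS_h by (auto simp: M0_def)
      show "g j i \<in> Pol" "dS l (h j) \<in> Pol" if "j \<in> M0 - M" for j
        using that \<open>l < n\<close> \<open>i \<in> M\<close> dS_h g(1) invs_Pol by (auto simp: M0_def)
    qed
    have p_rel: "(\<Sum>i\<in>M. q i * p l i) = 0" if l: "l < n" for l
    proof -
      have split: "(\<Sum>i\<in>M0. f i) = (\<Sum>i\<in>M. f i) + (\<Sum>i\<in>M0 - M. f i)" for f :: "nat \<Rightarrow> 'a \<Rightarrow> complex"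
        using sum.subset_diff[OF M_sub M0_fin, of f] by (simp add: add.commute)
      have "(\<Sum>i<r. q i * dS l (h i)) = 0"
      proof
        fix v
        have "dS l (\<lambda>v. Q (\<lambda>i. h i v)) v = (\<Sum>i<r. pd i Q (\<lambda>i. h i v) * dS l (h i) v)"
          by (rule dS_chain[OF less(2) invs_Pol[OF h_invs] l])
        moreover have "dS l (\<lambda>v. Q (\<lambda>i. h i v)) v = 0"
          by (rule dS_eqI) (simp add: less(4))
        ultimately show "(\<Sum>i<r. q i * dS l (h i)) v = 0 v" by (simp add: fapply q_def)
      qed
      moreover have "(\<Sum>i<r. q i * dS l (h i)) = (\<Sum>i\<in>M0. q i * dS l (h i))"
      proof (rule sum.mono_neutral_right)
        show "\<forall>i\<in>{..<r} - M0. q i * dS l (h i) = 0"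
        proof
          fix i assume "i \<in> {..<r} - M0"
          then have "q i = 0" by (auto simp: M0_def q_def fun_eq_iff fapply)
          then show "q i * dS l (h i) = 0" by simp
        qed
      qed (auto simp: M0_def)
      ultimately have "(\<Sum>i\<in>M. q i * dS l (h i)) + (\<Sum>j\<in>M0 - M. q j * dS l (h j)) = 0"
        unfolding split by simp
      moreover have "(\<Sum>j\<in>M0 - M. q j * dS l (h j)) = (\<Sum>j\<in>M0 - M. \<Sum>i\<in>M. q i * (g j i * dS l (h j)))"
      proof (rule sum.cong)
        fix j assume "j \<in> M0 - M"
        then have "q j * dS l (h j) = (\<Sum>i\<in>M. g j i * q i) * dS l (h j)" using g(3)[of j] by simp
        then show "q j * dS l (h j) = (\<Sum>i\<in>M. q i * (g j i * dS l (h j)))"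
          by (simp add: sum_distrib_right sum_distrib_left mult_ac)
      qed simp
      moreover have "\<dots> = (\<Sum>i\<in>M. \<Sum>j\<in>M0 - M. q i * (g j i * dS l (h j)))" by (rule sum.swap)
      ultimately show ?thesis
        by (simp only: p_def ring_distribs sum.distrib sum_distrib_left)
    qed
    have p_hom: "homog (d k - 1) (p l k)" if l: "l < n" for l
      unfolding p_def
    proof (intro homog_add homog_sum)
      show "homog (d k - 1) (dS l (h k))"
        using k0 l h_invs invs_Pol h_homog d_pos by (intro homog_dS) auto
      fix j assume j: "j \<in> M0 - M"
      then have j0: "j \<in> M0" "j < r" by (auto simp: M0_def)
      show "homog (d k - 1) (g j k * dS l (h j))"
      proof (cases "g j k = 0")
        case True
        then show ?thesis using homog_zero by simp
      next
        case False
        then have *: "d j \<le> d k" "homog (d k - d j) (g j k)" using g(2) j0 k by auto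
        have "homog (d j - 1) (dS l (h j))"
          using j0 l h_invs invs_Pol h_homog d_pos by (intro homog_dS) auto
        from homog_mult[OF *(2) this] show ?thesis using *(1) d_pos[OF j0(2)] by simp
      qed
    qed
    have p_ideal: "p l k \<in> hilbert_ideal" if l: "l < n" for l
      using relation_hilbert[of M k q "p l" "d k - 1", OF M_fin k _ p_Pol[OF l] p_rel[OF l] p_hom[OF l] M_min[OF k]]
        q_invs M_sub by (auto simp: M0_def)
    \<comment> \<open>The sum of \<open>x l * p l k\<close> over \<open>l\<close>, in which Euler's
      formula turns derivatives of h_j into \<open>d j\<close> times h_j. It is invariant, so it
      equals its own average, and the average is decomposable because each \<open>p l k\<close> lies
      in the Hilbert ideal.\<close>
    define T where "T = fscale (of_nat (d k)) (h k) + (\<Sum>j\<in>M0 - M. fscale (of_nat (d j)) (g j k * h j))"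
    have "T = (\<Sum>l<n. x l * p l k)"
    proof
      fix v
      have E: "(\<Sum>l<n. x l v * dS l (h j) v) = of_nat (d j) * h j v" if "j < r" for j
        using Euler h_homog h_invs invs_Pol that by blast
      have "(\<Sum>l<n. x l * p l k) v = (\<Sum>l<n. x l v * dS l (h k) v) +
          (\<Sum>l<n. \<Sum>j\<in>M0 - M. g j k v * (x l v * dS l (h j) v))"
        by (simp add: p_def fapply ring_distribs sum.distrib sum_distrib_left mult_ac)
      also have "(\<Sum>l<n. \<Sum>j\<in>M0 - M. g j k v * (x l v * dS l (h j) v)) =
          (\<Sum>j\<in>M0 - M. \<Sum>l<n. g j k v * (x l v * dS l (h j) v))" by (rule sum.swap)
      also have "\<dots> = (\<Sum>j\<in>M0 - M. g j k v * (of_nat (d j) * h j v))"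
        by (rule sum.cong) (auto simp: E M0_def sum_distrib_left[symmetric])
      finally show "T v = (\<Sum>l<n. x l * p l k) v"
        using E[OF k0(1)] by (simp add: T_def fapply mult_ac)
    qed
    moreover have "avg (\<Sum>l<n. x l * p l k) \<in> decomp"
      unfolding avg_sum
      by (intro decomp_closed(6) avg_mult_hilbert) (auto simp: Pol_x linfun_0 linfun_x p_ideal)
    moreover have "T \<in> invs" unfolding T_def
      using k0 k g(1) h_invs by (intro invs_closed invs_sum) (auto simp: M0_def)
    ultimately have T: "T \<in> decomp" using avg_invs_id by simp
    \<comment> \<open>The linear part of \<open>T\<close> modulo decomposables. If
      \<open>d j = d k\<close>, then \<open>g j k\<close> is constant; otherwise it is zero or an
      invariant of positive degree, and its product with \<open>h j\<close> is decomposable. The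
      entry at \<open>k\<close> itself is the nonzero number \<open>d k\<close>.\<close>
    define c where "c j = (if j = k then of_nat (d k) else
      if j \<in> M0 - M \<and> d j = d k then of_nat (d j) * g j k 0 else 0)" for j
    have "T - (\<Sum>j<r. fscale (c j) (h j)) \<in> decomp"
    proof -
      have gh: "fscale (of_nat (d j)) (g j k * h j) - fscale (c j) (h j) \<in> decomp" if j: "j \<in> M0 - M" for j
      proof -
        have jk: "j \<noteq> k" "j < r" "j \<in> M0" using j k by (auto simp: M0_def)
        have hp: "h j \<in> invs_pos" using jk h_invs h_homog d_pos by (intro invs_posI) auto
        consider "g j k = 0" | "g j k \<noteq> 0" "d j = d k" | "g j k \<noteq> 0" "d j \<noteq> d k" by blast
        then show ?thesis
        proof cases
          case 1
          then have "c j = 0" using jk by (simp add: c_def fapply)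
          then show ?thesis using 1 decomp_closed(2) by simp
        next
          case 2
          then have "homog 0 (g j k)" using g(2) jk k by force
          then have "g j k = (\<lambda>v. g j k 0)" by (rule homog_0_const)
          from fun_cong[OF this] have gv: "g j k v = g j k 0" for v .
          have "fscale (of_nat (d j)) (g j k * h j) v = fscale (c j) (h j) v" for v
            using 2 j jk gv[of v] by (simp add: fapply c_def)
          then have "fscale (of_nat (d j)) (g j k * h j) = fscale (c j) (h j)" by (rule ext)
          then show ?thesis using decomp_closed(2) by simp
        next
          case 3
          then have *: "homog (d k - d j) (g j k)" "d k - d j > 0" using g(2)[of j k] jk k by auto
          have "g j k \<in> invs_pos" using * g(1) jk k by (intro invs_posI) auto
          moreover have "c j = 0" using 3 jk by (simp add: c_def)
          ultimately show ?thesis using hp by (simp add: decomp_closed)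
        qed
      qed
      have "(\<Sum>j<r. fscale (c j) (h j)) = (\<Sum>j\<in>insert k (M0 - M). fscale (c j) (h j))"
        by (rule sum.mono_neutral_right) (use k0 in \<open>auto simp: c_def M0_def\<close>)
      also have "\<dots> = fscale (of_nat (d k)) (h k) + (\<Sum>j\<in>M0 - M. fscale (c j) (h j))"
        using k M0_fin by (simp add: c_def)
      finally have "T - (\<Sum>j<r. fscale (c j) (h j)) =
          (\<Sum>j\<in>M0 - M. fscale (of_nat (d j)) (g j k * h j) - fscale (c j) (h j))"
        by (simp add: T_def sum_subtractf)
      then show ?thesis using decomp_closed(6)[of "M0 - M", OF gh] by simp
    qed
    from decomp_closed(4)[OF T this] have "(\<Sum>j<r. fscale (c j) (h j)) \<in> decomp" by simp
    then have "c k = 0" using h_indep k0 by blast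
    then show False using d_pos[OF k0(1)] by (simp add: c_def)
  qed
qed

text \<open>Since h_i(c v) = c^(d i) h_i(v), the weighted components of a relation are again
  relations, so the homogeneous case applies to each of them.\<close>

lemma primitive_alg_indep: "alg_indep r h"
  unfolding alg_indep_def
proof (intro ballI impI)
  fix P assume P: "P \<in> Pn r" "\<forall>v. P (\<lambda>i. h i v) = 0"
  have gr: "w.polylike P" "\<And>D. w.hc D P \<in> Pn r" "\<exists>N. \<forall>D>N. w.hc D P = 0"
    using w.ga_graded[OF w_homog_coord] P(1) unfolding Pn_def by blast+
  have "w.hc D P (\<lambda>i. h i v) = 0" for D v
  proof -
    have "w.ray_poly P (\<lambda>i. h i v) = 0"
    proof (rule w.ray_poly_eqI)
      fix c
      have "P (\<lambda>i. c ^ d i * h i v) = P (\<lambda>i. h i (s c v))"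
        by (rule Pn_cong[OF P(1)]) (simp add: homogD[OF h_homog])
      then show "P (\<lambda>i. c ^ d i * h i v) = poly 0 c" using P(2) by simp
    qed
    then show ?thesis by (simp add: w.hc_def)
  qed
  then have "w.hc D P = 0" for D
    using no_homogeneous_relation[OF gr(2) w.homog_hc[OF gr(1)]] by blast
  then show "P = 0" using w.hc_decomp[OF gr(1), of 0] by simp
qed

end

text \<open>A homogeneous invariant of positive degree that is not congruent to a combination of a
  largest primitive family could be adjoined to it. That \<open>r = n\<close> needs the separate
  bound \<open>generators_ge\<close>.\<close>

theorem Chevalley_le:
  "\<exists>r h. r \<le> n \<and> (\<forall>i<r. h i \<in> invs \<and> (\<exists>d>0. homog d (h i))) \<and> alg_indep r h \<and>
    generated_algebra (h ` {..<r}) = invs"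
proof -
  let ?P = "\<lambda>r. \<exists>h d. primitive r h d"
  have bound: "r \<le> n" if "primitive r h d" for r h d
    by (rule alg_indep_Pol_le[OF _ primitive_alg_indep[OF that]])
      (use that in \<open>auto simp: primitive_def invs_Pol\<close>)
  have "?P 0" by (simp add: primitive_def)
  then obtain r where r: "?P r" and max: "\<And>k. ?P k \<Longrightarrow> k \<le> r"
    using Nat.ex_has_greatest_nat[of ?P 0 n] bound by metis
  obtain h d where prim: "primitive r h d" using r by blast
  note h = prim[unfolded primitive_def]
  have hdec: "\<exists>c. f - (\<Sum>i<r. fscale (c i) (h i)) \<in> decomp" if f: "f \<in> invs" "homog m f" "m > 0" for f m
  proof (rule ccontr)
    assume no: "\<not> ?thesis"
    let ?h = "h(r := f)" and ?d = "d(r := m)"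
    have "c i = 0" if c: "(\<Sum>i<Suc r. fscale (c i) (?h i)) \<in> decomp" and i: "i < Suc r" for c i
    proof -
      have eq: "(\<Sum>i<Suc r. fscale (c i) (?h i)) = (\<Sum>i<r. fscale (c i) (h i)) + fscale (c r) f"
        by simp
      have cr: "c r = 0"
      proof (rule ccontr)
        assume cr: "c r \<noteq> 0"
        have "fscale (1 / c r) (\<Sum>i<Suc r. fscale (c i) (?h i)) =
            f - (\<Sum>i<r. fscale (- (c i / c r)) (h i))"
          unfolding eq using cr by (simp add: fun_eq_iff fapply field_simps sum_distrib_left sum_negf)
        then show False using decomp_closed(5)[OF c, of "1 / c r"] no by metis
      qed
      then have "(\<Sum>i<r. fscale (c i) (h i)) \<in> decomp" using c unfolding eq by simp
      then have "\<forall>i<r. c i = 0" using h by blast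
      then show ?thesis using cr i by (auto simp: less_Suc_eq)
    qed
    then have "primitive (Suc r) ?h ?d" using h f unfolding primitive_def by (auto simp: less_Suc_eq)
    then show False using max[of "Suc r"] by auto
  qed
  have "invs \<subseteq> generated_algebra (h ` {..<r})"
  proof (rule invs_nakayama)
    show "\<exists>d. homog d (h i)" if "i < r" for i using h that by blast
    fix f assume f: "f \<in> invs"
    obtain N where N: "\<And>m. m > N \<Longrightarrow> hc m f = 0" using Pol_bound[OF invs_Pol[OF f]] by blast
    have "\<exists>g\<in>generated_algebra (h ` {..<r}). hc m f - g \<in> decomp" for m
    proof (cases "m = 0")
      case True
      have "hc 0 f = (\<lambda>v. hc 0 f 0)" by (rule homog_0_const[OF homog_hc[OF Pol_polylike[OF invs_Pol[OF f]]]])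
      then have "hc 0 f \<in> generated_algebra (h ` {..<r})" using generated_algebra.const by metis
      then show ?thesis using True decomp_closed(2) by (intro bexI[of _ "hc 0 f"]) auto
    next
      case False
      obtain c where "hc m f - (\<Sum>i<r. fscale (c i) (h i)) \<in> decomp"
        using hdec[OF invs_hc[OF f] homog_hc[OF Pol_polylike[OF invs_Pol[OF f]]]] False by blast
      moreover have "(\<Sum>i<r. fscale (c i) (h i)) \<in> generated_algebra (h ` {..<r})"
        by (intro ga_sum ga_scale generated_algebra.gen) auto
      ultimately show ?thesis by blast
    qed
    then obtain g where g: "\<And>m. g m \<in> generated_algebra (h ` {..<r})" "\<And>m. hc m f - g m \<in> decomp"
      by metis
    have "f - (\<Sum>m\<le>N. g m) = (\<Sum>m\<le>N. hc m f - g m)"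
      unfolding sum_subtractf using hc_decomp[OF Pol_polylike[OF invs_Pol[OF f]] N] by simp
    then have "f - (\<Sum>m\<le>N. g m) \<in> decomp" using g(2) by (simp add: decomp_closed(6))
    then show "\<exists>g\<in>generated_algebra (h ` {..<r}). f - g \<in> decomp"
      using g(1) by (intro bexI[of _ "\<Sum>m\<le>N. g m"] ga_sum)
  qed
  then have "generated_algebra (h ` {..<r}) = invs" using ga_invs[of r h] h by blast
  then show ?thesis using bound[OF prim] primitive_alg_indep[OF prim] h
    by (intro exI[of _ r] exI[of _ h]) blast
qed

end

section \<open>Separating orbits to first order\<close>

context coord_space
begin

text \<open>The product \<open>D a\<close> is 1 at \<open>a\<close> and 0 on \<open>Y\<close>.
  Passing to 1 minus the product of all \<open>1 - D a\<close> gives the value 1 on the whole of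
  \<open>X\<close>, whatever \<open>D a\<close> does at the other points of
  \<open>X\<close>.\<close>

lemma interpolation:
  assumes "finite X" "finite Y" "X \<inter> Y = {}"
  shows "\<exists>f\<in>Pol. (\<forall>v\<in>X. f v = 1) \<and> (\<forall>v\<in>Y. f v = 0)"
proof -
  have "\<exists>f\<in>Pol. f a = 1 \<and> f b = 0" if "a \<noteq> b" for a b
  proof -
    have "\<exists>i<n. x i a \<noteq> x i b" using x_sep[of a b] \<open>a \<noteq> b\<close> by blast
    then obtain i where i: "i < n" "x i a \<noteq> x i b" by blast
    have "fscale (1 / (x i a - x i b)) (x i - (\<lambda>v. x i b)) \<in> Pol" using i by (intro Pol_closed)
    then show ?thesis using i by (intro bexI) (auto simp: fapply)
  qed
  then obtain \<delta> where \<delta>: "\<And>a b. a \<noteq> b \<Longrightarrow> \<delta> a b \<in> Pol \<and> \<delta> a b a = 1 \<and> \<delta> a b b = 0" by metis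
  define D where "D a = (\<Prod>b\<in>Y. \<delta> a b)" for a
  have ne: "a \<noteq> b" if "a \<in> X" "b \<in> Y" for a b using that assms(3) by auto
  have D_Pol: "D a \<in> Pol" if "a \<in> X" for a
    unfolding D_def using \<delta> ne[OF that] by (intro Pol_closed) blast
  have D1: "D a a = 1" if "a \<in> X" for a
    unfolding D_def prod_fun_apply using \<delta> ne[OF that] by (intro prod.neutral) blast
  have D0: "D a b = 0" if "a \<in> X" "b \<in> Y" for a b
    unfolding D_def prod_fun_apply using \<delta> ne[OF that] that assms(2) by (intro prod_zero) blast+
  define f where "f = 1 - (\<Prod>a\<in>X. 1 - D a)"
  have "f \<in> Pol" unfolding f_def using D_Pol by (intro Pol_closed)
  moreover have "f v = 1" if "v \<in> X" for v
  proof -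
    have "(\<Prod>a\<in>X. 1 - D a v) = 0" using that D1 assms(1) by (intro prod_zero) auto
    then show ?thesis by (simp add: f_def fapply)
  qed
  moreover have "f v = 0" if "v \<in> Y" for v
    using that D0 by (simp add: f_def fapply)
  ultimately show ?thesis by blast
qed

end

lemma pd_comp:
  assumes R: "R \<in> Pn r" and F: "\<And>i. i < r \<Longrightarrow> F i \<in> Pn m" and l: "l < m"
  shows "pd l (\<lambda>y. R (\<lambda>i. F i y)) y = (\<Sum>i<r. pd i R (\<lambda>i. F i y) * pd l (F i) y)"
proof (rule pd_eqI)
  from pd_chain[OF R, where w = "\<lambda>t i. F i (y(l := t))" and t = "y l", OF pd_DERIV[OF F l]]
  show "((\<lambda>t. R (\<lambda>i. F i (y(l := t)))) has_field_derivative
      (\<Sum>i<r. pd i R (\<lambda>i. F i y) * pd l (F i) y)) (at (y l))" by simp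
qed

text \<open>The purpose of squaring the separating function: a squared factor vanishing at the point
  removes the first derivative, whatever \<open>A\<close> is.\<close>

lemma pd_mult_square_zero:
  assumes "A \<in> Pn r" "B \<in> Pn r" "l < r" "B y = 0"
  shows "pd l (A * (B * B)) y = 0"
  using assms by (simp add: pd_mult[of _ r] Pn_closed fapply)

text \<open>Instantiated twice: with the trivial group as \<open>H\<close> for the bound on the
  number of generators, and with the group generated by the reflections for the converse.\<close>

locale normal_subgroup = fin_lin_group +
  fixes H :: "('a \<Rightarrow> 'a) set"
  assumes H_group: "fin_lin_group s n x e H" and H_sub: "H \<subseteq> W"
    and H_normal: "w \<in> W \<Longrightarrow> h \<in> H \<Longrightarrow> \<exists>h'\<in>H. w \<circ> h = h' \<circ> w"
begin

sublocale H: fin_lin_group s n x e H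
  by (rule H_group)

lemma invs_sub: "invs \<subseteq> H.invs"
  using H_sub by (auto simp: invs_def H.invs_def)

lemma H_invs_comp:
  assumes b: "b \<in> H.invs" and w: "w \<in> W"
  shows "b \<circ> w \<in> H.invs"
  unfolding H.invs_def
proof (intro CollectI conjI ballI)
  show "b \<circ> w \<in> Pol" using b w W_lin H.invs_Pol by (intro Pol_comp)
  fix h assume "h \<in> H"
  then obtain h' where h': "h' \<in> H" "w \<circ> h = h' \<circ> w" using H_normal[OF w] by blast
  have "(b \<circ> w) \<circ> h = (b \<circ> h') \<circ> w" by (simp only: comp_assoc h'(2))
  then show "(b \<circ> w) \<circ> h = b \<circ> w" using H.invsD[OF b h'(1)] by simp
qed

text \<open>If the stabilizer of \<open>v\<close> lies in \<open>H\<close>, then \<open>H v\<close>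
  and \<open>(W - H) v\<close> are disjoint, and an interpolating polynomial separates them. Both
  sets are stable under \<open>H\<close>, so averaging over \<open>H\<close> keeps the two
  values.\<close>

lemma separating_invariant:
  assumes stab: "\<And>w. w \<in> W \<Longrightarrow> w v = v \<Longrightarrow> w \<in> H"
  shows "\<exists>b\<in>H.invs. b v = 1 \<and> (\<forall>w\<in>W - H. b (w v) = 0)"
proof -
  have mem: "w \<in> H" if w: "w \<in> W" and h: "h \<in> H" "w v = h v" for w h
  proof -
    obtain k where k: "k \<in> H" "k \<circ> h = id" "h \<circ> k = id" using H.W_inv[OF h(1)] by blast
    have "k (w v) = v" using h(2) fun_cong[OF k(2), of v] by simp
    then have "k \<circ> w \<in> H" using stab[of "k \<circ> w"] W_comp w k(1) H_sub by auto
    from H.W_comp[OF h(1) this] have "h \<circ> (k \<circ> w) \<in> H" .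
    then show ?thesis using k(3) by (simp add: comp_assoc[symmetric])
  qed
  have "(\<lambda>h. h v) ` H \<inter> (\<lambda>w. w v) ` (W - H) = {}" using mem by auto
  then obtain f where f: "f \<in> Pol" "\<And>h. h \<in> H \<Longrightarrow> f (h v) = 1" "\<And>w. w \<in> W - H \<Longrightarrow> f (w v) = 0"
    using interpolation[of "(\<lambda>h. h v) ` H" "(\<lambda>w. w v) ` (W - H)"] fin H.fin by auto
  have "H.avg f v = 1" using f(2) H.card_W by (simp add: H.avg_apply)
  moreover have "H.avg f (w v) = 0" if w: "w \<in> W - H" for w
  proof -
    have "f (h (w v)) = 0" if h: "h \<in> H" for h
    proof -
      have "h \<circ> w \<notin> H"
      proof
        assume hw: "h \<circ> w \<in> H"
        obtain k where k: "k \<in> H" "k \<circ> h = id" using H.W_inv[OF h] by blast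
        have "k \<circ> (h \<circ> w) \<in> H" using k(1) hw by (rule H.W_comp)
        then show False using w k(2) by (simp add: comp_assoc[symmetric])
      qed
      then have "h \<circ> w \<in> W - H" using w h H_sub W_comp by auto
      from f(3)[OF this] show ?thesis by simp
    qed
    then show ?thesis by (simp add: H.avg_apply)
  qed
  ultimately show ?thesis using H.avg_invs[OF f(1)] by blast
qed

text \<open>Averaging \<open>(h\<^sub>j - h\<^sub>j(v)) b\<^sup>2\<close> over \<open>W\<close>, where \<open>b\<close> separates the orbits of \<open>v\<close>: the terms with
  \<open>w \<notin> H\<close> vanish to second order at \<open>h(v)\<close>.\<close>

lemma separating_tangent:
  assumes h: "\<And>i. i < r \<Longrightarrow> h i \<in> H.invs" and gen: "H.invs \<subseteq> generated_algebra (h ` {..<r})"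
    and ind: "alg_indep r h" and stab: "\<And>w. w \<in> W \<Longrightarrow> w v = v \<Longrightarrow> w \<in> H" and j: "j < r"
  shows "\<exists>Q\<in>Pn r. (\<lambda>v. Q (\<lambda>i. h i v)) \<in> invs \<and>
    (\<forall>l<r. pd l Q (\<lambda>i. h i v) = (if l = j then 1 else 0))"
proof -
  obtain b where b: "b \<in> H.invs" "b v = 1" "\<And>w. w \<in> W - H \<Longrightarrow> b (w v) = 0"
    using separating_invariant[OF stab] by blast
  have lift: "\<exists>P\<in>Pn r. f = (\<lambda>v. P (\<lambda>i. h i v))" if "f \<in> H.invs" for f
    using gen that generated_algebra_image_iff by blast
  obtain B where B: "\<And>w. w \<in> W \<Longrightarrow> B w \<in> Pn r" "\<And>w. w \<in> W \<Longrightarrow> b \<circ> w = (\<lambda>v. B w (\<lambda>i. h i v))"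
    using lift[OF H_invs_comp[OF b(1)]] by metis
  obtain P where P: "\<And>w. w \<in> W \<Longrightarrow> P w \<in> Pn r" "\<And>w. w \<in> W \<Longrightarrow> h j \<circ> w = (\<lambda>v. P w (\<lambda>i. h i v))"
    using lift[OF H_invs_comp[OF h[OF j]]] by metis
  let ?y = "\<lambda>i. h i v"
  define c where "c = h j v"
  define T where "T w = (P w - (\<lambda>y. c)) * (B w * B w)" for w
  have T_Pn: "T w \<in> Pn r" if "w \<in> W" for w
    unfolding T_def using P(1)[OF that] B(1)[OF that] by (intro Pn_closed)
  have T_comp: "(\<lambda>v. T w (\<lambda>i. h i v)) = ((h j - (\<lambda>y. c)) * (b * b)) \<circ> w" if "w \<in> W" for w
    using fun_cong[OF P(2)[OF that]] fun_cong[OF B(2)[OF that]]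
    by (simp add: fun_eq_iff fapply T_def)
  have pd_T: "pd l (T w) ?y = (if w \<in> H then (if l = j then 1 else 0) else 0)"
    if w: "w \<in> W" and l: "l < r" for w l
  proof (cases "w \<in> H")
    case True
    \<comment> \<open>Algebraic independence identifies the polynomial representing h_j o w = h_j
      with a coordinate. As \<open>coord j - c\<close> vanishes at the point and the squared factor
      is 1 there, only the derivative of the coordinate survives.\<close>
    have "P w = coord j"
      using fun_cong[OF P(2)[OF w]] H.invsD[OF h[OF j] True]
      by (intro alg_indepD[OF ind P(1)[OF w] coord_Pn[OF j]]) (simp add: coord_def)
    moreover have "B w ?y = 1" using fun_cong[OF B(2)[OF w], of v] H.invs_apply[OF b(1) True] b(2) by simp
    ultimately show ?thesis
      using True l j B(1)[OF w]
      by (simp add: T_def pd_mult[of _ r] pd_diff[of _ r] Pn_closed pd_coord pd_const)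
        (simp add: fapply coord_def c_def)
  next
    case False
    then have "B w ?y = 0" using fun_cong[OF B(2)[OF w], of v] b(3) w by simp
    then show ?thesis unfolding T_def using False w l P(1) B(1)
      by (simp add: pd_mult_square_zero[of _ r] Pn_closed)
  qed
  \<comment> \<open>Each \<open>w\<close> in \<open>H\<close> contributes the unit covector at
    \<open>j\<close> and all other \<open>w\<close> contribute 0, hence the division by
    \<open>card H\<close>. The composite with \<open>h\<close> is a multiple of an average over
    \<open>W\<close>, so it is invariant.\<close>
  define Q where "Q = fscale (1 / of_nat (card H)) (\<Sum>w\<in>W. T w)"
  have sum_Pn: "(\<Sum>w\<in>W. T w) \<in> Pn r" by (intro Pn_closed T_Pn)
  have Q_Pn: "Q \<in> Pn r" unfolding Q_def by (intro Pn_closed T_Pn)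
  have "(\<lambda>v. Q (\<lambda>i. h i v)) =
      fscale (1 / of_nat (card H) * of_nat (card W)) (avg ((h j - (\<lambda>y. c)) * (b * b)))"
    using fun_cong[OF T_comp] card_W by (simp add: fun_eq_iff Q_def avg_def fapply)
  moreover have "(h j - (\<lambda>y. c)) * (b * b) \<in> Pol"
    using h[OF j] b(1) H.invs_Pol by (intro Pol_closed)
  ultimately have "(\<lambda>v. Q (\<lambda>i. h i v)) \<in> invs" using avg_invs invs_closed(7) by simp
  moreover have "pd l Q ?y = (if l = j then 1 else 0)" if l: "l < r" for l
  proof -
    have "pd l Q ?y = 1 / of_nat (card H) * (\<Sum>w\<in>W. pd l (T w) ?y)"
      unfolding Q_def pd_scale[OF sum_Pn l] using pd_sum[OF fin T_Pn l] by simp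
    also have "(\<Sum>w\<in>W. pd l (T w) ?y) = (\<Sum>w\<in>W. if w \<in> H then (if l = j then 1 else 0) else 0)"
      by (rule sum.cong) (auto simp: pd_T l)
    also have "\<dots> = (\<Sum>w\<in>H. if l = j then 1 else 0)"
      using H_sub fin by (simp add: sum.inter_restrict[symmetric] Int_absorb1)
    finally show ?thesis using H.card_W by simp
  qed
  ultimately show ?thesis using Q_Pn by blast
qed

end

section \<open>Lower bound for the number of generators of the invariants\<close>

context fin_lin_group
begin

text \<open>For \<open>w\<close> other than the identity some (x_i o w) - x_i is a nonzero
  polynomial vanishing on the fixed points of \<open>w\<close>; a common nonzero point of these
  polynomials has trivial stabilizer.\<close>

lemma exists_regular: "\<exists>v. \<forall>w\<in>W. w v = v \<longrightarrow> w = id"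
proof -
  have "\<exists>i<n. (x i \<circ> w) - x i \<noteq> 0" if w: "w \<noteq> id" for w
  proof (rule ccontr)
    assume "\<not> ?thesis"
    then have "x i (w v) = x i v" if "i < n" for i v
      using that by (auto simp: fun_eq_iff fapply)
    then have "w v = v" for v by (rule x_sep)
    then show False using w by auto
  qed
  then obtain i where i: "\<And>w. w \<noteq> id \<Longrightarrow> i w < n" "\<And>w. w \<noteq> id \<Longrightarrow> (x (i w) \<circ> w) - x (i w) \<noteq> 0"
    by metis
  have "\<exists>v. \<forall>w\<in>W - {id}. ((x (i w) \<circ> w) - x (i w)) v \<noteq> 0"
    using i fin W_lin by (intro exists_common_nonzero) (auto intro!: Pol_closed Pol_comp)
  then obtain v where v: "\<And>w. w \<in> W - {id} \<Longrightarrow> ((x (i w) \<circ> w) - x (i w)) v \<noteq> 0" by blast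
  have "w = id" if "w \<in> W" "w v = v" for w
    using v[of w] that by (auto simp: fapply)
  then show ?thesis by blast
qed

text \<open>For the trivial subgroup, \<open>separating_tangent\<close> yields invariants whose
  differentials at a regular point are the \<open>n\<close> unit covectors. They are polynomials in
  the \<open>f i\<close>, so the \<open>r\<close> differentials of the \<open>f i\<close> span a
  space of dimension \<open>n\<close>.\<close>

lemma generators_ge:
  assumes f: "\<And>i. i < r \<Longrightarrow> f i \<in> Pol" and gen: "invs \<subseteq> generated_algebra (f ` {..<r})"
  shows "n \<le> r"
proof -
  interpret normal_subgroup s n x e W "{id}"
    by unfold_locales (auto simp: W_id linmap_def)
  obtain v where v: "\<And>w. w \<in> W \<Longrightarrow> w v = v \<Longrightarrow> w = id" using exists_regular by blast
  have "H.invs = Pol" by (auto simp: H.invs_def)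
  then have "\<exists>Q\<in>Pn n. (\<lambda>v. Q (\<lambda>i. x i v)) \<in> invs \<and>
      (\<forall>l<n. pd l Q (\<lambda>i. x i v) = (if l = k then 1 else 0))" if "k < n" for k
    using that v alg_indep_x by (intro separating_tangent) (auto simp: Pol_x Pol_def[symmetric])
  then obtain Q where Q: "\<And>k. k < n \<Longrightarrow> Q k \<in> Pn n" "\<And>k. k < n \<Longrightarrow> (\<lambda>v. Q k (\<lambda>i. x i v)) \<in> invs"
    "\<And>k l. k < n \<Longrightarrow> l < n \<Longrightarrow> pd l (Q k) (\<lambda>i. x i v) = (if l = k then 1 else 0)" by metis
  define u where "u k l = (if l = k then 1 else 0 :: complex)" for k l :: nat
  \<comment> \<open>Covectors are functions on all natural numbers here; the value 0 beyond
    \<open>n\<close> lets the identity for \<open>u k\<close> hold at every index.\<close>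
  define b where "b i l = (if l < n then dS l (f i) v else 0)" for i l
  have u_span: "u k \<in> fv.span (b ` {..<r})" if k: "k < n" for k
  proof -
    obtain P where P: "P \<in> Pn r" "(\<lambda>v. Q k (\<lambda>i. x i v)) = (\<lambda>v. P (\<lambda>i. f i v))"
      using gen Q(2)[OF k] generated_algebra_image_iff by blast
    have "u k = (\<Sum>i<r. fscale (pd i P (\<lambda>i. f i v)) (b i))"
    proof
      fix l
      show "u k l = (\<Sum>i<r. fscale (pd i P (\<lambda>i. f i v)) (b i)) l"
      proof (cases "l < n")
        case True
        have "u k l = dS l (\<lambda>v. Q k (\<lambda>i. x i v)) v"
          using dS_Pn[OF Q(1)[OF k] True] Q(3)[OF k True] by (simp add: u_def)
        also have "\<dots> = (\<Sum>i<r. pd i P (\<lambda>i. f i v) * dS l (f i) v)"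
          unfolding P(2) by (rule dS_chain[OF P(1) f True])
        finally show ?thesis using True by (simp add: fapply b_def)
      next
        case False
        then show ?thesis using k by (simp add: u_def b_def fapply)
      qed
    qed
    also have "\<dots> \<in> fv.span (b ` {..<r})"
      by (intro fv.span_sum fv.span_scale fv.span_base) auto
    finally show ?thesis .
  qed
  have inj: "inj_on u {..<n}"
    by (rule inj_onI) (metis u_def zero_neq_one)
  have "fv.independent (u ` {..<n})"
  proof (rule fv.independent_if_scalars_zero)
    fix c y assume c: "(\<Sum>y\<in>u ` {..<n}. fscale (c y) y) = 0" and "y \<in> u ` {..<n}"
    then obtain k where k: "k < n" "y = u k" by auto
    have "0 = (\<Sum>i<n. fscale (c (u i)) (u i)) k"
      using c unfolding sum.reindex[OF inj] by (simp add: fapply o_def)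
    also have "\<dots> = c (u k)"
      using k(1) by (simp add: fapply u_def if_distrib[of "\<lambda>a. _ * a"] cong: if_cong)
    finally show "c y = 0" using k by simp
  qed simp
  then have "card (u ` {..<n}) \<le> card (b ` {..<r})"
    using fv.independent_span_bound[of "b ` {..<r}" "u ` {..<n}"] u_span by auto
  also have "\<dots> \<le> r" using card_image_le[of "{..<r}" b] by simp
  finally show ?thesis using card_image[OF inj] by simp
qed

end

theorem (in refl_group) Chevalley:
  "\<exists>h. (\<forall>i<n. h i \<in> invs \<and> (\<exists>d>0. homog d (h i))) \<and> alg_indep n h \<and>
    generated_algebra (h ` {..<n}) = invs"
proof -
  obtain r h where h: "r \<le> n" "\<forall>i<r. h i \<in> invs \<and> (\<exists>d>0. homog d (h i))" "alg_indep r h"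
    "generated_algebra (h ` {..<r}) = invs" using Chevalley_le by blast
  have "n \<le> r" using h invs_Pol by (intro generators_ge[of r h]) auto
  then have "r = n" using h(1) by simp
  then show ?thesis using h by blast
qed

section \<open>The converse of Chevalley's theorem\<close>

locale refl_subgroup = normal_subgroup +
  assumes H_refl: "refl_group s n x e H" and refl_in_H: "g \<in> W \<Longrightarrow> refl_map g \<Longrightarrow> g \<in> H"
begin

sublocale H: refl_group s n x e H
  by (rule H_refl)

text \<open>Without such a form every w u - u would be a multiple of w a - a, which makes
  \<open>w\<close> a \<open>refl_map\<close> and hence an element of \<open>H\<close>.\<close>

lemma rank_two:
  assumes w: "w \<in> W" "w \<notin> H" and a: "w a \<noteq> a"
  shows "\<exists>l u. linfun l \<and> l (w a - a) = 0 \<and> l (w u - u) \<noteq> 0"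
proof (rule ccontr)
  assume no: "\<not> ?thesis"
  obtain i where i: "i < n" "x i (w a - a) \<noteq> 0" using x_nonzero[of "w a - a"] a by auto
  let ?c = "x i (w a - a)"
  have diff: "x j (u - v) = x j u - x j v" if "j < n" for j u v by (rule linfun_diff[OF linfun_x[OF that]])
  have eq: "w u - u = s (x i (w u - u) / ?c) (w a - a)" for u
  proof (rule x_sep)
    fix j assume j: "j < n"
    \<comment> \<open>The coefficient makes this form vanish at w a - a, so by assumption it
      vanishes at every w u - u, which is the proportionality in coordinate
      \<open>j\<close>.\<close>
    let ?l = "\<lambda>v. x j v - x j (w a - a) / ?c * x i v"
    have "linfun ?l" using i j
      by (auto simp: linfun_def linfunD[OF linfun_x] algebra_simps add_divide_distrib)
    moreover have "?l (w a - a) = 0" using i by simp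
    ultimately have "?l (w u - u) = 0" using no by blast
    then show "x j (w u - u) = x j (s (x i (w u - u) / ?c) (w a - a))"
      by (simp add: linfunD[OF linfun_x[OF j]] mult.commute)
  qed
  let ?l = "\<lambda>u. x i (w u - u) / ?c"
  have "linfun ?l"
    using i by (simp add: linfun_def linfunD[OF linfun_x] linmapD[OF W_lin[OF w(1)]] diff
        add_divide_distrib diff_divide_distrib algebra_simps)
  moreover have "?l \<noteq> 0" using i(2) by (auto simp: fun_eq_iff fapply intro!: exI[of _ a])
  moreover have "w u = u + s (?l u) (w a - a)" for u using eq[of u] by (metis add_diff_cancel_left' diff_add_cancel add.commute)
  ultimately have "refl_map w" unfolding refl_map_def by blast
  then show False using refl_in_H w by blast
qed

text \<open>Let \<open>a\<close> be regular, and for each w outside \<open>H\<close> let l_w be a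
  form that kills w a - a but not every w u - u. If l_w(w b - b) is nonzero for all these w, then
  none of them fixes a point of the line a + t b (which would force t = 0, where the point is
  regular) or of the line b + t a. So \<open>D\<close> has no zero on either line and is constant on
  both. They meet in a + b, whence \<open>D b = D a\<close>; \<open>Pol_domain\<close> extends this
  from such \<open>b\<close> to all points.\<close>

lemma constant_if_nonzero:
  assumes D: "D \<in> Pol" and nz: "\<And>v. (\<And>w. w \<in> W \<Longrightarrow> w v = v \<Longrightarrow> w \<in> H) \<Longrightarrow> D v \<noteq> 0"
  shows "\<exists>c\<noteq>0. D = (\<lambda>v. c)"
proof -
  obtain a where a: "\<And>w. w \<in> W \<Longrightarrow> w a = a \<Longrightarrow> w = id" using exists_regular by blast
  have ex: "\<exists>l. linfun l \<and> l (w a - a) = 0 \<and> (\<exists>u. l (w u - u) \<noteq> 0)" if w: "w \<in> W - H" for w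
    using rank_two[of w a] a[of w] H.W_id w by blast
  obtain l where l: "\<And>w. w \<in> W - H \<Longrightarrow> linfun (l w)" "\<And>w. w \<in> W - H \<Longrightarrow> l w (w a - a) = 0"
    "\<And>w. w \<in> W - H \<Longrightarrow> \<exists>u. l w (w u - u) \<noteq> 0" using ex by metis
  define m where "m w = (\<lambda>u. l w (w u - u))" for w
  have m_eq: "m w = (l w \<circ> w) - l w" if "w \<in> W - H" for w
    by (simp add: fun_eq_iff m_def fapply linfun_diff[OF l(1)[OF that]])
  have m_Pol: "m w \<in> Pol" if "w \<in> W - H" for w
    unfolding m_eq[OF that] using that l(1) W_lin by (intro Pol_closed Pol_comp linfun_Pol) auto
  have m_nz: "m w \<noteq> 0" if "w \<in> W - H" for w
    using l(3)[OF that] by (auto simp: m_def fun_eq_iff fapply)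
  define g where "g = (\<Prod>w\<in>W - H. m w)"
  have g: "g \<in> Pol" unfolding g_def by (intro Pol_closed m_Pol)
  have g_nz: "g \<noteq> 0" unfolding g_def by (rule Pol_common_nonzero[OF finite_Diff[OF fin] m_Pol m_nz])
  have line: "D p = D (p + s 1 q)" if nzl: "\<And>t. D (p + s t q) \<noteq> 0" for p q
  proof -
    obtain P where P: "\<And>t. D (p + s t q) = poly P t" using Pol_line[OF D] by metis
    have "constant (poly P)" using fundamental_theorem_of_algebra[of P] nzl P by metis
    then have "poly P 0 = poly P 1" by (simp add: constant_def)
    then show ?thesis using P[of 0] P[of 1] by simp
  qed
  have eq: "D b = D a" if gb: "g b \<noteq> 0" for b
  proof -
    have mb: "m w b \<noteq> 0" if "w \<in> W - H" for w
      using gb fin that by (auto simp: g_def fapply)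
    have val: "l w (w (s c a + s d b) - (s c a + s d b)) = d * m w b" if w: "w \<in> W - H" for w c d
    proof -
      have "w (s c a + s d b) - (s c a + s d b) = s c (w a - a) + s d (w b - b)"
        using w W_lin by (simp add: linmapD scale_right_diff_distrib)
      then show ?thesis using l(1,2)[OF w] by (simp add: linfunD m_def)
    qed
    have nz1: "D (a + s t b) \<noteq> 0" for t
    proof (rule nz, rule ccontr)
      fix w assume w: "w \<in> W" "w (a + s t b) = a + s t b" "w \<notin> H"
      have "t * m w b = 0" using val[of w 1 t] w linfun_0[OF l(1)] by simp
      then have "t = 0" using mb w by simp
      then show False using w a[of w] H.W_id by simp
    qed
    have nz2: "D (b + s t a) \<noteq> 0" for t
    proof (rule nz, rule ccontr)
      fix w assume w: "w \<in> W" "w (b + s t a) = b + s t a" "w \<notin> H"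
      have "m w b = 0" using val[of w t 1] w linfun_0[OF l(1)] by (simp add: add.commute)
      then show False using mb w by simp
    qed
    show ?thesis using line[OF nz1] line[OF nz2] by (simp add: add.commute)
  qed
  have "g * (D - (\<lambda>v. D a)) = 0" using eq by (auto simp: fun_eq_iff fapply)
  then have "D - (\<lambda>v. D a) = 0"
    by (rule Pol_domain[OF g Pol_closed(8)[OF D Pol_const] _ g_nz])
  then have "D = (\<lambda>v. D a)" by simp
  moreover have "D a \<noteq> 0" using nz[of a] a H.W_id by blast
  ultimately show ?thesis by blast
qed

theorem polynomial_invariants_imp_refl:
  assumes f: "\<And>i. i < n \<Longrightarrow> \<exists>d. homog d (f i)" and gen: "generated_algebra (f ` {..<n}) = invs"
  shows "W = H"
proof -
  obtain h where h: "\<And>i. i < n \<Longrightarrow> h i \<in> H.invs" "\<And>i. i < n \<Longrightarrow> \<exists>d>0. homog d (h i)"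
    and ind: "alg_indep n h" and genH: "generated_algebra (h ` {..<n}) = H.invs"
    using H.Chevalley by blast
  have f_invs: "f i \<in> invs" if "i < n" for i
    using gen that generated_algebra.gen[of "f i" "f ` {..<n}"] by auto
  have "\<exists>F\<in>Pn n. f i = (\<lambda>v. F (\<lambda>j. h j v))" if "i < n" for i
    using f_invs[OF that] invs_sub genH generated_algebra_image_iff by blast
  then obtain F where F: "\<And>i. i < n \<Longrightarrow> F i \<in> Pn n" "\<And>i. i < n \<Longrightarrow> f i = (\<lambda>v. F i (\<lambda>j. h j v))"
    by metis
  define J where "J y = mat n n (\<lambda>(i, j). pd j (F i) y)" for y
  have J_carrier: "J y \<in> carrier_mat n n" for y by (simp add: J_def)
  define D where "D v = Determinant.det (J (\<lambda>i. h i v))" for v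
  \<comment> \<open>The Leibniz expansion exhibits the determinant as a polynomial function.\<close>
  have "D = (\<Sum>p\<in>{p. p permutes {0..<n}}. fscale (signof p) (\<Prod>i=0..<n. (\<lambda>v. pd (p i) (F i) (\<lambda>i. h i v))))"
  proof
    fix v
    have "(\<Prod>i=0..<n. J (\<lambda>i. h i v) $$ (i, p i)) = (\<Prod>i=0..<n. pd (p i) (F i) (\<lambda>i. h i v))"
      if "p permutes {0..<n}" for p
    proof (rule prod.cong)
      fix i assume i: "i \<in> {0..<n}"
      then have "p i < n" using permutes_in_image[OF that, of i] by simp
      then show "J (\<lambda>i. h i v) $$ (i, p i) = pd (p i) (F i) (\<lambda>i. h i v)" using i by (simp add: J_def)
    qed simp
    then show "D v = (\<Sum>p\<in>{p. p permutes {0..<n}}. fscale (signof p)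
        (\<Prod>i=0..<n. (\<lambda>v. pd (p i) (F i) (\<lambda>i. h i v)))) v"
      unfolding D_def Determinant.det_def'[OF J_carrier] by (simp add: fapply)
  qed
  also have "\<dots> \<in> Pol"
  proof (intro Pol_closed)
    fix p i assume "p \<in> {p. p permutes {0..<n}}" "i \<in> {0..<n}"
    then have pi: "i < n" "p i < n" using permutes_in_image[of p "{0..<n}" i] by auto
    show "(\<lambda>v. pd (p i) (F i) (\<lambda>i. h i v)) \<in> Pol"
      using Pn_comp[OF pd_Pn[OF F(1)[OF pi(1)] pi(2)], of h] genH H.invs_Pol by blast
  qed
  finally have D_Pol: "D \<in> Pol" .
  have D_nz: "D v \<noteq> 0" if stab: "\<And>w. w \<in> W \<Longrightarrow> w v = v \<Longrightarrow> w \<in> H" for v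
  proof -
    let ?y = "\<lambda>i. h i v"
    have "\<exists>Q\<in>Pn n. (\<lambda>v. Q (\<lambda>i. h i v)) \<in> invs \<and> (\<forall>l<n. pd l Q ?y = (if l = j then 1 else 0))"
      if "j < n" for j
      by (rule separating_tangent) (use h genH ind stab that in auto)
    then obtain Q where Q: "\<And>j. j < n \<Longrightarrow> Q j \<in> Pn n" "\<And>j. j < n \<Longrightarrow> (\<lambda>v. Q j (\<lambda>i. h i v)) \<in> invs"
      "\<And>j l. j < n \<Longrightarrow> l < n \<Longrightarrow> pd l (Q j) ?y = (if l = j then 1 else 0)" by metis
    have "\<exists>R\<in>Pn n. (\<lambda>v. Q j (\<lambda>i. h i v)) = (\<lambda>v. R (\<lambda>i. f i v))" if "j < n" for j
      using Q(2)[OF that] gen generated_algebra_image_iff by blast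
    then obtain R where R: "\<And>j. j < n \<Longrightarrow> R j \<in> Pn n"
      "\<And>j. j < n \<Longrightarrow> (\<lambda>v. Q j (\<lambda>i. h i v)) = (\<lambda>v. R j (\<lambda>i. f i v))" by metis
    \<comment> \<open>The equation holds after substitution of the \<open>h i\<close>; their
      algebraic independence removes the substitution.\<close>
    have QR: "Q j = (\<lambda>y. R j (\<lambda>i. F i y))" if j: "j < n" for j
    proof (rule alg_indepD[OF ind Q(1)[OF j]])
      show "(\<lambda>y. R j (\<lambda>i. F i y)) \<in> Pn n"
        using Pn_comp_in[OF R(1)[OF j], of F] F(1) unfolding Pn_def by blast
      show "Q j (\<lambda>i. h i v) = R j (\<lambda>i. F i (\<lambda>i. h i v))" for v
        using fun_cong[OF R(2)[OF j], of v] Pn_cong[OF R(1)[OF j], of "\<lambda>i. f i v" "\<lambda>i. F i (\<lambda>i. h i v)"] F(2)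
        by simp
    qed
    define A where "A = mat n n (\<lambda>(j, i). pd i (R j) (\<lambda>i. F i ?y))"
    have A_carrier: "A \<in> carrier_mat n n" by (simp add: A_def)
    \<comment> \<open>The chain rule for the factorisation of \<open>Q j\<close> through the
      \<open>F i\<close>: the differentials of the \<open>Q j\<close> at this point are the unit
      covectors, so \<open>A\<close> inverts the Jacobian matrix.\<close>
    have "A * J ?y = 1\<^sub>m n"
    proof (rule eq_matI)
      fix j l assume "j < dim_row (1\<^sub>m n)" "l < dim_col (1\<^sub>m n)"
      then have jl: "j < n" "l < n" by auto
      have "(A * J ?y) $$ (j, l) = (\<Sum>i<n. pd i (R j) (\<lambda>i. F i ?y) * pd l (F i) ?y)"
        using jl by (simp add: A_def J_def times_mat_def scalar_prod_def atLeast0LessThan)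
      also have "\<dots> = pd l (Q j) ?y"
        unfolding QR[OF jl(1)] by (rule pd_comp[symmetric, OF R(1)[OF jl(1)] F(1) jl(2)])
      finally show "(A * J ?y) $$ (j, l) = 1\<^sub>m n $$ (j, l)" using Q(3) jl by simp
    qed (simp_all add: A_def J_def)
    then have "Determinant.det A * Determinant.det (J ?y) = 1"
      using Determinant.det_mult[OF A_carrier J_carrier] by (metis Determinant.det_one)
    then show ?thesis unfolding D_def by auto
  qed
  obtain c where c: "c \<noteq> 0" "D = (\<lambda>v. c)" using constant_if_nonzero[OF D_Pol D_nz] by blast
  let ?o = "\<lambda>i::nat. 0::complex"
  \<comment> \<open>The degrees of the \<open>h i\<close> are positive, so the constant
    \<open>D\<close> is the Jacobian determinant at the origin of the tuple space.\<close>
  have h0: "h i 0 = 0" if "i < n" for i using h(2)[OF that] homog_at_0 by blast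
  have "J (\<lambda>i. h i 0) = J ?o"
    unfolding J_def
    by (rule cong_mat) (auto intro!: Pn_cong[OF pd_Pn[OF F(1)]] simp: h0)
  then have "Determinant.det (J ?o) \<noteq> 0" using fun_cong[OF c(2), of 0] c(1) unfolding D_def by simp
  then have "J ?o \<in> Units (ring_mat TYPE(complex) n ())"
    by (rule det_non_zero_imp_unit[OF J_carrier])
  then obtain C where C: "C \<in> carrier_mat n n" "C * J ?o = 1\<^sub>m n"
    unfolding Units_def by (auto simp: ring_mat_simps)
  have CJ: "(\<Sum>i<n. C $$ (l, i) * pd j (F i) ?o) = (if l = j then 1 else 0)" if "l < n" "j < n" for l j
  proof -
    have "(C * J ?o) $$ (l, j) = (\<Sum>i<n. C $$ (l, i) * pd j (F i) ?o)"
      using that C(1) by (simp add: J_def times_mat_def scalar_prod_def atLeast0LessThan)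
    then show ?thesis using C(2) that by simp
  qed
  have comp_invs: "(\<lambda>v. A (\<lambda>i. h i v)) \<in> H.invs" if "A \<in> Pn n" for A
    using Pn_comp[OF that, of h] genH by blast
  have comp_pos: "(\<lambda>v. A (\<lambda>i. h i v)) \<in> H.invs_pos" if "A \<in> Pn n" "A ?o = 0" for A
    using comp_invs[OF that(1)] Pn_cong[OF that(1), of "\<lambda>i. h i 0" ?o] h0 that(2)
    by (simp add: H.invs_pos_def)
  let ?D = "{A * B |A B. A \<in> Pn n \<and> B \<in> Pn n \<and> A ?o = 0 \<and> B ?o = 0}"
  have comp_decomp: "(\<lambda>v. Z (\<lambda>i. h i v)) \<in> H.decomp" if "Z \<in> fv.span ?D" for Z
    using that
  proof (induction rule: fv.span_induct_alt)
    case base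
    then show ?case using H.decomp_closed(2) by (simp add: zero_fun_def)
  next
    case (step c Y Z)
    then obtain A B where Y: "Y = A * B" "A \<in> Pn n" "B \<in> Pn n" "A ?o = 0" "B ?o = 0" by blast
    have "(\<lambda>v. (fscale c Y + Z) (\<lambda>i. h i v)) =
        fscale c ((\<lambda>v. A (\<lambda>i. h i v)) * (\<lambda>v. B (\<lambda>i. h i v))) + (\<lambda>v. Z (\<lambda>i. h i v))"
      by (simp add: fun_eq_iff fapply Y(1))
    moreover have "(\<lambda>v. A (\<lambda>i. h i v)) * (\<lambda>v. B (\<lambda>i. h i v)) \<in> H.decomp"
      using Y by (intro H.decomp_closed(1) comp_pos)
    ultimately show ?case using step(2) by (simp only: H.decomp_closed(3,5))
  qed
  have Taylor_h: "(\<lambda>v. P (\<lambda>i. h i v)) - (\<lambda>v. P ?o) - (\<Sum>l<n. fscale (pd l P ?o) (h l)) \<in> H.decomp"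
    if P: "P \<in> Pn n" for P
  proof -
    have "(\<lambda>v. (P - (\<lambda>y. P ?o) - (\<Sum>i<n. fscale (pd i P ?o) (coord i))) (\<lambda>i. h i v)) \<in> H.decomp"
      using Taylor_0[OF P] by (rule comp_decomp)
    moreover have "(\<lambda>v. (P - (\<lambda>y. P ?o) - (\<Sum>i<n. fscale (pd i P ?o) (coord i))) (\<lambda>i. h i v)) =
        (\<lambda>v. P (\<lambda>i. h i v)) - (\<lambda>v. P ?o) - (\<Sum>l<n. fscale (pd l P ?o) (h l))"
      by (simp add: fun_eq_iff fapply coord_def)
    ultimately show ?thesis by (simp only:)
  qed
  have h_dec: "\<exists>g\<in>generated_algebra (f ` {..<n}). h l - g \<in> H.decomp" if l: "l < n" for l
  proof
    \<comment> \<open>Row \<open>l\<close> of the inverse Jacobian at the origin, applied to the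
      \<open>f i\<close> without their constant terms: the linear parts in the \<open>h j\<close>
      combine to \<open>h l\<close>.\<close>
    let ?g = "\<Sum>i<n. fscale (C $$ (l, i)) (f i - (\<lambda>v. F i ?o))"
    show "?g \<in> generated_algebra (f ` {..<n})"
      by (intro ga_sum ga_scale ga_diff generated_algebra.const generated_algebra.gen) auto
    let ?E = "\<lambda>i. f i - (\<lambda>v. F i ?o) - (\<Sum>j<n. fscale (pd j (F i) ?o) (h j))"
    have "?E i \<in> H.decomp" if "i < n" for i
      using Taylor_h[OF F(1)[OF that]] F(2)[OF that] by (simp only:)
    then have 1: "(\<Sum>i<n. fscale (- (C $$ (l, i))) (?E i)) \<in> H.decomp"
      by (intro H.decomp_closed(5,6)) auto
    have "h l - ?g = (\<Sum>i<n. fscale (- (C $$ (l, i))) (?E i))"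
    proof
      fix v
      have "h l v = (\<Sum>j<n. (\<Sum>i<n. C $$ (l, i) * pd j (F i) ?o) * h j v)"
        using l by (simp add: CJ if_distrib[of "\<lambda>a. a * _"] cong: if_cong)
      also have "\<dots> = (\<Sum>j<n. \<Sum>i<n. C $$ (l, i) * (pd j (F i) ?o * h j v))"
        by (simp add: sum_distrib_right mult.assoc)
      also have "\<dots> = (\<Sum>i<n. \<Sum>j<n. C $$ (l, i) * (pd j (F i) ?o * h j v))" by (rule sum.swap)
      finally have "h l v = (\<Sum>i<n. C $$ (l, i) * (\<Sum>j<n. pd j (F i) ?o * h j v))"
        by (simp add: sum_distrib_left)
      then show "(h l - ?g) v = (\<Sum>i<n. fscale (- (C $$ (l, i))) (?E i)) v"
        by (simp add: fapply right_diff_distrib sum_subtractf sum_negf)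
    qed
    with 1 show "h l - ?g \<in> H.decomp" by (simp only:)
  qed
  have "H.invs \<subseteq> generated_algebra (f ` {..<n})"
  proof (rule H.invs_nakayama)
    show "\<exists>d. homog d (f i)" if "i < n" for i using f that by blast
    fix k assume "k \<in> H.invs"
    then obtain P where P: "P \<in> Pn n" "k = (\<lambda>v. P (\<lambda>i. h i v))" using genH generated_algebra_image_iff by blast
    obtain g where g: "\<And>l. l < n \<Longrightarrow> g l \<in> generated_algebra (f ` {..<n})" "\<And>l. l < n \<Longrightarrow> h l - g l \<in> H.decomp"
      using h_dec by metis
    let ?g = "(\<lambda>v. P ?o) + (\<Sum>l<n. fscale (pd l P ?o) (g l))"
    have "?g \<in> generated_algebra (f ` {..<n})"
      using g(1) by (intro ga_add ga_sum ga_scale generated_algebra.const) auto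
    moreover have "k - ?g = (k - (\<lambda>v. P ?o) - (\<Sum>l<n. fscale (pd l P ?o) (h l))) +
        (\<Sum>l<n. fscale (pd l P ?o) (h l - g l))"
      by (simp add: fun_eq_iff fapply right_diff_distrib sum_subtractf)
    moreover have "k - (\<lambda>v. P ?o) - (\<Sum>l<n. fscale (pd l P ?o) (h l)) \<in> H.decomp"
      unfolding P(2) by (rule Taylor_h[OF P(1)])
    moreover have "(\<Sum>l<n. fscale (pd l P ?o) (h l - g l)) \<in> H.decomp"
      using g(2) by (intro H.decomp_closed(5,6)) auto
    ultimately have "?g \<in> generated_algebra (f ` {..<n})" "k - ?g \<in> H.decomp"
      by (simp_all only: H.decomp_closed(3))
    then show "\<exists>g\<in>generated_algebra (f ` {..<n}). k - g \<in> H.decomp" by blast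
  qed
  then have sub: "H.invs \<subseteq> invs" using gen by simp
  show "W = H"
  proof (rule ccontr)
    assume "W \<noteq> H"
    then obtain w where w: "w \<in> W" "w \<notin> H" using H_sub by blast
    obtain v where v: "\<And>w. w \<in> W \<Longrightarrow> w v = v \<Longrightarrow> w = id" using exists_regular by blast
    \<comment> \<open>The function \<open>b\<close> would now be \<open>W\<close>-invariant, yet
      take the value 1 at \<open>v\<close> and 0 at \<open>w v\<close>.\<close>
    obtain b where "b \<in> H.invs" "b v = 1" "\<forall>w\<in>W - H. b (w v) = 0"
      using separating_invariant[of v] v H.W_id by blast
    then show False using sub invs_apply[of b w v] w by auto
  qed
qed

end

section \<open>Graded automorphisms of Veronese algebras\<close>

context coord_space
begin

lemma homog_prod_list_x: "set fs \<subseteq> x ` {..<n} \<Longrightarrow> homog (length fs) (prod_list fs)"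
  using homog_linfun linfun_x by (intro homog_prod_list) blast

lemma Pol_prod_list_x: "set fs \<subseteq> x ` {..<n} \<Longrightarrow> prod_list fs \<in> Pol"
  unfolding Pol_def by (intro ga_prod_list) (auto intro: generated_algebra.gen)

lemma hc_span_prod_list:
  assumes "f \<in> Pol"
  shows "hc d f \<in> fv.span {prod_list fs |fs. set fs \<subseteq> x ` {..<n} \<and> length fs = d}"
    (is "_ \<in> fv.span ?M")
proof -
  have "f \<in> fv.span {prod_list fs |fs. set fs \<subseteq> x ` {..<n}}"
    using ga_span_prod_list[of "x ` {..<n}"] assms unfolding Pol_def by (rule subsetD)
  then have "polylike f \<and> hc d f \<in> fv.span ?M"
  proof (induction rule: fv.span_induct_alt)
    case base
    then show ?case by (simp add: polylike_zero hc_zero fv.span_zero)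
  next
    case (step c m f)
    then obtain fs where fs: "m = prod_list fs" "set fs \<subseteq> x ` {..<n}" by blast
    have hom: "homog (length fs) m" unfolding fs(1) using fs(2) by (rule homog_prod_list_x)
    have pm: "polylike m" using hom by (rule homog_polylike)
    have "hc d m \<in> fv.span ?M"
    proof (cases "length fs = d")
      case True
      then have "m \<in> ?M" using fs by blast
      then have "m \<in> fv.span ?M" by (rule fv.span_base)
      then show ?thesis using True by (simp only: hc_homog[OF hom] simp_thms if_True)
    next
      case False
      then have "hc d m = 0" using hc_homog[OF hom, of d] by auto
      then show ?thesis by (simp only: fv.span_zero)
    qed
    moreover have "hc d (fscale c m + f) = fscale c (hc d m) + hc d f"
      using pm step(2) by (simp add: hc_add hc_scale polylike_ray)
    moreover have "polylike (fscale c m + f)" using pm step(2) by (simp add: polylike_ray)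
    ultimately show ?case using step(2) by (simp only: span_scale_add simp_thms)
  qed
  then show ?thesis ..
qed

lemma homog_span_prod_list:
  assumes "f \<in> Pol" "homog d f"
  shows "f \<in> fv.span {prod_list fs |fs. set fs \<subseteq> x ` {..<n} \<and> length fs = d}"
proof -
  have "hc d f = f" using hc_homog[OF assms(2), of d] by (simp only: if_True simp_thms)
  then show ?thesis using hc_span_prod_list[OF assms(1), of d] by (simp only:)
qed

lemma Sq_eq: "Sq s q = generated_algebra {f \<in> Pol. homog q f}"
  by (simp add: Sq_def homogeneous_polynomials_eq)

lemma Sq_gen: "f \<in> Pol \<Longrightarrow> homog q f \<Longrightarrow> f \<in> Sq s q"
  unfolding Sq_eq by (rule generated_algebra.gen) simp

lemma Sq_Pol: "Sq s q \<subseteq> Pol"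
  unfolding Sq_eq Pol_def by (rule ga_subset) (auto simp: Pol_def)

text \<open>A monomial whose degree is a multiple of \<open>q\<close> is cut into blocks of length
  \<open>q\<close>, each of which is a generator.\<close>

lemma Sq_prod_list: "set fs \<subseteq> x ` {..<n} \<Longrightarrow> length fs = k * q \<Longrightarrow> prod_list fs \<in> Sq s q"
proof (induction k arbitrary: fs)
  case 0
  then show ?case unfolding Sq_eq by (simp add: ga_one)
next
  case (Suc k)
  have sub: "set (take q fs) \<subseteq> x ` {..<n}" "set (drop q fs) \<subseteq> x ` {..<n}"
    using Suc.prems(1) set_take_subset[of q fs] set_drop_subset[of q fs] by blast+
  have "prod_list (take q fs) \<in> Sq s q"
    using Suc.prems(2) homog_prod_list_x[OF sub(1)] Pol_prod_list_x[OF sub(1)] by (intro Sq_gen) auto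
  moreover have "prod_list (drop q fs) \<in> Sq s q" using Suc by (intro Suc.IH sub) auto
  moreover have "prod_list fs = prod_list (take q fs) * prod_list (drop q fs)"
    by (metis append_take_drop_id prod_list.append)
  ultimately show ?case unfolding Sq_eq by (simp only: ga_mult)
qed

text \<open>The Veronese algebra contains all polynomials homogeneous of degree divisible by
  \<open>q\<close>. This is how invariants of a group containing the q-th roots of unity are
  recognised as its elements.\<close>

lemma hc_Sq: "f \<in> Pol \<Longrightarrow> hc (k * q) f \<in> Sq s q"
proof -
  have "{prod_list fs |fs. set fs \<subseteq> x ` {..<n} \<and> length fs = k * q} \<subseteq> Sq s q"
    using Sq_prod_list by blast
  then show "f \<in> Pol \<Longrightarrow> hc (k * q) f \<in> Sq s q"
    using ga_span[OF hc_span_prod_list[of f "k * q"]] unfolding Sq_eq by blast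
qed

text \<open>The degree bound is what matters: a nonzero polynomial of degree at most
  \<open>q\<close> whose root multiplicities are divisible by \<open>q\<close> has at most one
  root.\<close>

lemma homog_line:
  assumes "f \<in> Pol" "homog d f"
  shows "\<exists>p. degree p \<le> d \<and> (\<forall>t. f (a + s t b) = poly p t)"
  using homog_span_prod_list[OF assms]
proof (induction rule: fv.span_induct_alt)
  case base
  show ?case by (intro exI[of _ 0]) (simp add: fapply)
next
  case (step c m f)
  then obtain fs where fs: "m = prod_list fs" "set fs \<subseteq> x ` {..<n}" "length fs = d" by blast
  have "\<exists>p. degree p \<le> length fs \<and> (\<forall>t. prod_list fs (a + s t b) = poly p t)"
    using fs(2)
  proof (induction fs)
    case Nil
    show ?case by (intro exI[of _ 1]) (simp add: fapply)
  next
    case (Cons f fs)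
    then obtain p where p: "degree p \<le> length fs" "\<And>t. prod_list fs (a + s t b) = poly p t" by auto
    have f: "linfun f" using Cons.prems linfun_x by auto
    have "prod_list (f # fs) (a + s t b) = poly ([:f a, f b:] * p) t" for t
      using linfunD[OF f] p(2)[of t] by (simp add: times_fun_apply algebra_simps)
    moreover have "degree ([:f a, f b:] * p) \<le> length (f # fs)"
      using degree_mult_le[of "[:f a, f b:]" p] p(1) by (simp split: if_splits)
    ultimately show ?case by blast
  qed
  then obtain p where p: "degree p \<le> d" "\<And>t. m (a + s t b) = poly p t" using fs by blast
  obtain r where r: "degree r \<le> d" "\<And>t. f (a + s t b) = poly r t" using step(2) by blast
  have "(fscale c m + f) (a + s t b) = poly (Polynomial.smult c p + r) t" for t
    by (simp add: fapply p r)
  moreover have "degree (Polynomial.smult c p + r) \<le> d"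
    using p r by (intro degree_add_le) (auto intro: order_trans[OF degree_smult_le])
  ultimately show ?case by blast
qed

text \<open>The product of f - z g over all q-th roots of unity z vanishes at every point, so by the
  domain property one factor vanishes identically.\<close>

lemma power_eq_imp_root_of_unity:
  assumes f: "f \<in> Pol" and g: "g \<in> Pol" and q: "q > 0" and eq: "f ^ q = g ^ q"
  shows "\<exists>z. z ^ q = 1 \<and> f = fscale z g"
proof -
  let ?Z = "{z::complex. z ^ q = 1}"
  have fin: "finite ?Z" using finite_roots_unity[of q] q by simp
  have "(\<Prod>z\<in>?Z. f - fscale z g) = 0"
  proof
    fix v
    have pw: "f v ^ q = g v ^ q" using fun_cong[OF eq, of v] by (simp add: fapply)
    have "\<exists>z\<in>?Z. f v - z * g v = 0"
    proof (cases "g v = 0")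
      case True
      then have "f v = 0" using pw q by (simp add: zero_power)
      then show ?thesis using True by (intro bexI[of _ 1]) auto
    next
      case False
      then show ?thesis using pw by (intro bexI[of _ "f v / g v"]) (auto simp: power_divide)
    qed
    then have "(\<Prod>z\<in>?Z. f v - z * g v) = 0" using fin by (simp add: prod_zero_iff)
    then show "(\<Prod>z\<in>?Z. f - fscale z g) v = 0 v" by (simp only: fapply)
  qed
  then obtain z where "z \<in> ?Z" "f - fscale z g = 0"
    using Pol_common_nonzero[of ?Z "\<lambda>z. f - fscale z g"] fin Pol_closed(8)[OF f Pol_closed(7)[OF g]] by blast
  then show ?thesis by (intro exI[of _ z]) simp
qed

end

text \<open>Either there is no root and \<open>p\<close> is constant, or a root \<open>t\<close> has
  multiplicity at least \<open>q\<close> and exhausts the degree. Normalising by the value at 0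
  covers both cases, with \<open>r\<close> equal to 0 or to -1/t.\<close>

lemma poly_pure_power:
  fixes p :: "complex poly"
  assumes p0: "poly p 0 \<noteq> 0" and deg: "degree p \<le> q" and ord: "\<And>t. q dvd Polynomial.order t p"
  shows "\<exists>r. \<forall>u. poly p u = poly p 0 * (1 + r * u) ^ q"
proof (cases "\<exists>t. poly p t = 0")
  case False
  then have "constant (poly p)" using fundamental_theorem_of_algebra by blast
  then show ?thesis by (intro exI[of _ 0]) (auto simp: constant_def)
next
  case True
  then obtain t where t: "poly p t = 0" by blast
  have pn: "p \<noteq> 0" using p0 by auto
  have t0: "t \<noteq> 0" using t p0 by auto
  have "Polynomial.order t p \<noteq> 0" using t pn by (simp add: order_root)
  then have "q \<le> Polynomial.order t p" using ord[of t] by (simp add: dvd_imp_le)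
  then have "[:-t, 1:] ^ q dvd p" by (metis le_imp_power_dvd order_1 dvd_trans)
  then obtain r where r: "p = [:-t, 1:] ^ q * r" by (elim dvdE)
  have "r \<noteq> 0" using r pn by auto
  then have "degree p = q + degree r"
    unfolding r by (simp add: degree_mult_eq degree_power_eq)
  then have "degree r = 0" using deg by simp
  then obtain c where c: "r = [:c:]" using degree_eq_zeroE by blast
  have val: "poly p u = c * (u - t) ^ q" for u unfolding r c by (simp add: poly_power mult.commute)
  show ?thesis
  proof (intro exI[of _ "- 1 / t"] allI)
    fix u
    have "(u - t) = (- t) * (1 + - 1 / t * u)" using t0 by (simp add: field_simps)
    then have "(u - t) ^ q = (- t) ^ q * (1 + - 1 / t * u) ^ q" by (simp only: power_mult_distrib)
    then show "poly p u = poly p 0 * (1 + - 1 / t * u) ^ q" unfolding val by simp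
  qed
qed

lemma order_power: "p \<noteq> 0 \<Longrightarrow> Polynomial.order t (p ^ k) = k * Polynomial.order t p"
  for p :: "complex poly"
  by (induction k) (simp_all add: order_mult Polynomial.order_0I)

section \<open>Lifting a graded automorphism to a linear map\<close>

locale graded_aut = coord_space +
  fixes q :: nat and \<phi> :: "('a \<Rightarrow> complex) \<Rightarrow> 'a \<Rightarrow> complex" and B :: "'a set"
  assumes q: "q > 0" and phi_inj: "inj_on \<phi> (Sq s q)" and phi_one: "\<phi> 1 = 1"
    and phi_scale: "f \<in> Sq s q \<Longrightarrow> \<phi> (fscale c f) = fscale c (\<phi> f)"
    and phi_add: "f \<in> Sq s q \<Longrightarrow> g \<in> Sq s q \<Longrightarrow> \<phi> (f + g) = \<phi> f + \<phi> g"
    and phi_mult: "f \<in> Sq s q \<Longrightarrow> g \<in> Sq s q \<Longrightarrow> \<phi> (f * g) = \<phi> f * \<phi> g"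
    and phi_homog: "\<phi> ` {f \<in> Pol. homog q f} = {f \<in> Pol. homog q f}"
    and fd: "finite_dimensional_vector_space s B"
begin

lemma Sq_closed:
  "1 \<in> Sq s q" "0 \<in> Sq s q" "f \<in> Sq s q \<Longrightarrow> g \<in> Sq s q \<Longrightarrow> f * g \<in> Sq s q"
  "f \<in> Sq s q \<Longrightarrow> g \<in> Sq s q \<Longrightarrow> f + g \<in> Sq s q" "f \<in> Sq s q \<Longrightarrow> fscale c f \<in> Sq s q"
  "f \<in> Sq s q \<Longrightarrow> f ^ k \<in> Sq s q"
  unfolding Sq_eq by (auto intro: ga_one ga_zero ga_mult ga_add ga_scale ga_power)

lemma phi_zero: "\<phi> 0 = 0"
  using phi_scale[OF Sq_closed(1), of 0] by simp

lemma phi_power: "f \<in> Sq s q \<Longrightarrow> \<phi> (f ^ k) = \<phi> f ^ k"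
  by (induction k) (auto simp: phi_one phi_mult Sq_closed)

lemma phi_prod_list:
  "(\<And>f. f \<in> set fs \<Longrightarrow> f \<in> Sq s q) \<Longrightarrow> prod_list fs \<in> Sq s q \<and> \<phi> (prod_list fs) = prod_list (map \<phi> fs)"
  by (induction fs) (auto simp: phi_one phi_mult Sq_closed)

lemma x_mono: "i < n \<Longrightarrow> j < n \<Longrightarrow> x i ^ (q - 1) * x j \<in> Pol"
    "i < n \<Longrightarrow> j < n \<Longrightarrow> homog q (x i ^ (q - 1) * x j)"
    "i < n \<Longrightarrow> j < n \<Longrightarrow> x i ^ (q - 1) * x j \<in> Sq s q"
proof -
  show 1: "x i ^ (q - 1) * x j \<in> Pol" if "i < n" "j < n" for i j using that by (intro Pol_closed)
  show 2: "homog q (x i ^ (q - 1) * x j)" if "i < n" "j < n" for i j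
    using homog_mult[OF homog_power[OF homog_linfun[OF linfun_x[OF that(1)]], of "q - 1"]
        homog_linfun[OF linfun_x[OF that(2)]]] q by simp
  show "x i ^ (q - 1) * x j \<in> Sq s q" if "i < n" "j < n" for i j
    using 1[OF that] 2[OF that] by (rule Sq_gen)
qed

lemma x_pow: "i < n \<Longrightarrow> x i ^ q = x i ^ (q - 1) * x i"
  using q by (metis mult.commute power_Suc Suc_pred')

lemma phi_Pol: "f \<in> Pol \<Longrightarrow> homog q f \<Longrightarrow> \<phi> f \<in> Pol \<and> homog q (\<phi> f)"
  using phi_homog by blast

definition P :: "nat \<Rightarrow> 'a \<Rightarrow> complex" where
  "P i = \<phi> (x i ^ q)"

lemma P_Pol: "i < n \<Longrightarrow> P i \<in> Pol" and P_homog: "i < n \<Longrightarrow> homog q (P i)"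
  unfolding P_def using phi_Pol x_mono x_pow by auto

lemma x_pow_Sq: "i < n \<Longrightarrow> x i ^ q \<in> Sq s q"
  using x_mono(3)[of i i] x_pow by simp

lemma P_nonzero: "i < n \<Longrightarrow> P i \<noteq> 0"
proof
  assume i: "i < n" and "P i = 0"
  then have "\<phi> (x i ^ q) = \<phi> 0" by (simp add: P_def phi_zero)
  then have "x i ^ q = 0" using inj_onD[OF phi_inj] x_pow_Sq[OF i] Sq_closed(2) by blast
  then have "x i (e i) ^ q = 0" by (metis power_fun_apply zero_fun_apply)
  then show False using i x_e by simp
qed

lemma phi_monomial_power:
  assumes "set fs \<subseteq> x ` {..<n}" "length fs = q"
  shows "\<phi> (prod_list fs) ^ q = prod_list (map (\<lambda>f. \<phi> (f ^ q)) fs)"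
proof -
  have "prod_list fs \<in> Sq s q"
    using Sq_prod_list[of fs 1] assms by simp
  then have "\<phi> (prod_list fs) ^ q = \<phi> (prod_list fs ^ q)" by (simp add: phi_power)
  also have "prod_list fs ^ q = prod_list (map (\<lambda>f. f ^ q) fs)"
    by (induction fs) (simp_all add: power_mult_distrib)
  also have "\<phi> \<dots> = prod_list (map \<phi> (map (\<lambda>f. f ^ q) fs))"
    using phi_prod_list[of "map (\<lambda>f. f ^ q) fs"] assms(1) x_pow_Sq by auto
  finally show ?thesis by (simp add: o_def)
qed

text \<open>If all P_j vanish at \<open>v\<close>, so does the image of every monomial of degree
  \<open>q\<close>, because its q-th power is a product of the P_j. By surjectivity in degree
  \<open>q\<close> each x_j^q is a combination of such images, so all coordinates of
  \<open>v\<close> vanish.\<close>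

lemma P_common_zero:
  assumes v: "\<And>j. j < n \<Longrightarrow> P j v = 0"
  shows "v = 0"
proof (rule ccontr)
  assume "v \<noteq> 0"
  then obtain j where j: "j < n" "x j v \<noteq> 0" using x_nonzero by blast
  have "x j ^ q \<in> {f \<in> Pol. homog q f}" using x_mono[OF j(1) j(1)] x_pow[OF j(1)] by simp
  then obtain f where f: "f \<in> Pol" "homog q f" "x j ^ q = \<phi> f" using phi_homog by blast
  have "f \<in> Sq s q \<and> \<phi> f v = 0" using homog_span_prod_list[OF f(1,2)]
  proof (induction rule: fv.span_induct_alt)
    case base
    have "0 \<in> Sq s q \<and> \<phi> 0 v = 0" by (simp add: phi_zero Sq_closed zero_fun_apply)
    then show ?case .
  next
    case (step c m f)
    then obtain fs where fs: "m = prod_list fs" "set fs \<subseteq> x ` {..<n}" "length fs = q" by blast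
    have m: "m \<in> Sq s q" unfolding fs(1) using Sq_prod_list[of fs 1] fs by simp
    obtain g gs where g: "fs = g # gs" using fs(3) q by (cases fs) auto
    obtain i where i: "i < n" "g = x i" using fs(2) g by auto
    have "\<phi> m v ^ q = (\<phi> m ^ q) v" by (simp only: power_fun_apply)
    also have "\<dots> = P i v * prod_list (map (\<lambda>f. \<phi> (f ^ q)) gs) v"
      using phi_monomial_power[OF fs(2,3)] unfolding fs(1) by (simp add: times_fun_apply P_def i g)
    also have "\<dots> = 0" using v i by simp
    finally have "\<phi> m v = 0" by simp
    moreover have "\<phi> (fscale c m + f) = fscale c (\<phi> m) + \<phi> f"
      using m step(2) by (simp add: phi_add phi_scale Sq_closed)
    ultimately have "\<phi> (fscale c m + f) v = 0" using step(2) by (simp add: fapply)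
    moreover have "fscale c m + f \<in> Sq s q" using m step(2) by (simp add: Sq_closed)
    ultimately show ?case by (intro conjI)
  qed
  then have "x j v ^ q = 0" using f(3) by (metis power_fun_apply)
  then show False using j by simp
qed

text \<open>Let M = x_i^(q-1) x_j. If P_j is nonzero at the point, comparing orders in \<phi>(M)^q =
  P_i^(q-1) P_j gives q ord(\<phi>(M)) = (q-1) ord(P_i), and q is coprime to q - 1. If every P_j
  vanishes there, the point is the origin, which the line avoids.\<close>

lemma P_line_order:
  assumes i: "i < n" and p: "\<And>t. P i (a + s t b) = poly p t" "p \<noteq> 0" and nz: "\<And>t. a + s t b \<noteq> 0"
  shows "q dvd Polynomial.order t p"
proof (rule ccontr)
  assume nd: "\<not> q dvd Polynomial.order t p"
  have "P j (a + s t b) = 0" if j: "j < n" for j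
  proof -
    define M where "M = x i ^ (q - 1) * x j"
    have M: "M \<in> Sq s q" "\<phi> M \<in> Pol" using x_mono phi_Pol i j unfolding M_def by blast+
    have "M ^ q = (x i ^ q) ^ (q - 1) * x j ^ q"
      unfolding M_def by (simp add: power_mult_distrib power_mult[symmetric] mult.commute)
    then have eq: "\<phi> M ^ q = P i ^ (q - 1) * P j"
      using phi_power[OF M(1), of q] i j unfolding P_def
      by (simp add: phi_mult phi_power Sq_closed x_pow_Sq)
    obtain r where r: "\<And>t. P j (a + s t b) = poly r t" using Pol_line[OF P_Pol[OF j]] by metis
    obtain m where m: "\<And>t. \<phi> M (a + s t b) = poly m t" using Pol_line[OF M(2)] by metis
    have "poly (m ^ q) u = poly (p ^ (q - 1) * r) u" for u
      using fun_cong[OF eq, of "a + s u b"] by (simp add: fapply r m p(1) poly_power)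
    then have mp: "m ^ q = p ^ (q - 1) * r" by (intro poly_ext)
    show ?thesis
    proof (cases "poly r t = 0")
      case True
      then show ?thesis by (simp add: r)
    next
      case False
      then have rn: "r \<noteq> 0" and r0: "Polynomial.order t r = 0" by (auto simp: order_root)
      have pr: "p ^ (q - 1) * r \<noteq> 0" using rn p(2) by simp
      then have mn: "m \<noteq> 0" using mp q by (metis zero_power)
      have "q * Polynomial.order t m = (q - 1) * Polynomial.order t p"
        using arg_cong[OF mp, of "Polynomial.order t"] r0 order_mult[OF pr]
        by (simp add: order_power mn p(2))
      then have "q dvd (q - 1) * Polynomial.order t p" by (metis dvd_triv_left)
      moreover have "coprime q (q - 1)" using q by (rule coprime_diff_one_right_nat)
      ultimately have "q dvd Polynomial.order t p" by (simp add: coprime_dvd_mult_right_iff)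
      then show ?thesis using nd by blast
    qed
  qed
  then have "a + s t b = 0" by (rule P_common_zero)
  then show False using nz by blast
qed

text \<open>On every line the roots of \<open>P\<^sub>i = \<phi>(x\<^sub>i\<^sup>q)\<close> have multiplicity \<open>q\<close>. The linear form is read off from
  the first derivative at a point \<open>b\<close> with \<open>P\<^sub>i(b) \<noteq> 0\<close>.\<close>

lemma P_root:
  assumes i: "i < n"
  shows "\<exists>y. linfun y \<and> P i = y ^ q"
proof -
  obtain b where b: "P i b \<noteq> 0" using P_nonzero[OF i] by (auto simp: fun_eq_iff fapply)
  have b0: "b \<noteq> 0" using b homog_at_0[OF P_homog[OF i] q] by auto
  \<comment> \<open>The differential of P_i at \<open>b\<close>. If P_i = y^q, it equals q
    y(b)^(q-1) y, so it is proportional to the form that is sought.\<close>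
  define L where "L a = (\<Sum>k<n. dS k (P i) b * x k a)" for a
  have L: "linfun L" unfolding L_def
    by (auto simp: linfun_def linfunD[OF linfun_x] ring_distribs sum.distrib sum_distrib_left mult_ac
        intro!: sum.cong)
  have Lb: "L b = of_nat q * P i b"
    using Euler[OF P_Pol[OF i] P_homog[OF i], of b] by (simp add: L_def mult.commute)
  have pure: "\<exists>r. \<forall>u. P i (b + s u a) = P i b * (1 + r * u) ^ q" for a
  \<comment> \<open>\<open>P_line_order\<close> needs a line that avoids the origin. A line through
    the origin and \<open>b\<close> consists of multiples of \<open>b\<close>, where homogeneity
    gives the pure power directly.\<close>
  proof (cases "\<exists>u. b + s u a = 0")
    case False
    obtain p where p: "degree p \<le> q" "\<And>t. P i (b + s t a) = poly p t"
      using homog_line[OF P_Pol[OF i] P_homog[OF i]] by metis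
    have p0: "poly p 0 = P i b" using p(2)[of 0] by simp
    then have "poly p 0 \<noteq> 0" "p \<noteq> 0" using b by auto
    then show ?thesis
      using poly_pure_power[of p q, OF _ p(1) P_line_order[OF i p(2)]] False p0 by (simp add: p(2))
  next
    case True
    then obtain u where u: "b + s u a = 0" by blast
    then have "u \<noteq> 0" using b0 by auto
    have "s u a = - b" using u by (simp add: add_eq_0_iff)
    then have "s (1 / u) (s u a) = s (1 / u) (- b)" by simp
    then have a: "a = s (- 1 / u) b" using \<open>u \<noteq> 0\<close> by simp
    have "b + s t a = s (1 + - 1 / u * t) b" for t
      unfolding a by (simp add: scale_left_diff_distrib mult.commute)
    then show ?thesis
      using homogD[OF P_homog[OF i]] by (intro exI[of _ "- 1 / u"]) (simp add: mult.commute)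
  qed
  \<comment> \<open>On the line from \<open>b\<close> to \<open>a\<close>, comparing derivatives at
    u = 0 determines \<open>r\<close>, and u = 1 gives the value at \<open>a\<close>. Since L(b) = q
    P_i(b) by Euler's formula, 1 + r is a multiple of L(a).\<close>
  have val: "P i a = P i b * (L a / (of_nat q * P i b)) ^ q" for a
  proof -
    obtain r where r: "\<And>u. P i (b + s u (a - b)) = P i b * (1 + r * u) ^ q" using pure by metis
    obtain Q where Q: "Q \<in> Pn n" "P i = (\<lambda>v. Q (\<lambda>i. x i v))" using P_Pol[OF i] unfolding Pol_iff by blast
    have "((\<lambda>u. x k (b + s u (a - b))) has_field_derivative x k (a - b)) (at 0)" if "k < n" for k
      using that by (auto simp: linfunD[OF linfun_x] intro!: derivative_eq_intros)
    from pd_chain[OF Q(1), where w = "\<lambda>u k. x k (b + s u (a - b))" and t = 0, OF this]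
    have "((\<lambda>u. P i (b + s u (a - b))) has_field_derivative L (a - b)) (at 0)"
      by (simp add: Q(2) L_def dS_Pn[OF Q(1)])
    moreover have "((\<lambda>u. P i (b + s u (a - b))) has_field_derivative P i b * (of_nat q * r)) (at 0)"
      unfolding r by (auto intro!: derivative_eq_intros)
    ultimately have "L (a - b) = P i b * (of_nat q * r)" by (rule DERIV_unique)
    then have "1 + r = L a / (of_nat q * P i b)"
      using b q Lb by (simp add: linfun_diff[OF L] field_simps)
    then show ?thesis using r[of 1] by simp
  qed
  \<comment> \<open>A q-th root of the remaining scalar factor, to be absorbed into the linear
    form.\<close>
  obtain \<beta> where \<beta>: "\<beta> ^ q = P i b / (of_nat q * P i b) ^ q"
  proof -
    have "\<exists>z. poly (monom 1 q - [:P i b / (of_nat q * P i b) ^ q:]) z = 0"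
    proof (rule ccontr)
      assume "\<not> ?thesis"
      then have "constant (poly (monom 1 q - [:P i b / (of_nat q * P i b) ^ q:]))"
        using fundamental_theorem_of_algebra by blast
      then have "poly (monom 1 q - [:P i b / (of_nat q * P i b) ^ q:]) 0 =
          poly (monom 1 q - [:P i b / (of_nat q * P i b) ^ q:]) 1" by (auto simp: constant_def)
      then show False using q by (simp add: poly_monom zero_power)
    qed
    then show ?thesis using that by (auto simp: poly_monom)
  qed
  have "P i = (fscale \<beta> L) ^ q"
  proof
    fix a
    have "P i a = (P i b / (of_nat q * P i b) ^ q) * L a ^ q" using val[of a] by (simp add: power_divide)
    then show "P i a = (fscale \<beta> L ^ q) a" by (simp add: fapply power_mult_distrib \<beta>)
  qed
  moreover have "linfun (fscale \<beta> L)" using L by (auto simp: linfun_def fapply algebra_simps)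
  ultimately show ?thesis by blast
qed

text \<open>Each P_j determines its root y_j only up to a root of unity. The images of x_0^(q-1) x_j
  align these choices: they equal y_0^(q-1) Y_j with Y_j a multiple of y_j, and \<open>g\<close> is
  the map with coordinates Y_j. Every monomial of degree \<open>q\<close>, multiplied by a power of
  x_0^q, is a product of elements x_0^(q-1) x_j, so \<phi> substitutes the Y_j in it.\<close>

theorem linear_lift: "\<exists>g. linmap g \<and> bij g \<and> (\<forall>f\<in>Sq s q. \<phi> f = f \<circ> g)"
proof (cases "n = 0")
  \<comment> \<open>On the zero space all functions are constant, and there is no x_0 to normalise
    with.\<close>
  case True
  have "v = 0" for v :: 'a using x_sep[of v 0] True by simp
  then have f: "f = fscale (f 0) 1" for f :: "'a \<Rightarrow> complex"
    by (auto simp: fun_eq_iff fapply) metis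
  have "\<phi> f = f" for f
    using phi_scale[OF Sq_closed(1), of "f 0"] f[of f] phi_one by metis
  then show ?thesis by (intro exI[of _ id]) (auto simp: linmap_def)
next
  case False
  then have n: "0 < n" by simp
  obtain y where y: "linfun (y i)" "P i = y i ^ q" if "i < n" for i using P_root by metis
  let ?m = "\<lambda>j. x 0 ^ (q - 1) * x j"
  have "\<exists>z. z ^ q = 1 \<and> \<phi> (?m j) = fscale z (y 0 ^ (q - 1) * y j)" if j: "j < n" for j
  proof (rule power_eq_imp_root_of_unity)
    show "\<phi> (?m j) \<in> Pol" using phi_Pol x_mono n j by blast
    show "y 0 ^ (q - 1) * y j \<in> Pol" using linfun_Pol y n j by (intro Pol_closed) auto
    have "?m j ^ q = (x 0 ^ q) ^ (q - 1) * x j ^ q"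
      by (simp add: power_mult_distrib power_mult[symmetric] mult.commute)
    then have "\<phi> (?m j) ^ q = P 0 ^ (q - 1) * P j"
      using phi_power[OF x_mono(3)[OF n j], of q] n j unfolding P_def
      by (simp add: phi_mult phi_power Sq_closed x_pow_Sq)
    also have "\<dots> = (y 0 ^ (q - 1) * y j) ^ q"
      unfolding y(2)[OF n] y(2)[OF j]
      by (simp add: power_mult_distrib power_mult[symmetric] mult.commute)
    finally show "\<phi> (?m j) ^ q = (y 0 ^ (q - 1) * y j) ^ q" .
  qed (rule q)
  then obtain z where z: "\<phi> (?m j) = fscale (z j) (y 0 ^ (q - 1) * y j)" if "j < n" for j by metis
  define Y where "Y j = fscale (z j) (y j)" for j
  have Y_lin: "linfun (Y j)" if "j < n" for j
    using y(1)[OF that] by (auto simp: Y_def linfun_def fapply algebra_simps)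
  have mY: "\<phi> (?m j) = y 0 ^ (q - 1) * Y j" if "j < n" for j
    unfolding z[OF that] Y_def by (simp add: fun_eq_iff fapply mult_ac)
  define g where "g v = vec (\<lambda>j. Y j v)" for v
  have xg: "x j \<circ> g = Y j" if "j < n" for j by (simp add: fun_eq_iff g_def x_vec that)
  have g_lin: "linmap g" unfolding linmap_def
  proof (intro conjI allI)
    show "g (u + v) = g u + g v" for u v
      by (rule x_sep) (simp add: linfunD[OF linfun_x] g_def x_vec linfunD[OF Y_lin])
    show "g (s c v) = s c (g v)" for c v
      by (rule x_sep) (simp add: linfunD[OF linfun_x] g_def x_vec linfunD[OF Y_lin])
  qed
  have monomials: "\<phi> (prod_list fs) = prod_list fs \<circ> g" if fs: "set fs \<subseteq> x ` {..<n}" "length fs = q" for fs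
  proof -
    have "fs \<in> map x ` lists {..<n}" 
      using fs(1) by (simp only: lists_image[symmetric]) (simp add: lists_eq_set)
    then obtain js where js: "fs = map x js" "set js \<subseteq> {..<n}" by (auto simp: lists_eq_set)
    have mS: "prod_list fs \<in> Sq s q" using Sq_prod_list[of fs 1] fs by simp
    have len: "length js = q" using fs(2) js by simp
    have prods: "prod_list (map (\<lambda>j. u * w j) ks) = u ^ length ks * prod_list (map w ks)"
      for u :: "'a \<Rightarrow> complex" and w :: "nat \<Rightarrow> 'a \<Rightarrow> complex" and ks
      by (induction ks) (simp_all add: mult_ac)
    have swap: "(u ^ k) ^ l = (u ^ l) ^ k" for u :: "'a \<Rightarrow> complex" and k l
      by (simp add: power_mult[symmetric] mult.commute)
    \<comment> \<open>The exponent q (q - 1) of x_0 is distributed as one factor x_0^(q-1) for each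
      of the \<open>q\<close> variables of the monomial.\<close>
    have "prod_list fs * (x 0 ^ q) ^ (q - 1) = prod_list (map ?m js)"
      unfolding prods len js(1) swap[of "x 0" "q - 1" q] by (rule mult.commute)
    then have "\<phi> (prod_list fs) * P 0 ^ (q - 1) = \<phi> (prod_list (map ?m js))"
      using mS n by (simp add: phi_mult[symmetric] phi_power[symmetric] P_def x_pow_Sq Sq_closed)
    also have "\<dots> = prod_list (map \<phi> (map ?m js))"
      using phi_prod_list[of "map ?m js"] x_mono(3)[OF n] js(2) by auto
    also have "\<dots> = prod_list (map (\<lambda>j. y 0 ^ (q - 1) * Y j) js)"
    proof -
      have "\<phi> (?m j) = y 0 ^ (q - 1) * Y j" if "j \<in> set js" for j
        using js(2) that by (intro mY) auto
      then show ?thesis unfolding map_map o_def by (simp only: cong: map_cong)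
    qed
    also have "\<dots> = P 0 ^ (q - 1) * prod_list (map Y js)"
      unfolding prods len y(2)[OF n] swap[of "y 0" "q - 1" q] ..
    finally have "P 0 ^ (q - 1) * (\<phi> (prod_list fs) - prod_list (map Y js)) = 0"
      by (simp add: algebra_simps)
    moreover have "P 0 ^ (q - 1) \<noteq> 0"
    proof -
      obtain v where "P 0 v \<noteq> 0" using P_nonzero[OF n] by (auto simp: fun_eq_iff fapply)
      then have "(P 0 ^ (q - 1)) v \<noteq> 0 v" by (simp add: fapply)
      then show ?thesis by metis
    qed
    moreover have "P 0 ^ (q - 1) \<in> Pol" using P_Pol[OF n] by (intro Pol_closed)
    moreover have "\<phi> (prod_list fs) \<in> Pol"
      using phi_Pol[OF Pol_prod_list_x[OF fs(1)]] homog_prod_list_x[OF fs(1)] fs(2) by simp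
    moreover have "prod_list (map Y js) \<in> Pol"
      unfolding Pol_def using Y_lin linfun_Pol js(2) by (intro ga_prod_list) (auto simp: Pol_def)
    ultimately have "\<phi> (prod_list fs) - prod_list (map Y js) = 0"
      using Pol_domain Pol_closed(8) by blast
    then have "\<phi> (prod_list fs) = prod_list (map Y js)" by simp
    also have "\<dots> = prod_list fs \<circ> g"
      unfolding js(1) using js(2) xg
    proof (induction js)
      case Nil
      show ?case by (simp add: fun_eq_iff fapply)
    next
      case (Cons j js)
      have "set js \<subseteq> {..<n}" "j < n" using Cons.prems(1) by auto
      from Cons.IH[OF this(1) Cons.prems(2)] Cons.prems(2)[OF this(2)]
      show ?case by (simp only: list.map prod_list.Cons comp_fun_simps)
    qed
    finally show ?thesis .
  qed
  have homog_case: "\<phi> f = f \<circ> g" if f: "f \<in> Pol" "homog q f" for f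
  proof -
    have "f \<in> Sq s q \<and> \<phi> f = f \<circ> g" using homog_span_prod_list[OF f]
    proof (induction rule: fv.span_induct_alt)
      case base
      then show ?case by (simp add: phi_zero Sq_closed comp_fun_simps)
    next
      case (step c m f)
      then obtain fs where fs: "m = prod_list fs" "set fs \<subseteq> x ` {..<n}" "length fs = q" by blast
      have m: "m \<in> Sq s q" unfolding fs(1) using Sq_prod_list[of fs 1] fs by simp
      have "\<phi> m = m \<circ> g" unfolding fs(1) by (rule monomials[OF fs(2,3)])
      moreover have "\<phi> (fscale c m + f) = fscale c (\<phi> m) + \<phi> f"
        using m step(2) by (simp add: phi_add phi_scale Sq_closed)
      ultimately have "\<phi> (fscale c m + f) = (fscale c m + f) \<circ> g"
        using step(2) by (simp only: comp_fun_simps)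
      moreover have "fscale c m + f \<in> Sq s q" using m step(2) by (simp add: Sq_closed)
      ultimately show ?case by (intro conjI)
    qed
    then show ?thesis ..
  qed
  have "Sq s q \<subseteq> {f \<in> Sq s q. \<phi> f = f \<circ> g}"
    unfolding Sq_eq[of q]
  proof (rule ga_subsetI)
    show "{f \<in> Pol. homog q f} \<subseteq> {f \<in> generated_algebra {f \<in> Pol. homog q f}. \<phi> f = f \<circ> g}"
      using homog_case by (auto intro: generated_algebra.gen)
    have "\<phi> (fscale c 1) = fscale c 1" for c using phi_scale[OF Sq_closed(1)] phi_one by simp
    moreover have "fscale c 1 = (\<lambda>v::'a. c)" for c by (simp add: fscale_def one_fun_def)
    ultimately show "(\<lambda>v. c) \<in> {f \<in> generated_algebra {f \<in> Pol. homog q f}. \<phi> f = f \<circ> g}" for c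
      by (simp add: comp_fun_simps generated_algebra.const)
  qed (auto simp: phi_add phi_mult comp_fun_simps Sq_eq[symmetric] Sq_closed)
  then have all: "\<forall>f\<in>Sq s q. \<phi> f = f \<circ> g" by blast
  \<comment> \<open>A vector killed by \<open>g\<close> is a common zero of the P_j, and those have
    only the origin in common.\<close>
  have "inj g"
  proof (rule injI)
    fix u v assume uv: "g u = g v"
    have "g (u - v) = 0" using linmapD(1)[OF g_lin, of "u - v" v] uv by simp
    then have "P j (u - v) = 0" if "j < n" for j
      using all x_pow_Sq[OF that] q linfun_0[OF linfun_x[OF that]]
      by (simp add: P_def fapply zero_power)
    then have "u - v = 0" by (rule P_common_zero)
    then show "u = v" by simp
  qed
  interpret fd: finite_dimensional_vector_space s B by (rule fd)
  have "bij g" using fd.linear_inj_imp_surj[of g] \<open>inj g\<close> g_lin linmap_iff by (simp add: bij_def)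
  then show ?thesis using g_lin all by blast
qed

end

section \<open>Projective reflection groups\<close>

lemma exists_coord_space:
  fixes s :: "complex \<Rightarrow> 'v::ab_group_add \<Rightarrow> 'v"
  assumes "finite_dimensional_vector_space s B"
  shows "\<exists>x e. coord_space s (vector_space.dim s (UNIV :: 'v set)) x e"
proof -
  interpret finite_dimensional_vector_space s B by fact
  obtain h where h: "bij_betw h {0..<card B} B"
    using ex_bij_betw_nat_finite[OF finite_Basis] by blast
  define x where "x i v = representation B v (h i)" for i v
  have mem: "h i \<in> B" if "i < card B" for i
    using h that by (auto simp: bij_betw_def)
  have "coord_space s (card B) x h"
  proof (rule coord_space.intro[OF vector_space_axioms], rule coord_space_axioms.intro)
    show "Vector_Spaces.linear s (*) (x i)" for i
      unfolding Vector_Spaces.linear_def module_hom_def module_hom_axioms_def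
      using vector_space_axioms vector_space_complex
      by (auto simp: x_def module_iff_vector_space representation_add representation_scale
          independent_Basis span_Basis)
  next
    fix i j assume i: "i < card B" and j: "j < card B"
    have "(h i = h j) = (i = j)" using h i j by (auto simp: bij_betw_def inj_on_def)
    then show "x i (h j) = (if i = j then 1 else 0)"
      using representation_basis[OF independent_Basis mem[OF j]] by (simp add: x_def)
  next
    fix v
    have "(\<Sum>i<card B. s (x i v) (h i)) = (\<Sum>b\<in>B. s (representation B v b) b)"
      using sum.reindex_bij_betw[OF h, of "\<lambda>b. s (representation B v b) b"]
      by (simp add: x_def atLeast0LessThan)
    also have "\<dots> = v"
      by (rule sum_representation_eq[OF independent_Basis]) (auto simp: span_Basis finite_Basis)
    finally show "(\<Sum>i<card B. s (x i v) (h i)) = v" .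
  qed
  then show ?thesis by auto
qed

lemma exp_root_power_eq_1:
  assumes "q > 0" "exp (2 * of_real pi * \<i> / of_nat q) ^ d = (1 :: complex)"
  shows "q dvd d"
proof -
  let ?z = "exp (2 * of_real pi * \<i> / of_nat q) :: complex"
  have z: "?z ^ k = cis (2 * pi * real k / real q)" for k
    unfolding exp_of_nat_mult[symmetric] cis_conv_exp by (simp add: mult_ac)
  have "?z ^ q = 1" unfolding z using assms(1) by simp
  then have "?z ^ (d mod q) = ?z ^ d"
    by (metis mult_div_mod_eq power_add power_mult power_one mult_1)
  then have "cis (2 * pi * real (d mod q) / real q) = cis (2 * pi * real 0 / real q)"
    using assms(2) unfolding z by simp
  then have "d mod q = 0"
    using bij_betw_roots_unity[OF assms(1)] assms(1) unfolding bij_betw_def inj_on_def by auto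
  then show ?thesis by auto
qed

lemma funpow_bij_finite:
  assumes "finite W" "id \<in> W" "\<And>g h. g \<in> W \<Longrightarrow> h \<in> W \<Longrightarrow> g \<circ> h \<in> W" "g \<in> W" "bij g"
  shows "\<exists>k>0. g ^^ k = id"
proof -
  have mem: "g ^^ k \<in> W" for k
    by (induction k) (simp_all only: funpow.simps assms)
  have "\<not> inj (\<lambda>k. g ^^ k)"
  proof
    assume "inj (\<lambda>k. g ^^ k)"
    then have "infinite (range (\<lambda>k. g ^^ k))" by (simp add: finite_image_iff)
    moreover have "range (\<lambda>k. g ^^ k) \<subseteq> W" using mem by auto
    ultimately show False using finite_subset assms(1) by blast
  qed
  then obtain a b where ab: "a < b" "g ^^ a = g ^^ b" unfolding inj_def by (metis linorder_neqE_nat)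
  have inj: "inj (g ^^ a)" using assms(5) by (intro inj_fn) (simp add: bij_is_inj)
  have "(g ^^ a) ((g ^^ (b - a)) v) = (g ^^ a) v" for v
    using ab by (metis funpow_add comp_apply le_add_diff_inverse less_imp_le)
  then have "(g ^^ (b - a)) v = v" for v using inj by (simp add: inj_eq)
  then have "g ^^ (b - a) = id" by auto
  then show ?thesis using ab(1) by (intro exI[of _ "b - a"]) auto
qed

locale fd_coord = coord_space s n x e + finite_dimensional_vector_space s B
  for s :: "complex \<Rightarrow> 'v::ab_group_add \<Rightarrow> 'v" and n x e B
begin

section \<open>The general linear group and its reflections\<close>

abbreviation "GLs \<equiv> GL_group s"

lemma GL_carrier: "g \<in> carrier GLs \<longleftrightarrow> linmap g \<and> bij g"
  by (simp add: GL_group_def linmap_iff)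

lemma Bij_UNIV: "Bij UNIV = {g. bij g}"
  by (auto simp: Bij_def extensional_def)

lemma GL_mult: "g \<in> carrier GLs \<Longrightarrow> h \<in> carrier GLs \<Longrightarrow> g \<otimes>\<^bsub>GLs\<^esub> h = g \<circ> h"
  by (simp add: GL_group_def BijGroup_def Bij_UNIV compose_def fun_eq_iff)

lemma GL_one: "\<one>\<^bsub>GLs\<^esub> = id"
  by (simp add: GL_group_def BijGroup_def fun_eq_iff)

lemma linmap_inv:
  assumes "linmap g" "bij g"
  shows "linmap (inv_into UNIV g)"
  unfolding linmap_def
proof (intro conjI allI)
  have gi: "g (inv_into UNIV g v) = v" for v using assms(2) by (simp add: bij_is_surj surj_f_inv_f)
  have ig: "inv_into UNIV g (g v) = v" for v using assms(2) by (simp add: bij_is_inj)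
  show "inv_into UNIV g (u + v) = inv_into UNIV g u + inv_into UNIV g v" for u v
    using ig[of "inv_into UNIV g u + inv_into UNIV g v"] by (simp add: linmapD[OF assms(1)] gi)
  show "inv_into UNIV g (s c v) = s c (inv_into UNIV g v)" for c v
    using ig[of "s c (inv_into UNIV g v)"] by (simp add: linmapD[OF assms(1)] gi)
qed

lemma GL_inv_carrier: "g \<in> carrier GLs \<Longrightarrow> inv_into UNIV g \<in> carrier GLs"
  by (simp add: GL_carrier linmap_inv bij_imp_bij_inv)

lemma inv_comp: "bij g \<Longrightarrow> inv_into UNIV g \<circ> g = id" "bij g \<Longrightarrow> g \<circ> inv_into UNIV g = id"
  by (auto simp: fun_eq_iff bij_is_inj bij_is_surj surj_f_inv_f)

lemma GL_is_group: "group GLs"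
proof (rule groupI)
  show "g \<otimes>\<^bsub>GLs\<^esub> h \<in> carrier GLs" if "g \<in> carrier GLs" "h \<in> carrier GLs" for g h
    using that by (simp add: GL_mult) (simp add: GL_carrier linmap_comp bij_comp)
  show one: "\<one>\<^bsub>GLs\<^esub> \<in> carrier GLs" by (simp add: GL_one GL_carrier linmap_def)
  show "\<one>\<^bsub>GLs\<^esub> \<otimes>\<^bsub>GLs\<^esub> g = g" if "g \<in> carrier GLs" for g
    using GL_mult[OF one that] by (simp add: GL_one)
  show "\<exists>h\<in>carrier GLs. h \<otimes>\<^bsub>GLs\<^esub> g = \<one>\<^bsub>GLs\<^esub>" if "g \<in> carrier GLs" for g
    using GL_inv_carrier[OF that] that
    by (intro bexI[of _ "inv_into UNIV g"]) (auto simp: GL_mult GL_one GL_carrier inv_comp)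
  show "g \<otimes>\<^bsub>GLs\<^esub> h \<otimes>\<^bsub>GLs\<^esub> k = g \<otimes>\<^bsub>GLs\<^esub> (h \<otimes>\<^bsub>GLs\<^esub> k)"
    if "g \<in> carrier GLs" "h \<in> carrier GLs" "k \<in> carrier GLs" for g h k
  proof -
    have "g \<circ> h \<in> carrier GLs" "h \<circ> k \<in> carrier GLs"
      using that by (simp_all add: GL_carrier linmap_comp bij_comp)
    then show ?thesis using that by (simp add: GL_mult comp_assoc)
  qed
qed

sublocale GL: group GLs
  by (rule GL_is_group)

lemma GL_inv: "g \<in> carrier GLs \<Longrightarrow> inv\<^bsub>GLs\<^esub> g = inv_into UNIV g"
  by (rule GL.inv_equality) (auto simp: GL_mult GL_inv_carrier GL_one GL_carrier inv_comp linmap_inv bij_imp_bij_inv)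

lemma natural_action_eq:
  "g \<in> carrier GLs \<Longrightarrow> natural_action s q g = (\<lambda>f\<in>Sq s q. f \<circ> inv_into UNIV g)"
  by (simp add: natural_action_def GL_inv fun_eq_iff)

text \<open>In codimension 1 the fixed space and one vector \<open>b\<close> outside it span
  \<open>V\<close>. So v - k b is fixed for some k, which gives g v = v + k (g b - b); a coordinate
  not vanishing at g b - b reads off k linearly in v.\<close>

lemma is_reflection_imp_refl_map:
  assumes "is_reflection s g"
  shows "refl_map g" and "g \<noteq> id"
proof -
  let ?U = "{v. g v = v}"
  have g: "linmap g" and dimU: "dim ?U + 1 = dim UNIV"
    using assms by (auto simp: is_reflection_def GL_carrier)
  have sub: "subspace ?U" by (auto simp: subspace_def linmapD[OF g] linmap_0[OF g])
  show "g \<noteq> id" using dimU by auto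
  then obtain b where b: "g b \<noteq> b" by (metis ext id_apply)
  then have "b \<notin> span ?U" using sub by (simp add: span_eq_iff[THEN iffD2])
  then have "dim (insert b ?U) = dimension" using dimU by (simp add: dim_insert dimension_def)
  then have full: "span (insert b ?U) = UNIV" by (simp add: dim_eq_full)
  obtain i where i: "i < n" "x i (g b - b) \<noteq> 0" using x_nonzero[of "g b - b"] b by auto
  let ?l = "\<lambda>v. x i (g v - v) / x i (g b - b)"
  have "g v = v + s (?l v) (g b - b)" for v
  proof -
    have "v \<in> span (insert b ?U)" using full by simp
    then obtain k where "v - s k b \<in> span ?U" using span_breakdown_eq by blast
    then have "v - s k b \<in> ?U" using sub by (simp add: span_eq_iff[THEN iffD2])
    then have "g (v - s k b) = v - s k b" by simp
    moreover have "g v = g (v - s k b) + s k (g b)"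
      using linmapD(1)[OF g, of "v - s k b" "s k b"] linmapD(2)[OF g] by simp
    ultimately have gv: "g v = v + s k (g b - b)" by (simp add: scale_right_diff_distrib)
    then have "x i (g v - v) = k * x i (g b - b)" by (simp add: linfunD[OF linfun_x[OF i(1)]])
    then show ?thesis using gv i by simp
  qed
  moreover have "linfun ?l"
    by (simp add: linfun_def linfunD[OF linfun_x[OF i(1)]] linfun_diff[OF linfun_x[OF i(1)]] linmapD[OF g]
        add_divide_distrib diff_divide_distrib right_diff_distrib)
  moreover have "?l \<noteq> 0" using i by (auto simp: fun_eq_iff fapply intro!: exI[of _ b])
  ultimately show "refl_map g" unfolding refl_map_def by blast
qed

text \<open>For \<open>g\<close> other than the identity the vector \<open>a\<close> is nonzero, so
  the fixed space is the kernel of \<open>l\<close>, a hyperplane.\<close>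

lemma refl_map_imp_is_reflection:
  assumes "refl_map g" "g \<noteq> id" "g \<in> carrier GLs" "\<exists>k>0. g ^^ k = id"
  shows "is_reflection s g"
proof -
  obtain l a where l: "linfun l" "l \<noteq> 0" "\<And>v. g v = v + s (l v) a"
    using assms(1) unfolding refl_map_def by blast
  have a: "a \<noteq> 0" using assms(2) l(3) by (auto simp: fun_eq_iff)
  let ?U = "{v. g v = v}"
  have U: "?U = {v. l v = 0}" using a by (auto simp: l(3))
  obtain b where b: "l b \<noteq> 0" using l(2) by (auto simp: fun_eq_iff fapply)
  have sub: "subspace ?U" unfolding U by (auto simp: subspace_def linfunD[OF l(1)] linfun_0[OF l(1)])
  then have spanU: "span ?U = ?U" by (simp add: span_eq_iff[THEN iffD2])
  have "v \<in> span (insert b ?U)" for v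
    unfolding span_breakdown_eq spanU
    by (rule exI[of _ "l v / l b"]) (use b in \<open>simp add: U linfun_diff[OF l(1)] linfunD[OF l(1)]\<close>)
  then have "span (insert b ?U) = UNIV" by auto
  then have "dim (insert b ?U) = dim UNIV" by (metis dim_span)
  moreover have "b \<notin> span ?U" unfolding spanU using b U by auto
  ultimately show ?thesis using assms(3,4) by (simp add: is_reflection_def dim_insert)
qed

lemma subgroup_fin_lin_group:
  assumes W: "subgroup W GLs" "finite W"
  shows "fin_lin_group s n x e W"
proof
  have car: "g \<in> carrier GLs" if "g \<in> W" for g using that subgroup.subset[OF W(1)] by blast
  show "finite W" by fact
  show "id \<in> W" using subgroup.one_closed[OF W(1)] by (simp add: GL_one)
  show "g \<circ> h \<in> W" if "g \<in> W" "h \<in> W" for g h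
    using subgroup.m_closed[OF W(1) that] car that by (simp add: GL_mult)
  show "linmap g" if "g \<in> W" for g using car[OF that] by (simp add: GL_carrier)
  show "\<exists>h\<in>W. g \<circ> h = id \<and> h \<circ> g = id" if "g \<in> W" for g
    using subgroup.m_inv_closed[OF W(1) that] car[OF that]
    by (intro bexI[of _ "inv_into UNIV g"]) (auto simp: GL_inv GL_carrier inv_comp)
qed

lemma finite_reflection_refl_group:
  assumes W: "finite_reflection_group s W"
  shows "refl_group s n x e W"
proof -
  have sg: "subgroup W GLs" "finite W" using W by (auto simp: finite_reflection_group_def)
  interpret fin_lin_group s n x e W by (rule subgroup_fin_lin_group[OF sg])
  obtain R where R: "\<And>g. g \<in> R \<Longrightarrow> is_reflection s g" "W = generate GLs R"
    using W by (auto simp: finite_reflection_group_def)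
  have car: "g \<in> carrier GLs" if "g \<in> W" for g using that subgroup.subset[OF sg(1)] by blast
  show ?thesis
  proof
    fix X assume X: "id \<in> X" "\<And>g h. g \<in> W \<Longrightarrow> refl_map g \<Longrightarrow> h \<in> X \<Longrightarrow> g \<circ> h \<in> X"
    have RX: "g \<circ> h \<in> X" if "g \<in> R" "h \<in> X" for g h
      using X(2) R that generate.incl[of g R GLs] is_reflection_imp_refl_map(1) by blast
    have "w \<circ> h \<in> X" if "w \<in> generate GLs R" "h \<in> X" for w h
      using that
    proof (induction arbitrary: h)
      case one
      then show ?case by (simp add: GL_one)
    next
      case (incl g)
      then show ?case using RX by blast
    next
      case (inv g)
      \<comment> \<open>A reflection has finite order, so its inverse is a power and is covered by
        repeated left multiplication with the reflection itself.\<close>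
      obtain k where k: "k > 0" "g ^^ k = id" using R(1)[OF inv(1)] by (auto simp: is_reflection_def)
      have g: "g \<in> carrier GLs" using R(1)[OF inv(1)] by (simp add: is_reflection_def)
      have "g \<circ> g ^^ (k - 1) = id" using k by (metis Suc_pred' funpow.simps(2))
      then have "inv_into UNIV g \<circ> (g \<circ> g ^^ (k - 1)) = inv_into UNIV g" by simp
      then have eq: "inv\<^bsub>GLs\<^esub> g = g ^^ (k - 1)"
        using g by (simp add: GL_inv GL_carrier inv_comp comp_assoc[symmetric])
      have "g ^^ m \<circ> h \<in> X" for m
        by (induction m) (simp_all only: funpow.simps comp_assoc id_comp RX[OF inv(1)] inv(2))
      then show ?case unfolding eq .
    next
      case (eng g1 g2)
      then have "g1 \<in> carrier GLs" "g2 \<in> carrier GLs" using car R(2) by auto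
      then have "(g1 \<otimes>\<^bsub>GLs\<^esub> g2) \<circ> h = g1 \<circ> (g2 \<circ> h)" by (simp add: GL_mult comp_assoc)
      then show ?case using eng by simp
    qed
    from this[OF _ X(1)] show "W \<subseteq> X" unfolding R(2) by auto
  qed
qed

section \<open>The linear action on the Veronese algebra and its invariants\<close>

lemma Sq_comp:
  assumes "linmap g" "f \<in> Sq s q"
  shows "f \<circ> g \<in> Sq s q"
proof -
  let ?S = "{f \<in> Pol. homog q f}"
  have "generated_algebra ?S \<subseteq> {f. f \<circ> g \<in> generated_algebra ?S}"
  proof (rule ga_subsetI)
    show "?S \<subseteq> {f. f \<circ> g \<in> generated_algebra ?S}"
      using assms(1) by (auto intro!: generated_algebra.gen Pol_comp homog_comp)
    show "(\<lambda>v. c) \<in> {f. f \<circ> g \<in> generated_algebra ?S}" for c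
      by (simp only: comp_fun_simps mem_Collect_eq generated_algebra.const)
  qed (simp_all only: comp_fun_simps mem_Collect_eq ga_add ga_mult)
  then have "Sq s q \<subseteq> {f. f \<circ> g \<in> Sq s q}" unfolding Sq_eq .
  then show ?thesis using assms(2) by blast
qed

lemma Sq_root_invariant:
  assumes "c ^ q = 1" "f \<in> Sq s q"
  shows "f \<circ> s c = f"
proof -
  have "Sq s q \<subseteq> {f. f \<circ> s c = f}"
    unfolding Sq_eq
  proof (rule ga_subsetI)
    show "{f \<in> Pol. homog q f} \<subseteq> {f. f \<circ> s c = f}"
      using assms(1) by (auto simp: homogD fun_eq_iff)
  qed (simp_all only: comp_fun_simps mem_Collect_eq)
  then show ?thesis using assms(2) by blast
qed

lemma scalar_GL:
  assumes "c \<noteq> 0"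
  shows "s c \<in> carrier GLs" and "inv_into UNIV (s c) = s (1 / c)"
proof -
  have b: "s c (s (1 / c) v) = v" "s (1 / c) (s c v) = v" for v using assms by auto
  have bij: "bij (s c)" by (rule bijI', metis b, metis b)
  then show "s c \<in> carrier GLs"
    by (simp add: GL_carrier linmap_def scale_right_distrib mult.commute)
  show "inv_into UNIV (s c) = s (1 / c)" by (rule inv_equality) (use b in auto)
qed

text \<open>As \<open>W\<close> contains a primitive q-th root of unity z as a scalar, the degree-d
  component f_d of a \<open>W\<close>-invariant satisfies z^d f_d = f_d, so it vanishes unless
  \<open>q\<close> divides d. Hence all polynomial invariants of \<open>W\<close> lie in the
  Veronese algebra already.\<close>

lemma invariant_algebra_eq:
  assumes q: "q > 0" and W: "subgroup W GLs" "finite W" "Cq s q \<subseteq> W"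
  shows "invariant_algebra s q (natural_action s q ` W) = fin_lin_group.invs n x W"
proof -
  interpret fin_lin_group s n x e W by (rule subgroup_fin_lin_group[OF W(1) W(2)])
  have car: "g \<in> carrier GLs" if "g \<in> W" for g using that subgroup.subset[OF W(1)] by blast
  have inv_mem: "inv_into UNIV g \<in> W" if "g \<in> W" for g
    using subgroup.m_inv_closed[OF W(1) that] by (simp add: GL_inv car that)
  let ?z = "exp (2 * of_real pi * \<i> / of_nat q) :: complex"
  have z: "s ?z \<in> W" using W(3) generate.incl[of "s ?z" "{s ?z}" GLs] by (auto simp: Cq_def)
  have Sq: "f \<in> Sq s q" if f: "f \<in> invs" for f
  proof -
    have fP: "f \<in> Pol" using f by (rule invs_Pol)
    have "hc d f \<in> Sq s q" for d
    proof (cases "q dvd d")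
      case True
      then obtain k where "d = k * q" by (metis dvd_def mult.commute)
      then show ?thesis using hc_Sq[OF fP] by simp
    next
      case False
      have "?z ^ d * hc d f v = hc d f v" for v
        using invs_apply[OF invs_hc[OF f] z, of d v] homogD[OF homog_hc[OF Pol_polylike[OF fP]], of d ?z v]
        by simp
      then have "hc d f v = 0" for v using exp_root_power_eq_1[OF q, of d] False
        by (metis mult_cancel_right1)
      then have "hc d f = 0" by (simp add: fun_eq_iff fapply)
      then show ?thesis unfolding Sq_eq using ga_zero by simp
    qed
    moreover obtain N where "\<And>d. d > N \<Longrightarrow> hc d f = 0" using Pol_bound[OF fP] by blast
    then have "f = (\<Sum>d\<le>N. hc d f)" by (rule hc_decomp[OF Pol_polylike[OF fP]])
    ultimately show ?thesis unfolding Sq_eq using ga_sum[of "{..N}" "\<lambda>d. hc d f"] by simp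
  qed
  show "invariant_algebra s q (natural_action s q ` W) = invs"
  proof (rule Set.set_eqI)
    fix f
    show "f \<in> invariant_algebra s q (natural_action s q ` W) \<longleftrightarrow> f \<in> invs"
    proof
      assume f: "f \<in> invs"
      then show "f \<in> invariant_algebra s q (natural_action s q ` W)"
        using Sq[OF f] invsD[OF f inv_mem] by (auto simp: invariant_algebra_def natural_action_eq car)
    next
      assume f: "f \<in> invariant_algebra s q (natural_action s q ` W)"
      then have fS: "f \<in> Sq s q" and fi: "\<And>g. g \<in> W \<Longrightarrow> f \<circ> inv_into UNIV g = f"
        by (auto simp: invariant_algebra_def natural_action_eq car)
      have "f \<circ> g = f" if g: "g \<in> W" for g
      proof -
        have "bij g" using car[OF g] by (simp add: GL_carrier)
        then show ?thesis using fi[OF inv_mem[OF g]] by (simp add: inv_inv_eq)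
      qed
      then show "f \<in> invs" using fS Sq_Pol by (auto simp: invs_def)
    qed
  qed
qed

lemma projective_imp_polynomial:
  assumes q: "q > 0" and proj: "projective_reflection_group s G q"
  shows "\<exists>F. (\<forall>i<n. \<exists>d. F i \<in> homogeneous_polynomials s d) \<and> algebraically_independent n F \<and>
    generated_algebra (F ` {..<n}) = invariant_algebra s q G"
proof -
  obtain W where W: "finite_reflection_group s W" "Cq s q \<subseteq> W" "G = natural_action s q ` W"
    using proj by (auto simp: projective_reflection_group_def)
  interpret refl_group s n x e W by (rule finite_reflection_refl_group[OF W(1)])
  have eq: "invariant_algebra s q G = invs"
    unfolding W(3) using W(1,2) q by (intro invariant_algebra_eq) (auto simp: finite_reflection_group_def)
  obtain h where h: "\<forall>i<n. h i \<in> invs \<and> (\<exists>d>0. homog d (h i))" "alg_indep n h"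
    "generated_algebra (h ` {..<n}) = invs" using Chevalley by blast
  show ?thesis
    unfolding eq using h invs_Pol
    by (intro exI[of _ h]) (auto simp: homogeneous_polynomials_eq algebraically_independent_iff)
qed

lemma graded_automorphism_lift:
  assumes q: "q > 0" and phi: "\<phi> \<in> graded_automorphisms s q"
  shows "\<exists>g\<in>carrier GLs. \<phi> = natural_action s q g"
proof -
  have bij: "bij_betw \<phi> (Sq s q) (Sq s q)" "\<phi> \<in> extensional (Sq s q)"
    using phi by (auto simp: graded_automorphisms_def Bij_def)
  have "\<phi> ` (Sq s q \<inter> homogeneous_polynomials s q) = Sq s q \<inter> homogeneous_polynomials s q"
    using phi by (auto simp: graded_automorphisms_def)
  moreover have "Sq s q \<inter> homogeneous_polynomials s q = {f \<in> Pol. homog q f}"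
    using Sq_gen by (auto simp: homogeneous_polynomials_eq)
  ultimately have hom: "\<phi> ` {f \<in> Pol. homog q f} = {f \<in> Pol. homog q f}" by simp
  interpret graded_aut s n x e q \<phi> B
  proof
    show "\<phi> 1 = 1" using phi by (simp add: graded_automorphisms_def one_fun_def)
    show "\<phi> (fscale c f) = fscale c (\<phi> f)" if "f \<in> Sq s q" for c f
      using phi that by (simp add: graded_automorphisms_def fscale_def)
    show "\<phi> (f + g) = \<phi> f + \<phi> g" if "f \<in> Sq s q" "g \<in> Sq s q" for f g
      using phi that by (simp add: graded_automorphisms_def plus_fun_def)
    show "\<phi> (f * g) = \<phi> f * \<phi> g" if "f \<in> Sq s q" "g \<in> Sq s q" for f g
      using phi that by (simp add: graded_automorphisms_def times_fun_def)
  qed (use q bij hom finite_dimensional_vector_space_axioms in \<open>auto simp: bij_betw_def\<close>)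
  obtain g where g: "linmap g" "bij g" "\<And>f. f \<in> Sq s q \<Longrightarrow> \<phi> f = f \<circ> g" using linear_lift by blast
  then have gc: "inv_into UNIV g \<in> carrier GLs" using GL_inv_carrier by (simp add: GL_carrier)
  \<comment> \<open>The natural action composes with the inverse, so the lift is the inverse of the
    map provided by \<open>linear_lift\<close>.\<close>
  have "\<phi> = natural_action s q (inv_into UNIV g)"
    unfolding natural_action_eq[OF gc] inv_inv_eq[OF g(2)]
    by (rule extensionalityI[OF bij(2)]) (auto simp: g(3))
  then show ?thesis using gc by blast
qed

section \<open>The preimage of G in the general linear group\<close>

context
  fixes q :: nat and G :: "(('v \<Rightarrow> complex) \<Rightarrow> 'v \<Rightarrow> complex) set"
  assumes q: "q > 0" and G: "subgroup G (graded_automorphism_group s q)" "finite G"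
begin

text \<open>The full preimage, not one chosen lift for each element of \<open>G\<close>: it is
  therefore a group and contains C_q.\<close>

definition preimage :: "('v \<Rightarrow> 'v) set" where
  "preimage = {g \<in> carrier GLs. natural_action s q g \<in> G}"

lemma G_graded: "\<phi> \<in> G \<Longrightarrow> \<phi> \<in> graded_automorphisms s q"
  using subgroup.subset[OF G(1)] by (auto simp: graded_automorphism_group_def)

lemma image_preimage: "natural_action s q ` preimage = G"
  using graded_automorphism_lift[OF q G_graded] by (auto simp: preimage_def)

lemma preimage_comp:
  assumes g: "g \<in> preimage" and h: "h \<in> preimage"
  shows "g \<circ> h \<in> preimage"
proof -
  have gh: "g \<in> carrier GLs" "h \<in> carrier GLs" and na: "natural_action s q g \<in> G" "natural_action s q h \<in> G"
    using g h by (auto simp: preimage_def)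
  have ghc: "g \<circ> h \<in> carrier GLs" using gh by (simp add: GL_carrier linmap_comp bij_comp)
  have "natural_action s q g \<in> Bij (Sq s q)" "natural_action s q h \<in> Bij (Sq s q)"
    using G_graded[OF na(1)] G_graded[OF na(2)] by (auto simp: graded_automorphisms_def)
  then have "natural_action s q g \<otimes>\<^bsub>graded_automorphism_group s q\<^esub> natural_action s q h =
      compose (Sq s q) (natural_action s q g) (natural_action s q h)"
    by (simp add: graded_automorphism_group_def BijGroup_def)
  also have "\<dots> = natural_action s q (g \<circ> h)"
  proof -
    have "inv_into UNIV (g \<circ> h) = inv_into UNIV h \<circ> inv_into UNIV g"
      using gh by (simp add: o_inv_distrib GL_carrier)
    moreover have "f \<circ> inv_into UNIV h \<in> Sq s q" if "f \<in> Sq s q" for f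
      using that gh by (intro Sq_comp linmap_inv) (auto simp: GL_carrier)
    ultimately show ?thesis
      by (auto simp: natural_action_eq gh ghc compose_def restrict_def fun_eq_iff)
  qed
  finally show ?thesis using subgroup.m_closed[OF G(1) na] ghc by (simp add: preimage_def)
qed

lemma root_preimage:
  assumes c: "c ^ q = 1"
  shows "s c \<in> preimage"
proof -
  have c0: "c \<noteq> 0" using c q by (auto simp: zero_power)
  have "(1 / c) ^ q = 1" using c by (simp add: power_divide)
  then have "natural_action s q (s c) = (\<lambda>f\<in>Sq s q. f)"
    unfolding natural_action_eq[OF scalar_GL(1)[OF c0]] scalar_GL(2)[OF c0]
    by (auto simp: restrict_def fun_eq_iff Sq_root_invariant)
  also have "\<dots> \<in> G"
    using subgroup.one_closed[OF G(1)] by (simp add: graded_automorphism_group_def BijGroup_def)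
  finally show ?thesis using scalar_GL(1)[OF c0] by (simp add: preimage_def)
qed

lemma id_preimage: "id \<in> preimage"
proof -
  have "s 1 = id" by auto
  then show ?thesis using root_preimage[of 1] by simp
qed

text \<open>A linear bijection \<open>g\<close> is determined by the functions x_i o g^(-1). Each of
  them is a q-th root of \<phi>(x_i^q) for some \<phi> in \<open>G\<close>, and q-th roots in
  \<open>Pol\<close> differ only by roots of unity.\<close>

lemma finite_preimage: "finite preimage"
proof -
  define U where "U = (\<Union>\<phi>\<in>G. \<Union>i\<in>{..<n}. {u \<in> Pol. u ^ q = \<phi> (x i ^ q)})"
  have "finite {u \<in> Pol. u ^ q = p}" for p
  proof (cases "\<exists>u0\<in>Pol. u0 ^ q = p")
    case True
    then obtain u0 where u0: "u0 \<in> Pol" "u0 ^ q = p" by blast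
    have "{u \<in> Pol. u ^ q = p} \<subseteq> (\<lambda>z. fscale z u0) ` {z. z ^ q = 1}"
    proof
      fix u assume "u \<in> {u \<in> Pol. u ^ q = p}"
      then have "u \<in> Pol" "u ^ q = u0 ^ q" using u0(2) by auto
      then show "u \<in> (\<lambda>z. fscale z u0) ` {z. z ^ q = 1}"
        using power_eq_imp_root_of_unity[OF _ u0(1) q] by blast
    qed
    then show ?thesis using finite_subset finite_imageI[OF finite_roots_unity[of q]] q by auto
  next
    case False
    then have "{u \<in> Pol. u ^ q = p} = {}" by blast
    then show ?thesis by (simp only: finite.emptyI)
  qed
  then have finU: "finite U" unfolding U_def using G(2) by (intro finite_UN_I) auto
  define r where "r g = (\<lambda>i\<in>{..<n}. x i \<circ> inv_into UNIV g)" for g :: "'v \<Rightarrow> 'v"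
  have "r g \<in> {..<n} \<rightarrow>\<^sub>E U" if g: "g \<in> preimage" for g
  proof
    fix i assume i: "i \<in> {..<n}"
    have gc: "g \<in> carrier GLs" and na: "natural_action s q g \<in> G" using g by (auto simp: preimage_def)
    have xS: "x i ^ q \<in> Sq s q"
      using i homog_power[OF homog_linfun[OF linfun_x], of i q] by (intro Sq_gen Pol_closed) auto
    have "(x i \<circ> inv_into UNIV g) ^ q = natural_action s q g (x i ^ q)"
      using xS by (simp add: natural_action_eq[OF gc] fun_eq_iff fapply)
    moreover have "x i \<circ> inv_into UNIV g \<in> Pol"
      using i gc by (intro Pol_comp linmap_inv Pol_x) (auto simp: GL_carrier)
    ultimately show "r g i \<in> U" using i na by (auto simp: r_def U_def)
  qed (simp add: r_def)
  moreover have "inj_on r preimage"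
  proof (rule inj_onI)
    fix g h assume g: "g \<in> preimage" "h \<in> preimage" and rr: "r g = r h"
    have "x i (inv_into UNIV g v) = x i (inv_into UNIV h v)" if "i < n" for i v
    proof -
      have "x i \<circ> inv_into UNIV g = x i \<circ> inv_into UNIV h"
        using fun_cong[OF rr, of i] that by (simp add: r_def)
      then show ?thesis by (metis comp_apply)
    qed
    then have "inv_into UNIV g v = inv_into UNIV h v" for v by (rule x_sep)
    then have "inv_into UNIV g = inv_into UNIV h" by auto
    moreover have "bij g" "bij h" using g by (auto simp: preimage_def GL_carrier)
    ultimately show "g = h" by (metis inv_inv_eq)
  qed
  ultimately show ?thesis
    using inj_on_finite[of r preimage "{..<n} \<rightarrow>\<^sub>E U"] finite_PiE[of "{..<n}" "\<lambda>_. U"] finU by blast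
qed

lemma finite_order: "g \<in> preimage \<Longrightarrow> \<exists>k>0. g ^^ k = id"
  using funpow_bij_finite[OF finite_preimage id_preimage preimage_comp]
  by (auto simp: preimage_def GL_carrier)

lemma subgroup_preimage: "subgroup preimage GLs"
proof (rule GL.subgroupI)
  show "preimage \<subseteq> carrier GLs" by (auto simp: preimage_def)
  show "preimage \<noteq> {}" using id_preimage by blast
  show "g \<otimes>\<^bsub>GLs\<^esub> h \<in> preimage" if "g \<in> preimage" "h \<in> preimage" for g h
    using preimage_comp[OF that] that by (simp add: GL_mult preimage_def)
  show "inv\<^bsub>GLs\<^esub> g \<in> preimage" if g: "g \<in> preimage" for g
  proof -
    have gc: "g \<in> carrier GLs" using g by (simp add: preimage_def)
    obtain k where k: "k > 0" "g ^^ k = id" using finite_order[OF g] by blast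
    have "g \<circ> g ^^ (k - 1) = id" using k by (metis Suc_pred' funpow.simps(2))
    then have "inv_into UNIV g \<circ> (g \<circ> g ^^ (k - 1)) = inv_into UNIV g" by simp
    then have "inv\<^bsub>GLs\<^esub> g = g ^^ (k - 1)"
      using gc by (simp add: GL_inv GL_carrier inv_comp comp_assoc[symmetric])
    moreover have "g ^^ m \<in> preimage" for m
      by (induction m) (simp_all only: funpow.simps g preimage_comp id_preimage)
    ultimately show ?thesis by simp
  qed
qed

lemma Cq_preimage: "Cq s q \<subseteq> preimage"
proof -
  have "exp (2 * of_real pi * \<i> / of_nat q) ^ q = (1 :: complex)"
    unfolding exp_of_nat_mult[symmetric] using q by (simp add: exp_two_pi_i)
  then show ?thesis
    unfolding Cq_def by (intro GL.generate_subgroup_incl subgroup_preimage) (auto intro: root_preimage)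
qed

lemma polynomial_imp_projective:
  assumes F: "\<And>i. i < n \<Longrightarrow> \<exists>d. F i \<in> homogeneous_polynomials s d"
    and gen: "generated_algebra (F ` {..<n}) = invariant_algebra s q G"
  shows "projective_reflection_group s G q"
proof -
  interpret W: fin_lin_group s n x e preimage
    by (rule subgroup_fin_lin_group[OF subgroup_preimage finite_preimage])
  \<comment> \<open>All reflections of the preimage are taken, so that \<open>R\<close> is stable
    under conjugation and generates a normal subgroup.\<close>
  define R where "R = {g \<in> preimage. is_reflection s g}"
  define H where "H = generate GLs R"
  have RW: "R \<subseteq> preimage" by (auto simp: R_def)
  have H_sub: "H \<subseteq> preimage"
    unfolding H_def by (rule GL.generate_subgroup_incl[OF RW subgroup_preimage])
  have frH: "finite_reflection_group s H"
    unfolding finite_reflection_group_def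
  proof (intro conjI exI[of _ R])
    show "subgroup H GLs" unfolding H_def
      by (rule GL.generate_is_subgroup) (auto simp: R_def preimage_def)
    show "finite H" using H_sub finite_preimage finite_subset by blast
  qed (auto simp: R_def H_def)
  have car: "g \<in> carrier GLs" if "g \<in> preimage" for g using that by (simp add: preimage_def)
  have conj: "\<exists>h'\<in>R. w \<circ> h = h' \<circ> w" if w: "w \<in> preimage" and h: "h \<in> R" for w h
  proof -
    obtain k where k: "k \<in> preimage" "w \<circ> k = id" "k \<circ> w = id" using W.W_inv[OF w] by blast
    let ?h = "w \<circ> h \<circ> k"
    have hW: "h \<in> preimage" using h RW by blast
    have mem: "?h \<in> preimage" using w hW k(1) by (intro preimage_comp)
    have rh: "refl_map h" "h \<noteq> id" using h is_reflection_imp_refl_map by (auto simp: R_def)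
    obtain l a where l: "linfun l" "l \<noteq> 0" "\<And>v. h v = v + s (l v) a"
      using rh(1) unfolding refl_map_def by blast
    have wk: "w (k v) = v" "k (w v) = v" for v using fun_cong[OF k(2)] fun_cong[OF k(3)] by simp_all
    \<comment> \<open>Conjugation by \<open>w\<close> transports the form of the reflection to
      \<open>l \<circ> k\<close>, with \<open>k\<close> the inverse of \<open>w\<close>, and its
      vector to \<open>w a\<close>.\<close>
    have "?h v = v + s ((l \<circ> k) v) (w a)" for v
      by (simp add: l(3) linmapD[OF W.W_lin[OF w]] wk)
    moreover have "linfun (l \<circ> k)" by (rule linfun_comp[OF l(1) W.W_lin[OF k(1)]])
    moreover have "l \<circ> k \<noteq> 0"
    proof -
      obtain b where "l b \<noteq> 0" using l(2) by (auto simp: fun_eq_iff fapply)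
      then have "(l \<circ> k) (w b) \<noteq> 0 (w b)" by (simp add: wk fapply)
      then show ?thesis by metis
    qed
    ultimately have "refl_map ?h" unfolding refl_map_def by blast
    moreover have "?h \<noteq> id"
    proof
      assume "?h = id"
      then have "k (w (h (k (w v)))) = k (w v)" for v by (metis comp_apply id_apply)
      then have "h v = v" for v by (simp add: wk)
      then show False using rh(2) by auto
    qed
    ultimately have "?h \<in> R"
      using mem refl_map_imp_is_reflection[OF _ _ car[OF mem] finite_order[OF mem]] by (simp add: R_def)
    moreover have "w \<circ> h = ?h \<circ> w" by (simp add: comp_assoc k(3))
    ultimately show ?thesis by blast
  qed
  have normal: "\<exists>h'\<in>H. w \<circ> h = h' \<circ> w" if w: "w \<in> preimage" and h: "h \<in> H" for w h
    using h unfolding H_def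
  proof (induction)
    case one
    show ?case using generate.one[of GLs R] unfolding GL_one by (intro bexI[of _ id]) simp_all
  next
    case (incl h)
    then show ?case using conj[OF w incl] generate.incl[of _ R GLs] by blast
  next
    case (inv h)
    obtain h' where h': "h' \<in> R" "w \<circ> h = h' \<circ> w" using conj[OF w inv] by blast
    have c: "h \<in> carrier GLs" "h' \<in> carrier GLs" using inv h' RW car by blast+
    have b: "bij h" "bij h'" using c by (simp_all add: GL_carrier)
    have "inv_into UNIV h' \<circ> (w \<circ> h) \<circ> inv_into UNIV h = inv_into UNIV h' \<circ> (h' \<circ> w) \<circ> inv_into UNIV h"
      by (simp only: h'(2))
    moreover have "inv_into UNIV h' \<circ> (w \<circ> h) \<circ> inv_into UNIV h = inv_into UNIV h' \<circ> w"
      by (metis comp_assoc comp_id inv_comp(2)[OF b(1)])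
    moreover have "inv_into UNIV h' \<circ> (h' \<circ> w) \<circ> inv_into UNIV h = w \<circ> inv_into UNIV h"
      by (metis comp_assoc id_comp inv_comp(1)[OF b(2)])
    ultimately have "w \<circ> inv\<^bsub>GLs\<^esub> h = inv\<^bsub>GLs\<^esub> h' \<circ> w" using c by (simp add: GL_inv)
    then show ?case using generate.inv[OF h'(1), of GLs] by blast
  next
    case (eng h1 h2)
    obtain k1 k2 where k: "k1 \<in> generate GLs R" "k2 \<in> generate GLs R" "w \<circ> h1 = k1 \<circ> w" "w \<circ> h2 = k2 \<circ> w"
      using eng by blast
    have c: "h1 \<in> carrier GLs" "h2 \<in> carrier GLs" "k1 \<in> carrier GLs" "k2 \<in> carrier GLs"
      using eng k H_sub car unfolding H_def by blast+
    have "w \<circ> (h1 \<otimes>\<^bsub>GLs\<^esub> h2) = (w \<circ> h1) \<circ> h2" using c by (simp add: GL_mult comp_assoc)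
    also have "\<dots> = k1 \<circ> (w \<circ> h2)" unfolding k(3) by (rule comp_assoc)
    also have "\<dots> = (k1 \<otimes>\<^bsub>GLs\<^esub> k2) \<circ> w" using c by (simp add: GL_mult comp_assoc k(4))
    finally show ?case using generate.eng[OF k(1,2)] by blast
  qed
  have "fin_lin_group s n x e H"
    using frH by (intro subgroup_fin_lin_group) (auto simp: finite_reflection_group_def)
  then have "normal_subgroup s n x e preimage H"
    using W.fin_lin_group_axioms H_sub normal
    by (intro normal_subgroup.intro normal_subgroup_axioms.intro) auto
  then interpret refl_subgroup s n x e preimage H
  proof (rule refl_subgroup.intro[OF _ refl_subgroup_axioms.intro])
    show "refl_group s n x e H" by (rule finite_reflection_refl_group[OF frH])
    fix g assume g: "g \<in> preimage" "refl_map g"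
    show "g \<in> H"
    \<comment> \<open>\<open>refl_map\<close> admits the identity, which is not a reflection but
      belongs to \<open>H\<close> as its unit.\<close>
    proof (cases "g = id")
      case True
      then show ?thesis using generate.one[of GLs R] by (simp add: H_def GL_one)
    next
      case False
      then have "g \<in> R" using g refl_map_imp_is_reflection[OF _ _ car finite_order] by (simp add: R_def)
      then show ?thesis unfolding H_def by (rule generate.incl)
    qed
  qed
  have "invariant_algebra s q G = W.invs"
    using invariant_algebra_eq[OF q subgroup_preimage finite_preimage Cq_preimage]
    by (simp only: image_preimage)
  then have "preimage = H"
    using polynomial_invariants_imp_refl[of F] F gen by (auto simp: homogeneous_polynomials_eq)
  then show ?thesis
    unfolding projective_reflection_group_def using frH Cq_preimage image_preimage by metis
qed

end

end

theorem theorem2p2: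
  fixes s :: "complex \<Rightarrow> 'v::ab_group_add \<Rightarrow> 'v"
    and B :: "'v set"
    and n q :: nat
    and G :: "(('v \<Rightarrow> complex) \<Rightarrow> ('v \<Rightarrow> complex)) set"
  assumes V: "finite_dimensional_vector_space s B"
    and n: "n = vector_space.dim s (UNIV :: 'v set)"
    and q: "q > 0"
    and G: "subgroup G (graded_automorphism_group s q)" "finite G"
  shows "projective_reflection_group s G q \<longleftrightarrow>
    (\<exists>F :: nat \<Rightarrow> 'v \<Rightarrow> complex.
       (\<forall>i<n. \<exists>d. F i \<in> homogeneous_polynomials s d) \<and>
       algebraically_independent n F \<and>
       generated_algebra (F ` {..<n}) = invariant_algebra s q G)"
proof -
  obtain x e where "coord_space s n x e"
    using exists_coord_space[OF V] n by blast
  then interpret fd_coord s n x e B using V by (simp add: fd_coord_def)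
  show ?thesis
    using projective_imp_polynomial[OF q, of G] polynomial_imp_projective[OF q G] by blast
qed

end
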